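(* Let $(M,g)$ be a smooth compact connected Riemannian manifold of dimension $n+1\ge 2$ whose boundary $\Sigma$ has $b\geq 1$ connected components, and assume that, for some $L>0$, there is a neighborhood of $\Sigma$ in $M$ which is isometric to the product $\Sigma\times[0,L)$. For every Riemannian metric $g'$ on $M$ which coincides with $g$ on $\Sigma$ and in the complement of $\Sigma\times[0,\frac L2)$, one has $$\sigma_b(M,g')\le\frac 2L.$$
   Context: $\Sigma\times[0,L)$ carries the product metric $g_0+dt^2$, where $g_0$ is the metric induced by $g$ on $\Sigma$ and $t\in[0,L)$; the isometry identifies $\Sigma\subset M$ with $\Sigma\times\{0\}$, and $\Sigma\times[0,\frac L2)$ is regarded as a subset of $M$ through it. Steklov eigenvalues: for a smooth compact connected Riemannian manifold $(M,g)$ with nonempty boundary $\Sigma$, these are the real numbers $\sigma$ for which there is a non-zero function $f:M\to\mathbb{R}$, harmonic with respect to $g$, with $\partial_\nu f=\sigma f$ on $\Sigma$, where $\partial_\nu$ is the outward normal derivative. They form a discrete sequence, indexed from $1$ and repeated according to multiplicity, $0=\sigma_1<\sigma_2\le\sigma_3\le\cdots\nearrow\infty$, with $\sigma_k=\sigma_k(M,g)$. Equivalently, $$\sigma_k(M,g)=\min_{E}\max_{0\neq f\in E}\frac{\int_M|df|_g^2\,dv_g}{\int_\Sigma f^2\,dv_g},$$ where $E$ ranges over $k$-dimensional linear subspaces of $C^\infty(M)$, the integral over $\Sigma$ is with respect to the induced Riemannian measure, and the quotient is $+\infty$ if $f$ is nonzero and vanishes on $\Sigma$. *)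

theory Defs
  imports "HOL-Analysis.Analysis" "HOL-Library.Function_Algebras"
begin

section \<open>Smooth maps on subsets of Euclidean space\<close>

text \<open>\<open>Ck_on k f V\<close> is meant for open \<open>V\<close> only: \<open>f\<close> is \<open>k\<close> times continuously differentiable on \<open>V\<close>.\<close>

primrec Ck_on :: "nat \<Rightarrow> ('e::euclidean_space \<Rightarrow> 'f::real_normed_vector) \<Rightarrow> 'e set \<Rightarrow> bool" where
  "Ck_on 0 f V \<longleftrightarrow> continuous_on V f"
| "Ck_on (Suc k) f V \<longleftrightarrow>
     f differentiable_on V \<and> (\<forall>v. Ck_on k (\<lambda>x. frechet_derivative f (at x) v) V)"

text \<open>On an arbitrary set (in practice a relatively open subset of a half-space), smooth means:
  locally the restriction of a smooth function on an open set.\<close>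

definition smooth_on :: "'e::euclidean_space set \<Rightarrow> ('e \<Rightarrow> 'f::real_normed_vector) \<Rightarrow> bool" where
  "smooth_on S f \<longleftrightarrow>
     (\<forall>x\<in>S. \<exists>V F. open V \<and> x \<in> V \<and> (\<forall>k. Ck_on k F V) \<and> (\<forall>y\<in>S \<inter> V. F y = f y))"


section \<open>Manifolds with boundary\<close>

text \<open>The charts are indexed by a set, so that the charts of derived manifolds (the boundary, an open
  subset, a cylinder) keep the index of the chart they come from. The topology of the manifold is
  the one that \<open>points A\<close> inherits from the ambient topological space \<open>'a\<close>.\<close>

record ('i, 'a, 'e) atlas =
  charts :: "'i set"
  chart_dom :: "'i \<Rightarrow> 'a set"
  chart_map :: "'i \<Rightarrow> 'a \<Rightarrow> 'e"

definition points :: "('i, 'a, 'e) atlas \<Rightarrow> 'a set" where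
  "points A = (\<Union>i\<in>charts A. chart_dom A i)"

definition chart_inv :: "('i, 'a, 'e) atlas \<Rightarrow> 'i \<Rightarrow> 'e \<Rightarrow> 'a" where
  "chart_inv A i = inv_into (chart_dom A i) (chart_map A i)"

definition local_dom :: "('i, 'a, 'e) atlas \<Rightarrow> ('j, 'b, 'f) atlas \<Rightarrow> ('a \<Rightarrow> 'b) \<Rightarrow> 'i \<Rightarrow> 'j \<Rightarrow> 'e set" where
  "local_dom A B F i j = chart_map A i ` {p \<in> chart_dom A i. F p \<in> chart_dom B j}"

definition local_rep :: "('i, 'a, 'e) atlas \<Rightarrow> ('j, 'b, 'f) atlas \<Rightarrow> ('a \<Rightarrow> 'b) \<Rightarrow> 'i \<Rightarrow> 'j \<Rightarrow> 'e \<Rightarrow> 'f" where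
  "local_rep A B F i j = chart_map B j \<circ> F \<circ> chart_inv A i"

definition half_space :: "(real \<times> 'v::euclidean_space) set" where
  "half_space = {x. 0 \<le> fst x}"

text \<open>The model space \<open>real \<times> 'v\<close> has dimension \<open>DIM('v) + 1\<close>, where \<open>DIM('v) \<ge> 1\<close> holds for every
  Euclidean space; a point with coordinates \<open>(t, v)\<close> is a boundary point iff \<open>t = 0\<close>.\<close>

definition manifold_with_boundary ::
    "('i, 'a::{t2_space,second_countable_topology}, real \<times> 'v::euclidean_space) atlas \<Rightarrow> bool" where
  "manifold_with_boundary A \<longleftrightarrow>
     (\<forall>i\<in>charts A.
        openin (top_of_set (points A)) (chart_dom A i) \<and>
        openin (top_of_set half_space) (chart_map A i ` chart_dom A i) \<and>
        homeomorphism (chart_dom A i) (chart_map A i ` chart_dom A i)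
          (chart_map A i) (chart_inv A i)) \<and>
     (\<forall>i\<in>charts A. \<forall>j\<in>charts A. smooth_on (local_dom A A id i j) (local_rep A A id i j))"

definition boundary :: "('i, 'a, real \<times> 'v) atlas \<Rightarrow> 'a set" where
  "boundary A = {p. \<exists>i\<in>charts A. p \<in> chart_dom A i \<and> fst (chart_map A i p) = 0}"

definition boundary_atlas :: "('i, 'a, real \<times> 'v) atlas \<Rightarrow> ('i, 'a, 'v) atlas" where
  "boundary_atlas A =
     \<lparr>charts = charts A,
      chart_dom = (\<lambda>i. chart_dom A i \<inter> boundary A),
      chart_map = (\<lambda>i p. snd (chart_map A i p))\<rparr>"

definition open_submanifold :: "('i, 'a, 'e) atlas \<Rightarrow> 'a set \<Rightarrow> ('i, 'a, 'e) atlas" where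
  "open_submanifold A W = A\<lparr>chart_dom := (\<lambda>i. chart_dom A i \<inter> W)\<rparr>"

text \<open>For an atlas \<open>B\<close> of a manifold without boundary, the cylinder over \<open>B\<close> of height \<open>L\<close>. The real
  factor is the second component of a point, but the first component of its coordinates.\<close>

definition cylinder_atlas :: "('i, 'a, 'v) atlas \<Rightarrow> real \<Rightarrow> ('i, 'a \<times> real, real \<times> 'v) atlas" where
  "cylinder_atlas B L =
     \<lparr>charts = charts B,
      chart_dom = (\<lambda>i. chart_dom B i \<times> {0..<L}),
      chart_map = (\<lambda>i (y, t). (t, chart_map B i y))\<rparr>"

definition smooth_map ::
    "('i, 'a::topological_space, 'e::euclidean_space) atlas \<Rightarrow>
     ('j, 'b::topological_space, 'f::euclidean_space) atlas \<Rightarrow> ('a \<Rightarrow> 'b) \<Rightarrow> bool" where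
  "smooth_map A B F \<longleftrightarrow>
     F ` points A \<subseteq> points B \<and> continuous_on (points A) F \<and>
     (\<forall>i\<in>charts A. \<forall>j\<in>charts B. smooth_on (local_dom A B F i j) (local_rep A B F i j))"

definition diffeomorphism ::
    "('i, 'a::topological_space, 'e::euclidean_space) atlas \<Rightarrow>
     ('j, 'b::topological_space, 'f::euclidean_space) atlas \<Rightarrow> ('a \<Rightarrow> 'b) \<Rightarrow> bool" where
  "diffeomorphism A B F \<longleftrightarrow>
     bij_betw F (points A) (points B) \<and> smooth_map A B F \<and> smooth_map B A (inv_into (points A) F)"

text \<open>Functions are normalised to vanish off the manifold, so that two elements of
  \<open>smooth_functions A\<close> are equal iff they agree on \<open>points A\<close>.\<close>

definition smooth_functions :: "('i, 'a, 'e::euclidean_space) atlas \<Rightarrow> ('a \<Rightarrow> real) set" where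
  "smooth_functions A =
     {f. (\<forall>i\<in>charts A. smooth_on (chart_map A i ` chart_dom A i) (f \<circ> chart_inv A i)) \<and>
         (\<forall>p. p \<notin> points A \<longrightarrow> f p = 0)}"


section \<open>Riemannian metrics\<close>

text \<open>A covariant 2-tensor field is given by its components: \<open>g i p u v\<close> is the value at \<open>p\<close> on the two
  tangent vectors whose coordinates in the chart \<open>i\<close> are \<open>u\<close> and \<open>v\<close>. Only the values with
  \<open>p \<in> chart_dom A i\<close> matter.\<close>

type_synonym ('i, 'a, 'e) tensor2 = "'i \<Rightarrow> 'a \<Rightarrow> 'e \<Rightarrow> 'e \<Rightarrow> real"

text \<open>\<open>g = F\<^sup>* h\<close>. At boundary points the derivative of the local representation is one-sided; it is
  nevertheless unique, because the local domains are relatively open in a half-space.\<close>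

definition is_pullback ::
    "('i, 'a, 'e::euclidean_space) atlas \<Rightarrow> ('i, 'a, 'e) tensor2 \<Rightarrow>
     ('j, 'b, 'f::euclidean_space) atlas \<Rightarrow> ('j, 'b, 'f) tensor2 \<Rightarrow> ('a \<Rightarrow> 'b) \<Rightarrow> bool" where
  "is_pullback A g B h F \<longleftrightarrow>
     (\<forall>i\<in>charts A. \<forall>j\<in>charts B. \<forall>p\<in>chart_dom A i. F p \<in> chart_dom B j \<longrightarrow>
       (\<forall>D. (local_rep A B F i j has_derivative D) (at (chart_map A i p) within local_dom A B F i j) \<longrightarrow>
         (\<forall>u v. g i p u v = h j (F p) (D u) (D v))))"

definition riemannian_metric ::
    "('i, 'a, 'e::euclidean_space) atlas \<Rightarrow> ('i, 'a, 'e) tensor2 \<Rightarrow> bool" where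
  "riemannian_metric A g \<longleftrightarrow>
     (\<forall>i\<in>charts A. \<forall>p\<in>chart_dom A i.
        bilinear (g i p) \<and> (\<forall>u v. g i p u v = g i p v u) \<and> (\<forall>u. u \<noteq> 0 \<longrightarrow> 0 < g i p u u)) \<and>
     (\<forall>i\<in>charts A. \<forall>u v.
        smooth_on (chart_map A i ` chart_dom A i) (\<lambda>x. g i (chart_inv A i x) u v)) \<and>
     is_pullback A g A g id"

definition isometry ::
    "('i, 'a::topological_space, 'e::euclidean_space) atlas \<Rightarrow> ('i, 'a, 'e) tensor2 \<Rightarrow>
     ('j, 'b::topological_space, 'f::euclidean_space) atlas \<Rightarrow> ('j, 'b, 'f) tensor2 \<Rightarrow>
     ('a \<Rightarrow> 'b) \<Rightarrow> bool" where
  "isometry A g B h F \<longleftrightarrow> diffeomorphism A B F \<and> is_pullback A g B h F"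

definition induced_metric ::
    "('i, 'a, real \<times> 'v::euclidean_space) tensor2 \<Rightarrow> ('i, 'a, 'v) tensor2" where
  "induced_metric g = (\<lambda>i p v w. g i p (0, v) (0, w))"

definition product_metric ::
    "('i, 'a, 'v) tensor2 \<Rightarrow> ('i, 'a \<times> real, real \<times> 'v) tensor2" where
  "product_metric h = (\<lambda>i (y, t) (r, v) (s, w). r * s + h i y v w)"


section \<open>Integration and Dirichlet energy\<close>

text \<open>Determinant of the matrix of \<open>q\<close> in the standard basis, by the Leibniz formula. (The determinant
  of the library is restricted to matrices whose index sets are types.)\<close>

definition gram_det :: "('e::euclidean_space \<Rightarrow> 'e \<Rightarrow> real) \<Rightarrow> real" where
  "gram_det q = (\<Sum>s | s permutes (Basis :: 'e set). of_int (sign s) * (\<Prod>b\<in>Basis. q b (s b)))"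

definition riemannian_measure ::
    "('i, 'a::topological_space, 'e::euclidean_space) atlas \<Rightarrow> ('i, 'a, 'e) tensor2 \<Rightarrow> 'a measure" where
  "riemannian_measure A g = (THE \<mu>.
     sets \<mu> = sets (restrict_space borel (points A)) \<and>
     (\<forall>i\<in>charts A. \<forall>S\<in>sets \<mu>. S \<subseteq> chart_dom A i \<longrightarrow>
        emeasure \<mu> S =
          (\<integral>\<^sup>+x\<in>chart_map A i ` S. ennreal (sqrt (gram_det (g i (chart_inv A i x)))) \<partial>lborel)))"

text \<open>The squared norm of a covector \<open>\<alpha>\<close> with respect to an inner product \<open>q\<close>: the squared norm of the
  vector dual to \<open>\<alpha>\<close>.\<close>

definition covector_norm_sq :: "('e::euclidean_space \<Rightarrow> 'e \<Rightarrow> real) \<Rightarrow> ('e \<Rightarrow> real) \<Rightarrow> real" where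
  "covector_norm_sq q \<alpha> = (let u = (THE u. \<forall>v. q u v = \<alpha> v) in q u u)"

definition differential ::
    "('i, 'a, 'e::euclidean_space) atlas \<Rightarrow> ('a \<Rightarrow> real) \<Rightarrow> 'i \<Rightarrow> 'a \<Rightarrow> 'e \<Rightarrow> real" where
  "differential A f i p =
     frechet_derivative (f \<circ> chart_inv A i) (at (chart_map A i p) within chart_map A i ` chart_dom A i)"

text \<open>The value does not depend on the chart chosen around \<open>p\<close>.\<close>

definition differential_norm_sq ::
    "('i, 'a, 'e::euclidean_space) atlas \<Rightarrow> ('i, 'a, 'e) tensor2 \<Rightarrow> ('a \<Rightarrow> real) \<Rightarrow> 'a \<Rightarrow> real" where
  "differential_norm_sq A g f p =
     (let i = (SOME i. i \<in> charts A \<and> p \<in> chart_dom A i)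
      in covector_norm_sq (g i p) (differential A f i p))"

definition dirichlet_energy ::
    "('i, 'a::topological_space, 'e::euclidean_space) atlas \<Rightarrow> ('i, 'a, 'e) tensor2 \<Rightarrow>
     ('a \<Rightarrow> real) \<Rightarrow> ennreal" where
  "dirichlet_energy A g f =
     (\<integral>\<^sup>+p. ennreal (differential_norm_sq A g f p) \<partial>riemannian_measure A g)"

definition boundary_norm_sq ::
    "('i, 'a::topological_space, real \<times> 'v::euclidean_space) atlas \<Rightarrow>
     ('i, 'a, real \<times> 'v) tensor2 \<Rightarrow> ('a \<Rightarrow> real) \<Rightarrow> ennreal" where
  "boundary_norm_sq A g f =
     (\<integral>\<^sup>+p. ennreal ((f p)\<^sup>2) \<partial>riemannian_measure (boundary_atlas A) (induced_metric g))"


section \<open>Steklov eigenvalues\<close>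

definition steklov_quotient ::
    "('i, 'a::topological_space, real \<times> 'v::euclidean_space) atlas \<Rightarrow>
     ('i, 'a, real \<times> 'v) tensor2 \<Rightarrow> ('a \<Rightarrow> real) \<Rightarrow> ennreal" where
  "steklov_quotient A g f =
     (if \<forall>p\<in>boundary A. f p = 0 then \<infinity> else dirichlet_energy A g f / boundary_norm_sq A g f)"

definition fun_scale :: "real \<Rightarrow> ('a \<Rightarrow> real) \<Rightarrow> 'a \<Rightarrow> real" where
  "fun_scale c f = (\<lambda>x. c * f x)"

global_interpretation fun_space: vector_space "fun_scale :: real \<Rightarrow> ('a \<Rightarrow> real) \<Rightarrow> 'a \<Rightarrow> real"
  by unfold_locales (auto simp: fun_scale_def plus_fun_def algebra_simps)

definition subspaces_of_dim :: "nat \<Rightarrow> ('a \<Rightarrow> real) set \<Rightarrow> ('a \<Rightarrow> real) set set" where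
  "subspaces_of_dim k V =
     {E. E \<subseteq> V \<and> (\<exists>B. finite B \<and> card B = k \<and> fun_space.independent B \<and> fun_space.span B = E)}"

text \<open>The \<open>k\<close>-th Steklov eigenvalue, counted from \<open>k = 1\<close> and with multiplicity, by its variational
  (min-max) formula. On a compact manifold with nonempty boundary the infimum and the suprema are
  attained and the value is finite.\<close>

definition steklov_eigenvalue ::
    "('i, 'a::topological_space, real \<times> 'v::euclidean_space) atlas \<Rightarrow>
     ('i, 'a, real \<times> 'v) tensor2 \<Rightarrow> nat \<Rightarrow> ennreal" where
  "steklov_eigenvalue A g k =
     (INF E\<in>subspaces_of_dim k (smooth_functions A). SUP f\<in>E - {0}. steklov_quotient A g f)"

end

(* Let c be a locally constant function on the boundary Sigma and let eta be a smooth cutoff on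
   [0, L) that equals 1 on [0, L/2], vanishes near L and satisfies int (eta')^2 <= 2/L + epsilon.
   The function c(y) eta(t) on the collar, extended by 0, is locally constant where g' may differ
   from the product metric, so its energy is computed in the product metric on Sigma x [L/2, L); by Fubini it is
   int (eta')^2 times the integral of c^2 over Sigma. These functions form a space of dimension b on
   which the Steklov quotient is at most 2/L + epsilon.

   The measures in the definitions are descriptions, so the Riemannian measure has to be constructed:
   the chart densities agree on overlaps by the change of variables formula. *)

theory Submission
  imports Defs
begin

section \<open>Calculus of smooth functions\<close>

text \<open>The constant 2/L is the energy of the linear profile that falls from 1 to 0 over an
  interval of length L/2: slope squared times length. That profile is not smooth at its ends, so an
  actual cutoff only comes within \<epsilon> of it, and \<epsilon> disappears because the eigenvalue
  does not depend on it. On the whole test space the Dirichlet energy is one and the same multiple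
  of the boundary norm, so nothing has to be optimised over the space; division in
  \<open>ennreal\<close> absorbs the cases where the boundary norm is 0 or infinite. What shapes the
  proof is that metrics, differentials and densities exist only in charts, and that charts at the
  boundary allow only one-sided derivatives. Two facts carry the passage between charts: a
  derivative within a relatively open subset of a half-space is unique, and the square root of a
  Gram determinant absorbs the Jacobian of a change of coordinates. Charts of M and cylinder charts
  are unrelated, so integrals over the collar are cut into Borel pieces that lie in a single chart
  on each side.\<close>

lemma Ck_on_has_derivative:
  assumes "Ck_on (Suc k) f V" "open V" "x \<in> V"
  shows "(f has_derivative frechet_derivative f (at x)) (at x)"
proof -
  have "f differentiable (at x within V)"
    using assms(1,3) by (simp add: differentiable_on_def)
  then have "f differentiable (at x)"
    by (simp only: at_within_open[OF assms(3,2)])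
  then show ?thesis
    by (rule frechet_derivative_works[THEN iffD1])
qed

lemma Ck_on_cong:
  assumes "open V" "\<And>x. x \<in> V \<Longrightarrow> f x = g x" "Ck_on k f V"
  shows "Ck_on k g V"
  using assms
proof (induction k arbitrary: f g)
  case 0
  then show ?case using continuous_on_cong by (metis Ck_on.simps(1))
next
  case (Suc k)
  have der: "(g has_derivative frechet_derivative f (at x)) (at x)" if "x \<in> V" for x
    using Ck_on_has_derivative[OF Suc.prems(3,1) that]
    by (rule has_derivative_transform_within_open[OF _ Suc.prems(1) that]) (simp add: Suc.prems(2))
  have eq: "frechet_derivative f (at x) = frechet_derivative g (at x)" if "x \<in> V" for x
    using frechet_derivative_at[OF der[OF that]] .
  have "Ck_on k (\<lambda>x. frechet_derivative g (at x) v) V" for v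
    by (rule Suc.IH[OF Suc.prems(1), of "\<lambda>x. frechet_derivative f (at x) v"]) (use eq Suc.prems(3) in auto)
  moreover have "g differentiable_on V"
    using der by (meson differentiable_at_withinI differentiable_def differentiable_on_def)
  ultimately show ?case by simp
qed

text \<open>The definition speaks of \<open>frechet_derivative\<close>, which is fixed by a
  description. On an open set any pointwise derivative \<open>f'\<close> coincides with it, so
  ordinary derivative rules become usable.\<close>

lemma Ck_on_SucI:
  assumes "open V" "\<And>x. x \<in> V \<Longrightarrow> (f has_derivative f' x) (at x)" "\<And>v. Ck_on k (\<lambda>x. f' x v) V"
  shows "Ck_on (Suc k) f V"
proof -
  have eq: "f' x = frechet_derivative f (at x)" if "x \<in> V" for x
    using assms(2)[OF that] frechet_derivative_at by metis
  have "Ck_on k (\<lambda>x. frechet_derivative f (at x) v) V" for v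
    by (rule Ck_on_cong[OF assms(1) _ assms(3)[of v]]) (simp add: eq)
  moreover have "f differentiable_on V"
    using assms(2) by (meson differentiable_at_withinI differentiable_def differentiable_on_def)
  ultimately show ?thesis by simp
qed

lemma Ck_on_Suc_imp: "Ck_on (Suc k) f V \<Longrightarrow> Ck_on k f V"
proof (induction k arbitrary: f)
  case 0
  then show ?case by (simp add: differentiable_imp_continuous_on)
next
  case (Suc k)
  then show ?case by (simp only: Ck_on.simps(2)) auto
qed

lemma Ck_on_subset: "Ck_on k f V \<Longrightarrow> U \<subseteq> V \<Longrightarrow> Ck_on k f U"
  by (induction k arbitrary: f) (auto intro: continuous_on_subset differentiable_on_subset)

lemma Ck_on_const: "open V \<Longrightarrow> Ck_on k (\<lambda>x. c) V"
proof (induction k arbitrary: c)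
  case (Suc k)
  show ?case
    by (rule Ck_on_SucI[where f' = "\<lambda>x v. 0"]) (use Suc in auto)
qed simp

lemma Ck_on_add:
  "open V \<Longrightarrow> Ck_on k f V \<Longrightarrow> Ck_on k g V \<Longrightarrow> Ck_on k (\<lambda>x. f x + g x) V"
proof (induction k arbitrary: f g)
  case 0
  then show ?case by (simp add: continuous_on_add)
next
  case (Suc k)
  show ?case
    by (rule Ck_on_SucI[OF Suc.prems(1)
          has_derivative_add[OF Ck_on_has_derivative[OF Suc.prems(2,1)] Ck_on_has_derivative[OF Suc.prems(3,1)]]])
      (use Suc in auto)
qed

lemma Ck_on_linear:
  assumes "bounded_linear l"
  shows "open V \<Longrightarrow> Ck_on k f V \<Longrightarrow> Ck_on k (\<lambda>x. l (f x)) V"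
proof (induction k arbitrary: f)
  case 0
  then show ?case by (simp add: bounded_linear.continuous_on[OF assms])
next
  case (Suc k)
  show ?case
    by (rule Ck_on_SucI[OF Suc.prems(1)
          bounded_linear.has_derivative[OF assms Ck_on_has_derivative[OF Suc.prems(2,1)]]])
      (use Suc in auto)
qed

lemma Ck_on_mult:
  fixes f g :: "'e::euclidean_space \<Rightarrow> real"
  shows "open V \<Longrightarrow> Ck_on k f V \<Longrightarrow> Ck_on k g V \<Longrightarrow> Ck_on k (\<lambda>x. f x * g x) V"
proof (induction k arbitrary: f g)
  case 0
  then show ?case by (simp add: continuous_on_mult)
next
  case (Suc k)
  have "Ck_on k f V" "Ck_on k g V"
    using Suc.prems Ck_on_Suc_imp by blast+
  then show ?case
    by (intro Ck_on_SucI[OF Suc.prems(1)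
          has_derivative_mult[OF Ck_on_has_derivative[OF Suc.prems(2,1)] Ck_on_has_derivative[OF Suc.prems(3,1)]]]
         Ck_on_add Suc.IH) (use Suc.prems in auto)
qed

text \<open>With an outer function of one real variable the chain rule is a product of two real
  functions, so the induction closes with \<open>Ck_on_mult\<close>.\<close>

lemma Ck_on_compose_real:
  fixes h :: "real \<Rightarrow> real" and f :: "'e::euclidean_space \<Rightarrow> real"
  shows "open V \<Longrightarrow> Ck_on k h UNIV \<Longrightarrow> Ck_on k f V \<Longrightarrow> Ck_on k (\<lambda>x. h (f x)) V"
proof (induction k arbitrary: h)
  case 0
  then show ?case using continuous_on_compose2[of UNIV h V f] by simp
next
  case (Suc k)
  let ?h' = "\<lambda>s. frechet_derivative h (at s) 1"
  have d: "((\<lambda>x. h (f x)) has_derivative (\<lambda>v. ?h' (f x) * frechet_derivative f (at x) v)) (at x)"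
    if "x \<in> V" for x
  proof -
    have 1: "(h has_derivative frechet_derivative h (at (f x))) (at (f x))"
      using Ck_on_has_derivative[OF Suc.prems(2)] by simp
    have lin: "linear (frechet_derivative h (at (f x)))"
      using 1 has_derivative_linear by blast
    have "frechet_derivative h (at (f x)) = (\<lambda>v. ?h' (f x) * v)"
    proof
      fix v
      show "frechet_derivative h (at (f x)) v = ?h' (f x) * v"
        using linear_cmul[OF lin, of v 1] by simp
    qed
    then have "frechet_derivative h (at (f x)) \<circ> frechet_derivative f (at x)
        = (\<lambda>v. ?h' (f x) * frechet_derivative f (at x) v)"
      by (metis comp_apply)
    with diff_chain_at[OF Ck_on_has_derivative[OF Suc.prems(3,1) that] 1]
    show ?thesis by (simp add: o_def)
  qed
  have "Ck_on k (\<lambda>x. ?h' (f x)) V"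
    by (rule Suc.IH[OF Suc.prems(1) _ Ck_on_Suc_imp[OF Suc.prems(3)]]) (use Suc.prems(2) in simp)
  then show ?case
    using Suc.prems by (intro Ck_on_SucI[OF Suc.prems(1) d] Ck_on_mult) auto
qed

text \<open>The local smooth extension is differentiable in the full sense, and its derivative
  restricts to one within S, also where S ends.\<close>

lemma smooth_on_has_derivative:
  assumes "smooth_on S f" "x \<in> S"
  shows "\<exists>D. (f has_derivative D) (at x within S)"
proof -
  obtain V F where V: "open V" "x \<in> V" "\<forall>k. Ck_on k F V" "\<forall>y\<in>S \<inter> V. F y = f y"
    using assms unfolding smooth_on_def by blast
  have "(F has_derivative frechet_derivative F (at x)) (at x within S)"
    using Ck_on_has_derivative V has_derivative_at_withinI by blast
  then have "(f has_derivative frechet_derivative F (at x)) (at x within S)"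
    by (rule has_derivative_transform_eventually)
      (use V assms in \<open>auto simp: eventually_at_topological\<close>)
  then show ?thesis by blast
qed

lemma smooth_on_continuous_on: "smooth_on S f \<Longrightarrow> continuous_on S f"
  using smooth_on_has_derivative has_derivative_continuous continuous_on_eq_continuous_within by metis

section \<open>A cutoff function\<close>

text \<open>The flat function exp (-1/x), extended by 0, with a polynomial factor in 1/x. The factor
  makes the family closed under differentiation, so that smoothness becomes an induction over the
  order.\<close>

definition flat_exp :: "real poly \<Rightarrow> real \<Rightarrow> real" where
  "flat_exp p x = (if x > 0 then poly p (inverse x) * exp (- inverse x) else 0)"

lemma poly_exp_minus_tendsto_0: "((\<lambda>y. poly p y * exp (- y)) \<longlongrightarrow> 0) at_top" for p :: "real poly"
proof -
  have "((\<lambda>y. \<Sum>i\<le>degree p. coeff p i * (y ^ i / exp y)) \<longlongrightarrow> (\<Sum>i\<le>degree p. coeff p i * 0)) at_top"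
    by (intro tendsto_intros tendsto_power_div_exp_0)
  then show ?thesis
    by (simp add: poly_altdef sum_distrib_right exp_minus divide_inverse mult.assoc)
qed

text \<open>With y = 1/x and dy/dx = - y^2, the derivative of p(y) exp (-y) is y^2 (p - p')(y) exp
  (-y), which explains the polynomial. At 0 exponential decay beats every power of 1/x.\<close>

lemma flat_exp_derivative:
  "(flat_exp p has_real_derivative flat_exp ([:0, 0, 1:] * (p - pderiv p)) x) (at x)"
proof -
  consider "x < 0" | "x = 0" | "x > 0" by linarith
  then show ?thesis
  proof cases
    case 1
    have "((\<lambda>x. 0) has_real_derivative 0) (at x)" by simp
    then have "(flat_exp p has_real_derivative 0) (at x)"
      by (rule has_field_derivative_transform_within_open[of _ _ _ "{..<0}"])
        (use 1 in \<open>auto simp: flat_exp_def\<close>)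
    then show ?thesis using 1 by (simp add: flat_exp_def)
  next
    case 3
    have "((\<lambda>x. poly p (inverse x) * exp (- inverse x)) has_real_derivative
       poly ([:0, 0, 1:] * (p - pderiv p)) (inverse x) * exp (- inverse x)) (at x)"
      using 3 by (auto intro!: derivative_eq_intros DERIV_chain2[OF poly_DERIV]
          simp: field_simps power2_eq_square)
    then have "(flat_exp p has_real_derivative
       poly ([:0, 0, 1:] * (p - pderiv p)) (inverse x) * exp (- inverse x)) (at x)"
      by (rule has_field_derivative_transform_within_open[of _ _ _ "{0<..}"])
        (use 3 in \<open>auto simp: flat_exp_def\<close>)
    then show ?thesis using 3 by (simp add: flat_exp_def)
  next
    case 2
    \<comment> \<open>Division by h multiplies the polynomial in 1/h by its variable, so the right
      difference quotient is again of the form covered by \<open>poly_exp_minus_tendsto_0\<close>,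
      with \<open>pCons 0 p\<close>.\<close>
    have "((\<lambda>h. (flat_exp p h - flat_exp p 0) / h) \<longlongrightarrow> 0) (at_right 0)"
    proof -
      have "((\<lambda>h. poly (pCons 0 p) (inverse h) * exp (- inverse h)) \<longlongrightarrow> 0) (at_right 0)"
        using filterlim_compose[OF poly_exp_minus_tendsto_0 filterlim_inverse_at_top_right] .
      then show ?thesis
        by (rule Lim_transform_eventually)
          (auto simp: eventually_at_right_field flat_exp_def field_simps intro: exI[of _ 1])
    qed
    moreover have "((\<lambda>h. (flat_exp p h - flat_exp p 0) / h) \<longlongrightarrow> 0) (at_left 0)"
      by (rule Lim_transform_eventually[of "\<lambda>_. 0"])
          (auto simp: eventually_at_left_field flat_exp_def intro: exI[of _ "-1"])
    ultimately have "((\<lambda>h. (flat_exp p h - flat_exp p 0) / h) \<longlongrightarrow> 0) (at 0)"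
      using filterlim_split_at by blast
    then show ?thesis
      using 2 by (simp add: has_field_derivative_iff flat_exp_def)
  qed
qed

lemma Ck_on_antiderivative:
  fixes F :: "real \<Rightarrow> real"
  assumes "\<And>x. (F has_real_derivative f x) (at x)" "Ck_on k f UNIV"
  shows "Ck_on (Suc k) F UNIV"
proof (rule Ck_on_SucI)
  show "(F has_derivative (\<lambda>v. v * f x)) (at x)" for x
    using assms(1)[of x] by (simp add: has_field_derivative_def mult.commute[of _ "f x"] mult_commute_abs)
  show "Ck_on k (\<lambda>x. v * f x) UNIV" for v
    by (rule Ck_on_linear[OF bounded_linear_mult_right]) (use assms in auto)
qed simp

lemma Ck_on_flat_exp: "Ck_on k (flat_exp p) UNIV"
proof (induction k arbitrary: p)
  case 0
  show ?case
    using flat_exp_derivative[THEN DERIV_isCont] by (auto intro!: continuous_at_imp_continuous_on)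
next
  case (Suc k)
  show ?case
    by (rule Ck_on_antiderivative[OF flat_exp_derivative Suc])
qed

text \<open>The slope of the cutoff is a smooth function with values in \<open>[0, 1/I]\<close> and integral \<open>1\<close>, so
  its square integrates to at most \<open>1/I\<close>. The width \<open>d\<close> of the two transition zones makes \<open>I\<close> close
  to \<open>L/2\<close>.\<close>

lemma smooth_cutoff:
  fixes L \<epsilon> :: real
  assumes "L > 0" "\<epsilon> > 0"
  obtains \<eta> \<psi> :: "real \<Rightarrow> real" and r where
    "\<And>k. Ck_on k \<eta> UNIV" "\<And>t. t \<le> L/2 \<Longrightarrow> \<eta> t = 1" "L/2 < r" "r < L" "\<And>t. r \<le> t \<Longrightarrow> \<eta> t = 0"
    "\<And>t. (\<eta> has_real_derivative \<psi> t) (at t)" "continuous_on UNIV \<psi>"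
    "(\<integral>\<^sup>+t\<in>{L/2..<L}. ennreal ((\<psi> t)\<^sup>2) \<partial>lborel) \<le> ennreal (2 / L + \<epsilon>)"
proof -
  \<comment> \<open>The denominator is the lower bound proved below for I: the bump is at least exp
    (-2d) on an interval of length L/2 - 3d. As d tends to 0 its reciprocal tends to 2/L.\<close>
  have "((\<lambda>d. 1 / (exp (- 2 * d) * (L/2 - 3 * d))) \<longlongrightarrow> 1 / (exp (-2 * 0) * (L/2 - 3 * 0))) (at_right 0)"
    using assms by (intro tendsto_intros) auto
  then have "\<forall>\<^sub>F d in at_right 0. 1 / (exp (- 2 * d) * (L/2 - 3 * d)) < 2 / L + \<epsilon>"
    by (rule order_tendstoD) (use assms in auto)
  moreover have "\<forall>\<^sub>F d in at_right 0. d < L / 10"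
    using assms by (auto simp: eventually_at_right_field intro!: exI[of _ "L/10"])
  moreover have "\<forall>\<^sub>F d in at_right (0::real). d > 0"
    by (auto simp: eventually_at_right_field intro: exI[of _ 1])
  ultimately have "\<forall>\<^sub>F d in at_right 0. 1 / (exp (- 2 * d) * (L/2 - 3 * d)) < 2 / L + \<epsilon> \<and> d < L/10 \<and> d > 0"
    by eventually_elim auto
  then obtain d where d: "1 / (exp (- 2 * d) * (L/2 - 3 * d)) < 2 / L + \<epsilon>" "d < L/10" "d > 0"
    using eventually_happens'[of "at_right (0::real)"] trivial_limit_at_right_real by blast
  \<comment> \<open>Stopping at L - d makes the cutoff vanish before the open end of the collar. The
    scale d^2 in h lets it rise from 0 to at least exp (-d) within width d.\<close>
  define r where "r = L - d"
  define h where "h = (\<lambda>s::real. flat_exp 1 (s / d\<^sup>2))"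
  define \<phi> where "\<phi> = (\<lambda>t. h (t - L/2) * h (r - t))"
  have h01: "0 \<le> h s" "h s \<le> 1" for s by (auto simp: h_def flat_exp_def zero_less_divide_iff)
  have h0: "h s = 0" if "s \<le> 0" for s using that by (auto simp: h_def flat_exp_def zero_less_divide_iff)
  have hd: "exp (- d) \<le> h s" if "d \<le> s" for s
  proof -
    have "d * d \<le> d * s" using that d by simp
    then have "inverse (s / d\<^sup>2) \<le> d" using that d by (simp add: field_simps power2_eq_square)
    then show ?thesis using that d by (simp add: h_def flat_exp_def)
  qed
  have Ckphi: "Ck_on k \<phi> UNIV" for k
  proof -
    have lin: "Ck_on k (\<lambda>t::real. a * t + c) UNIV" for a c
    proof (intro Ck_on_add Ck_on_const)
      have id: "Ck_on k (\<lambda>t::real. t) UNIV"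
      proof (cases k)
        case (Suc m)
        then show ?thesis by (auto intro!: Ck_on_SucI[where f' = "\<lambda>x v. v"] Ck_on_const)
      qed simp
      show "Ck_on k (\<lambda>t::real. a * t) UNIV"
        by (rule Ck_on_linear[OF bounded_linear_mult_right _ id]) simp
    qed simp_all
    have "Ck_on k (\<lambda>t. flat_exp 1 ((1/d\<^sup>2) * t + (- L/2/d\<^sup>2)) * flat_exp 1 ((- 1/d\<^sup>2) * t + (r/d\<^sup>2))) UNIV"
      by (rule Ck_on_mult[OF open_UNIV Ck_on_compose_real[OF open_UNIV Ck_on_flat_exp lin]
            Ck_on_compose_real[OF open_UNIV Ck_on_flat_exp lin]])
    moreover have "\<phi> = (\<lambda>t. flat_exp 1 ((1/d\<^sup>2) * t + (- L/2/d\<^sup>2)) * flat_exp 1 ((- 1/d\<^sup>2) * t + (r/d\<^sup>2)))"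
      using d by (auto simp: \<phi>_def h_def fun_eq_iff diff_divide_distrib)
    ultimately show ?thesis by simp
  qed
  have cont: "continuous_on UNIV \<phi>" by (rule Ckphi[of 0, unfolded Ck_on.simps(1)])
  have phi01: "0 \<le> \<phi> t" "\<phi> t \<le> 1" for t
    unfolding \<phi>_def by (intro mult_nonneg_nonneg mult_le_one h01)+
  have "\<exists>F. \<forall>t. -\<infinity> < ereal t \<longrightarrow> ereal t < \<infinity> \<longrightarrow> (F has_vector_derivative \<phi> t) (at t)"
    by (rule einterval_antiderivative) (use cont in \<open>simp_all add: continuous_on_eq_continuous_at\<close>)
  then obtain F where F: "\<And>t. (F has_real_derivative \<phi> t) (at t)"
    unfolding has_real_derivative_iff_has_vector_derivative by auto
  have Fmono: "F s \<le> F t" if "s \<le> t" for s t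
    using F phi01 that DERIV_nonneg_imp_nondecreasing by metis
  have Fconst: "F s = F t" if "s \<le> t" "\<And>u. s \<le> u \<Longrightarrow> u \<le> t \<Longrightarrow> \<phi> u = 0" for s t
  proof (cases "s = t")
    case False
    then have "s < t" using that by simp
    moreover have "\<And>x. s < x \<Longrightarrow> x < t \<Longrightarrow> (F has_real_derivative 0) (at x)"
      using F that by (metis less_imp_le)
    moreover have "continuous_on {s..t} F"
      using F DERIV_isCont by (auto intro!: continuous_at_imp_continuous_on)
    ultimately show ?thesis
      using DERIV_isconst_end[of s t F] by simp
  qed simp
  define I where "I = F r - F (L/2)"
  have Ilow: "exp (- 2 * d) * (L/2 - 3 * d) \<le> I"
  proof -
    \<comment> \<open>Between the two transition zones both factors of \<phi> are at least exp (-d);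
      the mean value theorem turns this into a lower bound for the growth of F.\<close>
    have "L/2 + d < r - d" using d by (simp add: r_def)
    then obtain z where z: "L/2 + d < z" "z < r - d"
        "F (r - d) - F (L/2 + d) = (r - d - (L/2 + d)) * \<phi> z"
      using MVT2[of "L/2+d" "r - d" F \<phi>] F by blast
    have "exp (-d) * exp (-d) \<le> \<phi> z"
      unfolding \<phi>_def by (rule mult_mono) (use z hd h01 in auto)
    then have "exp (-2 * d) \<le> \<phi> z" by (simp flip: exp_add)
    then have "exp (- 2 * d) * (L/2 - 3 * d) \<le> F (r - d) - F (L/2 + d)"
      unfolding z(3) using d by (simp add: r_def mult.commute mult_left_mono)
    also have "\<dots> \<le> I"
      unfolding I_def using Fmono[of "r - d" r] Fmono[of "L/2" "L/2 + d"] d by linarith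
    finally show ?thesis .
  qed
  have pos: "exp (- 2 * d) * (L/2 - 3 * d) > 0" using d by simp
  then have Ipos: "I > 0" using Ilow by linarith
  have Iinv: "1 / I \<le> 2 / L + \<epsilon>"
    using d(1) Ilow pos frac_le[of 1 1 "exp (- 2 * d) * (L/2 - 3 * d)" I] by simp
  define \<eta> where "\<eta> = (\<lambda>t. (F r - F t) / I)"
  define \<psi> where "\<psi> = (\<lambda>t. - \<phi> t / I)"
  have der: "(\<eta> has_real_derivative \<psi> t) (at t)" for t
    unfolding \<eta>_def \<psi>_def using Ipos by (auto intro!: derivative_eq_intros F)
  have psiCk: "Ck_on k \<psi> UNIV" for k
  proof -
    have "\<psi> = (\<lambda>t. (-1/I) * \<phi> t)" by (auto simp: \<psi>_def)
    then show ?thesis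
      by (simp only: Ck_on_linear[OF bounded_linear_mult_right open_UNIV Ckphi])
  qed
  show ?thesis
  proof (rule that[of \<eta> r \<psi>])
    show "Ck_on k \<eta> UNIV" for k
      using Ck_on_antiderivative[OF der psiCk] Ck_on_Suc_imp by blast
    show "\<eta> t = 1" if "t \<le> L/2" for t
    proof -
      have "F t = F (L/2)" by (rule Fconst[OF that]) (simp add: \<phi>_def h0)
      then show ?thesis using Ipos by (simp add: \<eta>_def I_def)
    qed
    show "\<eta> t = 0" if "r \<le> t" for t
    proof -
      have "F r = F t" by (rule Fconst[OF that]) (simp add: \<phi>_def h0)
      then show ?thesis by (simp add: \<eta>_def)
    qed
    show "L/2 < r" "r < L" using d by (auto simp: r_def)
    show "(\<eta> has_real_derivative \<psi> t) (at t)" for t by (rule der)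
    show "continuous_on UNIV \<psi>" using psiCk[of 0] by simp
    have "(\<integral>\<^sup>+t\<in>{L/2..<L}. ennreal ((\<psi> t)\<^sup>2) \<partial>lborel)
        \<le> (\<integral>\<^sup>+t. ennreal (\<phi> t / I\<^sup>2) * indicator {L/2..L} t \<partial>lborel)"
    proof (rule nn_integral_mono)
      fix t
      have "(\<phi> t)\<^sup>2 \<le> \<phi> t"
        using mult_left_mono[OF phi01(2)[of t] phi01(1)[of t]] by (simp add: power2_eq_square)
      then have "(\<psi> t)\<^sup>2 \<le> \<phi> t / I\<^sup>2"
        by (simp add: \<psi>_def power_divide divide_right_mono)
      then show "ennreal ((\<psi> t)\<^sup>2) * indicator {L/2..<L} t \<le> ennreal (\<phi> t / I\<^sup>2) * indicator {L/2..L} t"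
        by (auto simp: indicator_def ennreal_leI)
    qed
    also have "\<dots> = ennreal (F L / I\<^sup>2 - F (L/2) / I\<^sup>2)"
    proof (rule nn_integral_FTC_Icc)
      show "(\<lambda>t. \<phi> t / I\<^sup>2) \<in> borel_measurable borel"
        using cont by (intro borel_measurable_divide borel_measurable_continuous_onI) auto
      show "((\<lambda>t. F t / I\<^sup>2) has_real_derivative \<phi> t / I\<^sup>2) (at t)" for t
        by (rule DERIV_cdivide[OF F])
    qed (use phi01 assms in auto)
    also have "F L = F r"
      by (rule Fconst[symmetric]) (use d in \<open>auto simp: r_def \<phi>_def h0\<close>)
    also have "F r / I\<^sup>2 - F (L/2) / I\<^sup>2 = 1 / I"
      using Ipos by (simp add: I_def power2_eq_square flip: diff_divide_distrib)
    also have "ennreal (1 / I) \<le> ennreal (2 / L + \<epsilon>)"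
      using Iinv by (rule ennreal_leI)
    finally show "(\<integral>\<^sup>+t\<in>{L/2..<L}. ennreal ((\<psi> t)\<^sup>2) \<partial>lborel) \<le> ennreal (2 / L + \<epsilon>)" .
  qed
qed

section \<open>Gram determinants and the change of variables formula\<close>

text \<open>The change of variables theorem of the library is stated for \<open>real^'n\<close> with a finite
  well-ordered index type. This type of indices transfers it to an arbitrary Euclidean space.\<close>

typedef (overloaded) ('e::euclidean_space) coord = "{..<DIM('e)}"
  by (rule exI[of _ 0]) simp

instance coord :: (euclidean_space) finite
proof
  have "(UNIV :: 'a coord set) = Abs_coord ` {..<DIM('a)}"
    using Rep_coord Rep_coord_inverse by (metis UNIV_eq_I image_eqI)
  then show "finite (UNIV :: 'a coord set)" by (metis finite_imageI finite_lessThan)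
qed

instantiation coord :: (euclidean_space) wellorder
begin

definition less_eq_coord :: "'a coord \<Rightarrow> 'a coord \<Rightarrow> bool"
  where "less_eq_coord i j \<longleftrightarrow> Rep_coord i \<le> Rep_coord j"

definition less_coord :: "'a coord \<Rightarrow> 'a coord \<Rightarrow> bool"
  where "less_coord i j \<longleftrightarrow> Rep_coord i < Rep_coord j"

instance
proof
  fix P and a :: "'a coord"
  assume step: "\<And>x::'a coord. (\<And>y. y < x \<Longrightarrow> P y) \<Longrightarrow> P x"
  show "P a"
    by (induction a rule: measure_induct_rule[of Rep_coord]) (use step in \<open>auto simp: less_coord_def\<close>)
qed (auto simp: less_eq_coord_def less_coord_def Rep_coord_inject)

end

definition coord_basis :: "('e::euclidean_space) coord \<Rightarrow> 'e" where
  "coord_basis = (SOME \<beta>. bij_betw \<beta> UNIV Basis)"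

lemma bij_coord_basis: "bij_betw coord_basis UNIV (Basis :: 'e::euclidean_space set)"
proof -
  have "card (UNIV :: 'e coord set) = DIM('e)"
    using type_definition.card[OF type_definition_coord] by simp
  then obtain \<beta> :: "'e coord \<Rightarrow> 'e" where "bij_betw \<beta> UNIV Basis"
    using finite_same_card_bij[of "UNIV :: 'e coord set" "Basis :: 'e set"] by auto
  then show ?thesis unfolding coord_basis_def by (rule someI[of "\<lambda>\<beta>. bij_betw \<beta> UNIV Basis"])
qed

lemma coord_basis_in_Basis [simp]: "coord_basis i \<in> Basis"
  using bij_coord_basis by (metis bij_betwE UNIV_I)

lemma inner_coord_basis: "coord_basis i \<bullet> coord_basis j = (if i = j then 1 else 0)"
  using bij_betw_imp_inj_on[OF bij_coord_basis] by (auto simp: inner_Basis dest: injD)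

lemma sum_coord_basis: "(\<Sum>i\<in>UNIV. f (coord_basis i)) = (\<Sum>b\<in>Basis. f b)"
  by (rule sum.reindex_bij_betw[OF bij_coord_basis])

lemma prod_coord_basis: "(\<Prod>i\<in>UNIV. f (coord_basis i)) = (\<Prod>b\<in>Basis. f b)"
  by (rule prod.reindex_bij_betw[OF bij_coord_basis])

definition to_vec :: "'e::euclidean_space \<Rightarrow> real ^ 'e coord" where
  "to_vec x = (\<chi> i. x \<bullet> coord_basis i)"

definition of_vec :: "real ^ 'e coord \<Rightarrow> 'e::euclidean_space" where
  "of_vec v = (\<Sum>i\<in>UNIV. v $ i *\<^sub>R coord_basis i)"

lemma of_vec_inner [simp]: "of_vec v \<bullet> coord_basis i = v $ i"
  by (simp add: of_vec_def inner_sum_left inner_coord_basis if_distrib cong: if_cong)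

lemma to_vec_of_vec [simp]: "to_vec (of_vec v) = v"
  by (simp add: to_vec_def vec_eq_iff)

lemma of_vec_to_vec [simp]: "of_vec (to_vec x) = x"
  by (simp add: to_vec_def of_vec_def sum_coord_basis[of "\<lambda>b. (x \<bullet> b) *\<^sub>R b"] euclidean_representation)

lemma linear_of_vec: "linear of_vec"
  by (rule linearI) (simp_all add: of_vec_def algebra_simps sum.distrib scaleR_sum_right)

lemma linear_to_vec: "linear to_vec"
  by (rule linearI) (simp_all add: to_vec_def vec_eq_iff inner_add_left)

lemma bounded_linear_of_vec: "bounded_linear of_vec"
  using linear_of_vec linear_conv_bounded_linear by blast

lemma bounded_linear_to_vec: "bounded_linear to_vec"
  using linear_to_vec linear_conv_bounded_linear by blast

lemma continuous_on_of_vec: "continuous_on S of_vec"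
  using bounded_linear_of_vec by (rule linear_continuous_on)

lemma of_vec_measurable [measurable]: "of_vec \<in> borel_measurable borel"
  by (simp add: borel_measurable_continuous_onI continuous_on_of_vec)

lemma of_vec_image: "of_vec ` (to_vec ` S) = S" "to_vec ` (of_vec ` T) = T"
  by (simp_all add: image_image)

lemma to_vec_image_eq: "to_vec ` S = of_vec -` S"
  by (auto simp: image_iff) (metis to_vec_of_vec)

lemma to_vec_image_borel: "S \<in> sets borel \<Longrightarrow> to_vec ` S \<in> sets borel"
  unfolding to_vec_image_eq using measurable_sets[OF of_vec_measurable] by simp

lemma inj_to_vec: "inj to_vec"
  by (metis injI of_vec_to_vec)

text \<open>Coordinate boxes correspond to coordinate boxes with the same side lengths, and box
  volumes determine \<open>lborel\<close>.\<close>

lemma lborel_of_vec: "distr lborel borel (of_vec :: _ \<Rightarrow> 'e::euclidean_space) = lborel"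
proof (rule lborel_eqI[symmetric])
  fix l u :: 'e
  assume lu: "\<And>b. b \<in> Basis \<Longrightarrow> l \<bullet> b \<le> u \<bullet> b"
  have all: "(\<forall>b\<in>Basis. P b) \<longleftrightarrow> (\<forall>i. P (coord_basis i))" for P :: "'e \<Rightarrow> bool"
    using bij_coord_basis by (metis UNIV_I bij_betw_imp_surj_on coord_basis_in_Basis imageE)
  have "of_vec -` box l u = box (to_vec l) (to_vec u)"
    by (auto simp: box_def all to_vec_def Basis_vec_def inner_axis)
  moreover have "emeasure lborel (box (to_vec l) (to_vec u)) = (\<Prod>b\<in>Basis. (to_vec u - to_vec l) \<bullet> b)"
    using lu by (intro emeasure_lborel_box) (auto simp: to_vec_def Basis_vec_def inner_axis)
  moreover have "(\<Prod>b\<in>Basis. (to_vec u - to_vec l) \<bullet> b) = (\<Prod>i\<in>UNIV. (u - l) \<bullet> coord_basis i)"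
  proof -
    have "bij_betw (\<lambda>i. axis i (1::real)) UNIV (Basis :: (real^'e coord) set)"
      by (auto simp: bij_betw_def inj_on_def Basis_vec_def axis_eq_axis)
    from prod.reindex_bij_betw[OF this, of "\<lambda>b. (to_vec u - to_vec l) \<bullet> b", symmetric]
    show ?thesis by (simp add: inner_axis to_vec_def inner_diff_left)
  qed
  ultimately show "emeasure (distr lborel borel of_vec) (box l u) = (\<Prod>b\<in>Basis. (u - l) \<bullet> b)"
    by (simp add: emeasure_distr prod_coord_basis[of "\<lambda>b. (u - l) \<bullet> b"])
qed simp

lemma nn_integral_of_vec:
  assumes "f \<in> borel_measurable borel"
  shows "(\<integral>\<^sup>+x. f x \<partial>lborel) = (\<integral>\<^sup>+v. f (of_vec v) \<partial>lborel)"
  using nn_integral_distr[of of_vec lborel borel f] assms by (simp add: lborel_of_vec)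

section \<open>Change of variables for nonnegative integrals\<close>

text \<open>The theorem for absolutely integrable functions, used with values in
  \<open>real^1\<close>, amounts to: one integrand has integral r iff the other has. If either
  nonnegative integral is finite this gives equality; otherwise both are infinite.\<close>

lemma nn_integral_change_of_variables_vec:
  fixes g :: "real^'m::{finite,wellorder} \<Rightarrow> real^'m::_" and f :: "real^'m::_ \<Rightarrow> real"
  assumes "S \<in> sets borel"
    and der: "\<And>x. x \<in> S \<Longrightarrow> (g has_derivative g' x) (at x within S)" and "inj_on g S"
    and nonneg: "\<And>y. 0 \<le> f y"
    and ml: "(\<lambda>x. (\<bar>det (matrix (g' x))\<bar> * f (g x)) * indicator S x) \<in> borel_measurable borel"
    and mr: "(\<lambda>y. f y * indicator (g ` S) y) \<in> borel_measurable borel"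
  shows "(\<integral>\<^sup>+x. ennreal (\<bar>det (matrix (g' x))\<bar> * f (g x)) * indicator S x \<partial>lborel)
       = (\<integral>\<^sup>+y. ennreal (f y) * indicator (g ` S) y \<partial>lborel)"
proof -
  define h where "h = (\<lambda>x. \<bar>det (matrix (g' x))\<bar> * f (g x))"
  have h0: "0 \<le> h x" for x by (simp add: h_def nonneg)
  have "S \<in> sets lebesgue" using assms(1) by simp
  note cov = has_absolute_integral_change_of_variables[OF this der \<open>inj_on g S\<close>, of "\<lambda>y. vec (f y) :: real^1"]
  have vec1: "(\<lambda>x. vec (k x) :: real^1) absolutely_integrable_on A \<and> integral A (\<lambda>x. vec (k x) :: real^1) = vec r
      \<longleftrightarrow> (k has_integral r) A" if "\<And>x. 0 \<le> k x" for k :: "real^'m::_ \<Rightarrow> real" and A r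
  proof -
    have "(\<lambda>x. vec (k x) :: real^1) absolutely_integrable_on A \<longleftrightarrow> k integrable_on A"
      using that by (simp only: absolutely_integrable_on_1_iff vec_component absolutely_integrable_on_iff_nonneg)
    moreover have "integral A (\<lambda>x. vec (k x) :: real^1) = vec r \<longleftrightarrow> integral A k = r"
      by (simp only: integral_on_1_eq vec_component vec_eq)
    ultimately show ?thesis by (simp only: has_integral_iff)
  qed
  have scale: "c *\<^sub>R vec d = (vec (c * d) :: real^1)" for c d :: real
    by (simp add: vec_eq_iff)
  have iff: "(h has_integral r) S \<longleftrightarrow> (f has_integral r) (g ` S)" for r
    using cov[of "vec r"] unfolding scale vec1[of f, OF nonneg] h_def[symmetric]
    using vec1[of h, OF h0] by (simp only: h_def)
  have fin: "(k has_integral r) T"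
    if "(\<integral>\<^sup>+x. ennreal (k x) * indicator T x \<partial>lborel) = ennreal r" "0 \<le> r" "\<And>x. 0 \<le> k x"
      "(\<lambda>x. k x * indicator T x) \<in> borel_measurable borel"
    for k :: "real^'m::_ \<Rightarrow> real" and T r
  proof -
    have "(\<integral>\<^sup>+x. ennreal (k x) * indicator T x \<partial>lborel) = (\<integral>\<^sup>+x. ennreal (k x * indicator T x) \<partial>lborel)"
      by (intro nn_integral_cong) (auto simp: indicator_def)
    then have "((\<lambda>x. k x * indicator T x) has_integral r) UNIV"
      using that by (intro nn_integral_has_integral) auto
    moreover have "(\<lambda>x. k x * indicator T x) = (\<lambda>x. if x \<in> T then k x else 0)"
      by (auto simp: indicator_def)
    ultimately show ?thesis by (simp add: has_integral_restrict_UNIV)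
  qed
  let ?A = "\<integral>\<^sup>+x. ennreal (h x) * indicator S x \<partial>lborel"
  let ?B = "\<integral>\<^sup>+y. ennreal (f y) * indicator (g ` S) y \<partial>lborel"
  have "?A = ?B"
  proof (cases "?A = \<infinity> \<and> ?B = \<infinity>")
    case False
    then consider "?A \<noteq> top" | "?B \<noteq> top" by auto
    then show ?thesis
    proof cases
      case 1
      then obtain r where r: "?A = ennreal r" "0 \<le> r" by (cases ?A) simp_all
      then have "(h has_integral r) S" using fin h0 ml by (simp add: h_def)
      then have "(f has_integral r) (g ` S)" using iff by simp
      then have "?B = ennreal r"
        by (rule nn_integral_has_integral_lebesgue'[rotated]) (rule nonneg)
      with r show ?thesis by simp
    next
      case 2
      then obtain r where r: "?B = ennreal r" "0 \<le> r" by (cases ?B) simp_all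
      then have "(f has_integral r) (g ` S)" using fin nonneg mr by simp
      then have "(h has_integral r) S" using iff by simp
      then have "?A = ennreal r"
        by (rule nn_integral_has_integral_lebesgue'[rotated]) (rule h0)
      with r show ?thesis by simp
    qed
  qed simp
  then show ?thesis by (simp add: h_def)
qed

section \<open>Gram determinants under pullback and in products\<close>

text \<open>Conjugation with the bijection matches the permutations of the two index sets and
  preserves the sign. It links \<open>gram_det\<close>, indexed by basis vectors, with matrix
  determinants, and later removes the embedding of one factor into a product.\<close>

lemma leibniz_sum_bij:
  fixes q :: "'b \<Rightarrow> 'b \<Rightarrow> real"
  assumes "bij_betw \<phi> S T" "finite S"
  shows "(\<Sum>s | s permutes T. of_int (sign s) * (\<Prod>b\<in>T. q b (s b)))
       = (\<Sum>s | s permutes S. of_int (sign s) * (\<Prod>b\<in>S. q (\<phi> b) (\<phi> (s b))))"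
proof -
  have inj: "inj_on \<phi> S" using assms bij_betw_def by blast
  have inv: "bij_betw (inv_into S \<phi>) T S" using assms bij_betw_inv_into by blast
  have fT: "finite T" using assms bij_betw_finite by blast
  have "bij_betw (map_permutation S \<phi>) {s. s permutes S} {s. s permutes T}"
  proof (rule bij_betw_byWitness[where f' = "map_permutation T (inv_into S \<phi>)"])
    show "\<forall>s\<in>{s. s permutes S}. map_permutation T (inv_into S \<phi>) (map_permutation S \<phi> s) = s"
      using assms inj by (auto intro!: map_permutation_compose_inv)
    show "\<forall>s\<in>{s. s permutes T}. map_permutation S \<phi> (map_permutation T (inv_into S \<phi>) s) = s"
      using assms inj inv
      by (auto intro!: map_permutation_compose_inv simp: bij_betw_def f_inv_into_f)
    show "map_permutation S \<phi> ` {s. s permutes S} \<subseteq> {s. s permutes T}"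
      using map_permutation_permutes[OF assms(1)] by auto
    show "map_permutation T (inv_into S \<phi>) ` {s. s permutes T} \<subseteq> {s. s permutes S}"
      using map_permutation_permutes[OF inv] by auto
  qed
  from sum.reindex_bij_betw[OF this, symmetric]
  have "(\<Sum>s | s permutes T. of_int (sign s) * (\<Prod>b\<in>T. q b (s b))) =
    (\<Sum>s | s permutes S. of_int (sign (map_permutation S \<phi> s)) * (\<Prod>b\<in>T. q b (map_permutation S \<phi> s b)))" .
  also have "\<dots> = (\<Sum>s | s permutes S. of_int (sign s) * (\<Prod>b\<in>S. q (\<phi> b) (\<phi> (s b))))"
  proof (intro sum.cong refl)
    fix s assume "s \<in> {s. s permutes S}"
    then have s: "s permutes S" by simp
    have "(\<Prod>b\<in>T. q b (map_permutation S \<phi> s b)) = (\<Prod>b\<in>S. q (\<phi> b) (map_permutation S \<phi> s (\<phi> b)))"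
      using prod.reindex_bij_betw[OF assms(1), symmetric] .
    also have "\<dots> = (\<Prod>b\<in>S. q (\<phi> b) (\<phi> (s b)))"
      using map_permutation_apply[OF inj] by (intro prod.cong) auto
    finally show "of_int (sign (map_permutation S \<phi> s)) * (\<Prod>b\<in>T. q b (map_permutation S \<phi> s b)) =
        of_int (sign s) * (\<Prod>b\<in>S. q (\<phi> b) (\<phi> (s b)))"
      using sign_map_permutation[OF inj s assms(2)] by simp
  qed
  finally show ?thesis .
qed

lemma gram_det_eq_det: "gram_det q = det (\<chi> i j. q (coord_basis i) (coord_basis j))"
  unfolding gram_det_def det_def
  by (subst leibniz_sum_bij[OF bij_coord_basis]) simp_all

lemma matrix_to_vec: "linear D \<Longrightarrow> matrix (to_vec \<circ> D \<circ> of_vec) $ k $ i = D (coord_basis i) \<bullet> coord_basis k"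
proof -
  have "of_vec (axis i 1) = (coord_basis i :: 'a)"
    by (simp add: of_vec_def axis_def if_distrib[of "\<lambda>r. r *\<^sub>R _"] cong: if_cong)
  then show ?thesis by (simp add: matrix_def to_vec_def)
qed

text \<open>If M is the matrix of D and G that of q, the pulled-back form has matrix M^T G M; the
  two outer factors give the squared Jacobian.\<close>

lemma gram_det_pullback:
  fixes q :: "'e::euclidean_space \<Rightarrow> 'e \<Rightarrow> real"
  assumes "bilinear q" "linear D"
  shows "gram_det (\<lambda>u v. q (D u) (D v)) = (det (matrix (to_vec \<circ> D \<circ> of_vec)))\<^sup>2 * gram_det q"
proof -
  let ?M = "matrix (to_vec \<circ> D \<circ> of_vec)" and ?G = "\<chi> i j. q (coord_basis i) (coord_basis j)"
  interpret l: linear "\<lambda>u. q u v" for v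
    using assms(1) by (simp add: bilinear_def)
  interpret r: linear "\<lambda>v. q u v" for u
    using assms(1) by (simp add: bilinear_def)
  have rep: "D (coord_basis i) = (\<Sum>k\<in>UNIV. ?M $ k $ i *\<^sub>R coord_basis k)" for i
    by (simp add: matrix_to_vec[OF assms(2)] sum_coord_basis[of "\<lambda>b. (_ \<bullet> b) *\<^sub>R b"] euclidean_representation)
  have "q (D (coord_basis i)) (D (coord_basis j)) = (transpose ?M ** ?G ** ?M) $ i $ j" for i j
    unfolding rep
    by (simp add: l.sum r.sum l.scaleR r.scaleR matrix_matrix_mult_def transpose_def
        sum_distrib_left sum_distrib_right mult_ac)
  then have "(\<chi> i j. q (D (coord_basis i)) (D (coord_basis j))) = transpose ?M ** ?G ** ?M"
    by (simp add: vec_eq_iff)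
  then show ?thesis
    by (simp add: gram_det_eq_det det_mul power2_eq_square)
qed

text \<open>The matrix is block diagonal with an entry 1 for the real factor. A permutation that
  moves this basis vector picks up an off-diagonal zero, so only the permutations of the second
  block contribute.\<close>

lemma gram_det_product:
  fixes h :: "'v::euclidean_space \<Rightarrow> 'v \<Rightarrow> real"
  assumes "\<And>v. h 0 v = 0" "\<And>v. h v 0 = 0"
  shows "gram_det (\<lambda>(r, v) (s, w). r * s + h v w) = gram_det h"
proof -
  let ?q = "\<lambda>(r, v) (s, w). r * s + h v w :: real" and ?e = "(1, 0) :: real \<times> 'v"
  let ?T = "Pair (0::real) ` (Basis :: 'v set)"
  have B: "(Basis :: (real \<times> 'v) set) = insert ?e ?T"
    by (auto simp: Basis_prod_def)
  have e: "?e \<notin> ?T" by auto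
  let ?t = "\<lambda>A s. of_int (sign s) * (\<Prod>b\<in>A. ?q b (s b)) :: real"
  have "(\<Sum>s | s permutes insert ?e ?T. ?t (insert ?e ?T) s) = (\<Sum>s | s permutes ?T. ?t (insert ?e ?T) s)"
  proof (rule sum.mono_neutral_right)
    show "finite {s. s permutes insert ?e ?T}" by (simp add: finite_permutations)
    show "{s. s permutes ?T} \<subseteq> {s. s permutes insert ?e ?T}"
      using permutes_subset[of _ ?T "insert ?e ?T"] by blast
    show "\<forall>s\<in>{s. s permutes insert ?e ?T} - {s. s permutes ?T}. ?t (insert ?e ?T) s = 0"
    proof
      fix s assume s: "s \<in> {s. s permutes insert ?e ?T} - {s. s permutes ?T}"
      then have "s ?e \<noteq> ?e"
        using permutes_superset[of s "insert ?e ?T" ?T] by auto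
      moreover have "s ?e \<in> insert ?e ?T"
        using s permutes_in_image[of s "insert ?e ?T" ?e] by auto
      ultimately obtain b where "s ?e = (0, b)" by auto
      then have "?q ?e (s ?e) = 0" using assms by simp
      then show "?t (insert ?e ?T) s = 0" using e by simp
    qed
  qed
  also have "\<dots> = (\<Sum>s | s permutes ?T. ?t ?T s)"
  proof (intro sum.cong refl)
    fix s assume "s \<in> {s. s permutes ?T}"
    then have "s ?e = ?e" using permutes_not_in[of s ?T ?e] e by blast
    then show "?t (insert ?e ?T) s = ?t ?T s" using e assms by simp
  qed
  also have "\<dots> = (\<Sum>s | s permutes Basis. of_int (sign s) * (\<Prod>b\<in>Basis. ?q (0, b) (0, s b)))"
    by (rule leibniz_sum_bij) (auto simp: bij_betw_def inj_on_def)
  finally show ?thesis unfolding gram_det_def B by simp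
qed

text \<open>By \<open>gram_det_pullback\<close> the square roots of the Gram determinants differ by
  exactly the absolute Jacobian, so no determinant of a derivative survives in the formula. The
  weight \<open>H\<close> lets it serve both for comparing chart densities and for the
  energy.\<close>

lemma nn_integral_change_of_variables_gram:
  fixes \<psi> :: "'e::euclidean_space \<Rightarrow> 'e" and H :: "'e \<Rightarrow> real"
  assumes S: "S \<in> sets borel" and T: "\<psi> ` S \<in> sets borel" and inj: "inj_on \<psi> S"
    and der: "\<And>x. x \<in> S \<Longrightarrow> \<exists>D. (\<psi> has_derivative D) (at x within S) \<and> (\<forall>u v. q x u v = q' (\<psi> x) (D u) (D v))"
    and bil: "\<And>x. x \<in> S \<Longrightarrow> bilinear (q' (\<psi> x))"
    and mq: "(\<lambda>x. gram_det (q x)) \<in> borel_measurable (restrict_space borel S)"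
    and mq': "(\<lambda>y. gram_det (q' y)) \<in> borel_measurable (restrict_space borel (\<psi> ` S))"
    and mH: "H \<in> borel_measurable (restrict_space borel (\<psi> ` S))" and H0: "\<And>y. 0 \<le> H y"
  shows "(\<integral>\<^sup>+x. ennreal (sqrt (gram_det (q x))) * ennreal (H (\<psi> x)) * indicator S x \<partial>lborel)
       = (\<integral>\<^sup>+y. ennreal (sqrt (gram_det (q' y))) * ennreal (H y) * indicator (\<psi> ` S) y \<partial>lborel)"
proof -
  from der obtain D where D: "\<And>x. x \<in> S \<Longrightarrow> (\<psi> has_derivative D x) (at x within S)"
    and qD: "\<And>x u v. x \<in> S \<Longrightarrow> q x u v = q' (\<psi> x) (D x u) (D x v)"
    by metis
  have cont: "continuous_on S \<psi>"
    using D has_derivative_continuous continuous_on_eq_continuous_within by blast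
  \<comment> \<open>Nonnegativity of the Gram determinant is not assumed, and \<open>sqrt\<close> of
    a negative number is negative. Truncation at 0 gives a nonnegative real function with the same
    \<open>ennreal\<close> value.\<close>
  define f where "f = (\<lambda>y. max 0 (sqrt (gram_det (q' y))) * H y)"
  have f0: "0 \<le> f y" for y by (simp add: f_def H0)
  have ef: "ennreal (f y) = ennreal (sqrt (gram_det (q' y))) * ennreal (H y)" for y
    by (simp add: f_def ennreal_mult H0) (metis ennreal_eq_0_iff max_def linorder_linear)
  define k where "k = (\<lambda>x. max 0 (sqrt (gram_det (q x))) * H (\<psi> x))"
  have ek: "ennreal (k x) = ennreal (sqrt (gram_det (q x))) * ennreal (H (\<psi> x))" for x
    by (simp add: k_def ennreal_mult H0) (metis ennreal_eq_0_iff max_def linorder_linear)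
  let ?J = "\<lambda>x. \<bar>det (matrix (to_vec \<circ> D x \<circ> of_vec))\<bar>"
  have kf: "k x = ?J x * f (\<psi> x)" if "x \<in> S" for x
  proof -
    have "q x = (\<lambda>u v. q' (\<psi> x) (D x u) (D x v))" using qD[OF that] by blast
    then have "gram_det (q x) = (?J x)\<^sup>2 * gram_det (q' (\<psi> x))"
      using gram_det_pullback[OF bil[OF that]] has_derivative_linear[OF D[OF that]] by simp
    then have eq: "sqrt (gram_det (q x)) = ?J x * sqrt (gram_det (q' (\<psi> x)))"
      by (simp add: real_sqrt_mult)
    have "max 0 (?J x * s) = ?J x * max 0 s" for s
      by (simp add: max_mult_distrib_left)
    then show ?thesis
      unfolding k_def f_def eq by (simp only: mult.assoc)
  qed
  have mf: "(\<lambda>y. f y * indicator (\<psi> ` S) y) \<in> borel_measurable borel"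
  proof -
    have "f \<in> borel_measurable (restrict_space borel (\<psi> ` S))"
      unfolding f_def using mq' mH by measurable
    then show ?thesis
      using T borel_measurable_restrict_space_iff[of "\<psi> ` S" borel f] by (simp add: mult.commute)
  qed
  have mk: "(\<lambda>x. k x * indicator S x) \<in> borel_measurable borel"
  proof -
    have "\<psi> \<in> restrict_space borel S \<rightarrow>\<^sub>M restrict_space borel (\<psi> ` S)"
      using borel_measurable_continuous_on_restrict[OF cont]
      by (intro measurable_restrict_space2) (auto simp: space_restrict_space)
    then have "(\<lambda>x. H (\<psi> x)) \<in> borel_measurable (restrict_space borel S)"
      using mH by measurable
    then have "k \<in> borel_measurable (restrict_space borel S)"
      unfolding k_def using mq by measurable
    then show ?thesis
      using S borel_measurable_restrict_space_iff[of S borel k] by (simp add: mult.commute)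
  qed
  let ?g = "to_vec \<circ> \<psi> \<circ> of_vec" and ?S = "to_vec ` S"
  have im: "?g ` ?S = to_vec ` (\<psi> ` S)" by (auto simp: image_image)
  have indS: "indicator (to_vec ` A) v = (indicator A (of_vec v) :: real)"
     "indicator (to_vec ` A) v = (indicator A (of_vec v) :: ennreal)" for A :: "'e set" and v
    unfolding to_vec_image_eq by (simp_all add: indicator_def)
  have "(\<integral>\<^sup>+x. ennreal (k x) * indicator S x \<partial>lborel)
      = (\<integral>\<^sup>+v. ennreal (k (of_vec v)) * indicator S (of_vec v) \<partial>lborel)"
  proof (rule nn_integral_of_vec)
    have "(\<lambda>x. ennreal (k x * indicator S x)) \<in> borel_measurable borel" using mk by measurable
    also have "(\<lambda>x. ennreal (k x * indicator S x)) = (\<lambda>x. ennreal (k x) * indicator S x)"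
      by (auto simp: indicator_def)
    finally show "(\<lambda>x. ennreal (k x) * indicator S x) \<in> borel_measurable borel" .
  qed
  also have "\<dots> = (\<integral>\<^sup>+v. ennreal (?J (of_vec v) * f (of_vec (?g v))) * indicator ?S v \<partial>lborel)"
    unfolding indS by (intro nn_integral_cong) (auto simp: indicator_def kf)
  also have "\<dots> = (\<integral>\<^sup>+w. ennreal (f (of_vec w)) * indicator (?g ` ?S) w \<partial>lborel)"
  proof (rule nn_integral_change_of_variables_vec)
    show "?S \<in> sets borel" using S by (rule to_vec_image_borel)
    show "(?g has_derivative to_vec \<circ> D (of_vec v) \<circ> of_vec) (at v within ?S)" if "v \<in> ?S" for v
    proof -
      have 1: "(of_vec has_derivative of_vec) (at v within ?S)"
        using bounded_linear_of_vec by (rule bounded_linear_imp_has_derivative)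
      have "of_vec v \<in> S" using that by auto
      then have 2: "(\<psi> has_derivative D (of_vec v)) (at (of_vec v) within of_vec ` ?S)"
        using D by (simp add: of_vec_image)
      from diff_chain_within[OF 1 2]
      have 3: "(\<psi> \<circ> of_vec has_derivative D (of_vec v) \<circ> of_vec) (at v within ?S)" .
      have 4: "(to_vec has_derivative to_vec) (at ((\<psi> \<circ> of_vec) v) within (\<psi> \<circ> of_vec) ` ?S)"
        using bounded_linear_to_vec by (rule bounded_linear_imp_has_derivative)
      from diff_chain_within[OF 3 4] show ?thesis by (simp only: o_assoc)
    qed
    show "inj_on ?g ?S"
      using inj by (auto simp: inj_on_def inj_eq[OF inj_to_vec])
    show "0 \<le> f (of_vec w)" for w by (rule f0)
    have "(\<lambda>v. (?J (of_vec v) * f (of_vec (?g v))) * indicator ?S v) = (\<lambda>v. k (of_vec v) * indicator S (of_vec v))"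
      unfolding indS by (auto simp: indicator_def kf)
    moreover have "(\<lambda>v. k (of_vec v) * indicator S (of_vec v)) \<in> borel_measurable borel"
      using measurable_compose[OF of_vec_measurable mk] by simp
    ultimately show "(\<lambda>v. (?J (of_vec v) * f (of_vec (?g v))) * indicator ?S v) \<in> borel_measurable borel"
      by simp
    show "(\<lambda>w. f (of_vec w) * indicator (?g ` ?S) w) \<in> borel_measurable borel"
      unfolding im indS using measurable_compose[OF of_vec_measurable mf] by simp
  qed
  also have "\<dots> = (\<integral>\<^sup>+w. ennreal (f (of_vec w)) * indicator (\<psi> ` S) (of_vec w) \<partial>lborel)"
    unfolding im indS ..
  also have "\<dots> = (\<integral>\<^sup>+y. ennreal (f y) * indicator (\<psi> ` S) y \<partial>lborel)"
  proof (rule nn_integral_of_vec[symmetric])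
    have "(\<lambda>x. ennreal (f x * indicator (\<psi> ` S) x)) \<in> borel_measurable borel" using mf by measurable
    also have "(\<lambda>x. ennreal (f x * indicator (\<psi> ` S) x)) = (\<lambda>x. ennreal (f x) * indicator (\<psi> ` S) x)"
      by (auto simp: indicator_def)
    finally show "(\<lambda>x. ennreal (f x) * indicator (\<psi> ` S) x) \<in> borel_measurable borel" .
  qed
  finally show ?thesis by (simp add: ek ef)
qed

section \<open>The Riemannian measure\<close>

text \<open>The direct image is the preimage under the continuous inverse, and preimages of Borel
  sets are harmless.\<close>

lemma homeomorphism_image_borel:
  assumes "homeomorphism U V \<phi> \<iota>" "V \<in> sets borel" "S \<in> sets borel" "S \<subseteq> U"
  shows "\<phi> ` S \<in> sets borel"
proof -
  have eq: "\<phi> ` S = \<iota> -` S \<inter> V"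
  proof
    show "\<phi> ` S \<subseteq> \<iota> -` S \<inter> V"
      using assms(1,4) by (auto simp: homeomorphism_def)
    show "\<iota> -` S \<inter> V \<subseteq> \<phi> ` S"
      using assms(1) by (force simp: homeomorphism_def)
  qed
  have "\<iota> \<in> borel_measurable (restrict_space borel V)"
    using assms(1) by (intro borel_measurable_continuous_on_restrict) (auto simp: homeomorphism_def)
  from measurable_sets[OF this assms(3)]
  have "\<iota> -` S \<inter> V \<in> sets (restrict_space borel V)"
    by (simp add: space_restrict_space)
  then show ?thesis
    using assms(2) by (simp add: eq sets_restrict_space_iff)
qed

lemma suminf_ennreal_commute:
  fixes f :: "nat \<Rightarrow> nat \<Rightarrow> ennreal"
  shows "(\<Sum>k. \<Sum>n. f k n) = (\<Sum>n. \<Sum>k. f k n)"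
  using nn_integral_suminf[of "\<lambda>n k. f k n" "count_space UNIV"]
  by (simp add: nn_integral_count_space_nat)

text \<open>Measurability is asked only on the union because densities are controlled only on chart
  images.\<close>

lemma set_nn_integral_disjoint_UN:
  fixes f :: "'b \<Rightarrow> ennreal" and S :: "nat \<Rightarrow> 'b set"
  assumes "(\<lambda>x. f x * indicator (\<Union>n. S n) x) \<in> borel_measurable N"
    and S: "\<And>n. S n \<in> sets N" and disj: "disjoint_family S"
  shows "(\<integral>\<^sup>+x\<in>(\<Union>n. S n). f x \<partial>N) = (\<Sum>n. \<integral>\<^sup>+x\<in>S n. f x \<partial>N)"
proof -
  have "(\<integral>\<^sup>+x\<in>(\<Union>n. S n). f x \<partial>N) = (\<integral>\<^sup>+x. (\<Sum>n. f x * indicator (S n) x) \<partial>N)"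
    using suminf_indicator[OF disj] by (simp add: ennreal_suminf_cmult)
  also have "\<dots> = (\<Sum>n. \<integral>\<^sup>+x\<in>S n. f x \<partial>N)"
  proof (rule nn_integral_suminf)
    fix n
    have "(\<lambda>x. f x * indicator (\<Union>n. S n) x * indicator (S n) x) \<in> borel_measurable N"
      using assms(1) S by measurable
    also have "(\<lambda>x. f x * indicator (\<Union>n. S n) x * indicator (S n) x) = (\<lambda>x. f x * indicator (S n) x)"
      by (auto simp: indicator_def)
    finally show "(\<lambda>x. f x * indicator (S n) x) \<in> borel_measurable N" .
  qed
  finally show ?thesis .
qed

text \<open>Common ground of M, modelled on a half-space, and its boundary, modelled on
  \<open>'v\<close>: chart images are only required to be Borel, so the measure is constructed once
  for both. Smoothness enters only through measurability and the derivatives of transition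
  maps.\<close>

locale riemannian_atlas =
  fixes A :: "('i, 'a::{t2_space,second_countable_topology}, 'e::euclidean_space) atlas"
    and g :: "('i, 'a, 'e) tensor2"
  assumes nonempty: "charts A \<noteq> {}"
    and points_borel: "points A \<in> sets borel"
    and open_dom: "i \<in> charts A \<Longrightarrow> openin (top_of_set (points A)) (chart_dom A i)"
    and image_borel: "i \<in> charts A \<Longrightarrow> chart_map A i ` chart_dom A i \<in> sets borel"
    and homeo: "i \<in> charts A \<Longrightarrow>
      homeomorphism (chart_dom A i) (chart_map A i ` chart_dom A i) (chart_map A i) (chart_inv A i)"
    and bilinear: "i \<in> charts A \<Longrightarrow> p \<in> chart_dom A i \<Longrightarrow> bilinear (g i p)"
    and gram_measurable: "i \<in> charts A \<Longrightarrow> (\<lambda>x. gram_det (g i (chart_inv A i x)))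
        \<in> borel_measurable (restrict_space borel (chart_map A i ` chart_dom A i))"
    and transition: "i \<in> charts A \<Longrightarrow> j \<in> charts A \<Longrightarrow> p \<in> chart_dom A i \<Longrightarrow> p \<in> chart_dom A j \<Longrightarrow>
      \<exists>D. (chart_map A j \<circ> chart_inv A i has_derivative D)
             (at (chart_map A i p) within chart_map A i ` (chart_dom A i \<inter> chart_dom A j)) \<and>
          (\<forall>u v. g i p u v = g j p (D u) (D v))"
begin

lemma inv_map [simp]: "i \<in> charts A \<Longrightarrow> p \<in> chart_dom A i \<Longrightarrow> chart_inv A i (chart_map A i p) = p"
  using homeo by (auto simp: homeomorphism_def)

lemma dom_points: "i \<in> charts A \<Longrightarrow> chart_dom A i \<subseteq> points A"
  by (auto simp: points_def)

lemma sets_points: "S \<in> sets (restrict_space borel (points A)) \<longleftrightarrow> S \<subseteq> points A \<and> S \<in> sets borel"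
  using points_borel by (simp add: sets_restrict_space_iff)

lemma dom_borel: "i \<in> charts A \<Longrightarrow> chart_dom A i \<in> sets borel"
  by (metis open_dom openin_open borel_open points_borel sets.Int)

lemma map_image_borel: "i \<in> charts A \<Longrightarrow> S \<in> sets borel \<Longrightarrow> S \<subseteq> chart_dom A i \<Longrightarrow> chart_map A i ` S \<in> sets borel"
  using homeomorphism_image_borel[OF homeo image_borel] .

lemma map_inj: "i \<in> charts A \<Longrightarrow> inj_on (chart_map A i) (chart_dom A i)"
  by (metis inj_onI inv_map)

lemma map_image_vimage:
  "i \<in> charts A \<Longrightarrow> S \<subseteq> chart_dom A i \<Longrightarrow>
    chart_inv A i -` S \<inter> chart_map A i ` chart_dom A i = chart_map A i ` S"
  by auto

definition chart_density :: "'i \<Rightarrow> 'e \<Rightarrow> ennreal" where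
  "chart_density i x = ennreal (sqrt (gram_det (g i (chart_inv A i x))))"

lemma chart_density_measurable:
  "i \<in> charts A \<Longrightarrow>
    chart_density i \<in> borel_measurable (restrict_space borel (chart_map A i ` chart_dom A i))"
  unfolding chart_density_def[abs_def] using gram_measurable by measurable

definition chart_measure :: "'i \<Rightarrow> 'a measure" where
  "chart_measure i = distr (density (restrict_space lborel (chart_map A i ` chart_dom A i)) (chart_density i))
     (restrict_space borel (chart_dom A i)) (chart_inv A i)"

lemma sets_chart_measure: "sets (chart_measure i) = sets (restrict_space borel (chart_dom A i))"
  by (simp add: chart_measure_def)

lemma inv_measurable:
  assumes "i \<in> charts A"
  shows "chart_inv A i \<in> restrict_space borel (chart_map A i ` chart_dom A i) \<rightarrow>\<^sub>M restrict_space borel (chart_dom A i)"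
proof (rule measurable_restrict_space2)
  show "chart_inv A i \<in> borel_measurable (restrict_space borel (chart_map A i ` chart_dom A i))"
    using homeo[OF assms] by (intro borel_measurable_continuous_on_restrict) (auto simp: homeomorphism_def)
qed (use assms in \<open>auto simp: space_restrict_space\<close>)

lemma measurable_restrict_lborel:
  "measurable (restrict_space lborel X) N = measurable (restrict_space borel X) N"
  by (rule measurable_cong_sets) (simp_all add: sets_restrict_space)

lemma nn_integral_chart_measure:
  assumes "i \<in> charts A" "F \<in> borel_measurable (restrict_space borel (chart_dom A i))"
  shows "(\<integral>\<^sup>+p. F p \<partial>chart_measure i)
    = (\<integral>\<^sup>+x. chart_density i x * F (chart_inv A i x) * indicator (chart_map A i ` chart_dom A i) x \<partial>lborel)"
proof -
  let ?V = "chart_map A i ` chart_dom A i"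
  have m: "(\<lambda>x. F (chart_inv A i x)) \<in> borel_measurable (restrict_space borel ?V)"
    using measurable_compose[OF inv_measurable[OF assms(1)] assms(2)] .
  have "(\<integral>\<^sup>+p. F p \<partial>chart_measure i)
      = (\<integral>\<^sup>+x. F (chart_inv A i x) \<partial>density (restrict_space lborel ?V) (chart_density i))"
    unfolding chart_measure_def
    by (rule nn_integral_distr) (use inv_measurable assms in \<open>simp_all add: measurable_restrict_lborel\<close>)
  also have "\<dots> = (\<integral>\<^sup>+x. chart_density i x * F (chart_inv A i x) \<partial>restrict_space lborel ?V)"
    by (rule nn_integral_density)
      (use m chart_density_measurable assms in \<open>simp_all add: measurable_restrict_lborel\<close>)
  also have "\<dots> = (\<integral>\<^sup>+x. chart_density i x * F (chart_inv A i x) * indicator ?V x \<partial>lborel)"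
    by (rule nn_integral_restrict_space) (use image_borel assms in simp)
  finally show ?thesis .
qed

lemma emeasure_chart_measure:
  assumes "i \<in> charts A" "S \<in> sets borel" "S \<subseteq> chart_dom A i"
  shows "emeasure (chart_measure i) S = (\<integral>\<^sup>+x\<in>chart_map A i ` S. chart_density i x \<partial>lborel)"
proof -
  have S: "S \<in> sets (restrict_space borel (chart_dom A i))"
    using assms dom_borel by (simp add: sets_restrict_space_iff)
  then have "emeasure (chart_measure i) S = (\<integral>\<^sup>+p. indicator S p \<partial>chart_measure i)"
    by (simp add: sets_chart_measure)
  also have "\<dots> = (\<integral>\<^sup>+x. chart_density i x * indicator S (chart_inv A i x) * indicator (chart_map A i ` chart_dom A i) x \<partial>lborel)"
    using S assms(1) by (intro nn_integral_chart_measure) auto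
  also have "\<dots> = (\<integral>\<^sup>+x\<in>chart_map A i ` S. chart_density i x \<partial>lborel)"
    using map_image_vimage[OF assms(1,3)]
    by (intro nn_integral_cong) (auto simp: indicator_def split: if_splits)
  finally show ?thesis .
qed

lemma nn_integral_chart_change:
  assumes "i \<in> charts A" "j \<in> charts A" "S \<in> sets borel" "S \<subseteq> chart_dom A i" "S \<subseteq> chart_dom A j"
  shows "(\<integral>\<^sup>+x\<in>chart_map A i ` S. chart_density i x \<partial>lborel) = (\<integral>\<^sup>+x\<in>chart_map A j ` S. chart_density j x \<partial>lborel)"
proof -
  let ?\<psi> = "chart_map A j \<circ> chart_inv A i"
  have im: "?\<psi> ` (chart_map A i ` S) = chart_map A j ` S"
    using assms by (force simp: image_image)
  have "(\<integral>\<^sup>+x. ennreal (sqrt (gram_det (g i (chart_inv A i x)))) * ennreal 1 * indicator (chart_map A i ` S) x \<partial>lborel)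
     = (\<integral>\<^sup>+x. ennreal (sqrt (gram_det (g j (chart_inv A j x)))) * ennreal 1 * indicator (?\<psi> ` (chart_map A i ` S)) x \<partial>lborel)"
  proof (rule nn_integral_change_of_variables_gram[where H = "\<lambda>_. 1"])
    show "chart_map A i ` S \<in> sets borel" "?\<psi> ` (chart_map A i ` S) \<in> sets borel"
      using assms map_image_borel by (simp_all only: im)
    show "inj_on ?\<psi> (chart_map A i ` S)"
    proof (rule inj_onI)
      fix x y assume "x \<in> chart_map A i ` S" "y \<in> chart_map A i ` S" "?\<psi> x = ?\<psi> y"
      then obtain p q where "p \<in> S" "q \<in> S" "x = chart_map A i p" "y = chart_map A i q"
        "chart_map A j p = chart_map A j q"
        using assms by auto (metis assms(1,4) inv_map subsetD)
      then show "x = y" using map_inj[OF assms(2)] assms(5) by (metis inj_onD subsetD)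
    qed
    fix x assume "x \<in> chart_map A i ` S"
    then obtain p where p: "p \<in> S" "x = chart_map A i p" by blast
    then have pi: "p \<in> chart_dom A i" and pj: "p \<in> chart_dom A j" using assms by auto
    have sub: "chart_map A i ` S \<subseteq> chart_map A i ` (chart_dom A i \<inter> chart_dom A j)"
      using assms by blast
    show "\<exists>D. (?\<psi> has_derivative D) (at x within chart_map A i ` S) \<and>
        (\<forall>u v. g i (chart_inv A i x) u v = g j (chart_inv A j (?\<psi> x)) (D u) (D v))"
      using transition[OF assms(1,2) pi pj] has_derivative_subset[OF _ sub] pi pj assms p by auto
    show "bilinear (g j (chart_inv A j (?\<psi> x)))"
      using bilinear pi pj assms p by auto
  next
    show "(\<lambda>x. gram_det (g i (chart_inv A i x))) \<in> borel_measurable (restrict_space borel (chart_map A i ` S))"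
      by (rule measurable_restrict_mono[OF gram_measurable[OF assms(1)]]) (use assms in blast)
    show "(\<lambda>x. gram_det (g j (chart_inv A j x))) \<in> borel_measurable (restrict_space borel (?\<psi> ` (chart_map A i ` S)))"
      unfolding im by (rule measurable_restrict_mono[OF gram_measurable[OF assms(2)]]) (use assms in blast)
  qed simp_all
  then show ?thesis unfolding im by (simp add: chart_density_def)
qed

section \<open>Gluing the chart measures along a countable Borel partition\<close>

lemma countable_cover:
  obtains c :: "nat \<Rightarrow> 'i" where "range c \<subseteq> charts A" "(\<Union>n. chart_dom A (c n)) = points A"
proof -
  obtain F where F: "F \<subseteq> chart_dom A ` charts A" "countable F" "\<Union>F = \<Union>(chart_dom A ` charts A)"
    using Lindelof_openin[of "chart_dom A ` charts A" "points A"] open_dom by blast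
  then obtain C where C: "C \<subseteq> charts A" "countable C" "F = chart_dom A ` C"
    using countable_subset_image[of F "chart_dom A" "charts A"] by auto
  \<comment> \<open>Adding one chart guarantees a nonempty countable set, whose range under
    \<open>from_nat_into\<close> is the set itself.\<close>
  obtain i where i: "i \<in> charts A" using nonempty by blast
  let ?c = "from_nat_into (insert i C)"
  have r: "range ?c = insert i C"
    using C by (intro range_from_nat_into) auto
  have "range (\<lambda>n. chart_dom A (?c n)) = chart_dom A ` range ?c"
    by (simp only: image_image)
  then have "(\<Union>n. chart_dom A (?c n)) = \<Union>(chart_dom A ` insert i C)"
    by (simp only: r)
  also have "\<dots> = points A"
    using F C i by (auto simp: points_def)
  finally show ?thesis
    using that[of ?c] r C i by auto
qed

definition cover :: "nat \<Rightarrow> 'i" where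
  "cover = (SOME c. range c \<subseteq> charts A \<and> (\<Union>n. chart_dom A (c n)) = points A)"

lemma cover: "cover n \<in> charts A" "(\<Union>n. chart_dom A (cover n)) = points A"
proof -
  have "\<exists>c :: nat \<Rightarrow> 'i. range c \<subseteq> charts A \<and> (\<Union>n. chart_dom A (c n)) = points A"
    by (rule countable_cover) blast
  from someI_ex[OF this] have "range cover \<subseteq> charts A \<and> (\<Union>n. chart_dom A (cover n)) = points A"
    unfolding cover_def .
  then show "cover n \<in> charts A" "(\<Union>n. chart_dom A (cover n)) = points A" by auto
qed

text \<open>A Borel partition with each member inside one chart. It plays the role of a partition of
  unity: integrals over the manifold become sums over pieces.\<close>

definition piece :: "nat \<Rightarrow> 'a set" where
  "piece = disjointed (\<lambda>n. chart_dom A (cover n))"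

lemma piece_dom: "piece n \<subseteq> chart_dom A (cover n)"
  unfolding piece_def by (rule disjointed_subset)

lemma disjoint_piece: "disjoint_family piece"
  unfolding piece_def by (rule disjoint_family_disjointed)

lemma UN_piece: "(\<Union>n. piece n) = points A"
  unfolding piece_def by (simp add: UN_disjointed_eq cover)

lemma piece_borel: "piece n \<in> sets borel"
proof -
  have "range (\<lambda>n. chart_dom A (cover n)) \<subseteq> sets borel"
    using dom_borel cover by blast
  from sets.range_disjointed_sets[OF this] show ?thesis
    by (auto simp: piece_def)
qed

text \<open>Each piece is measured in its own chart and the results are added. The formula in an
  arbitrary chart \<open>i\<close> follows because on a part of a piece inside that chart the two
  densities integrate alike (\<open>nn_integral_chart_change\<close>).\<close>

lemma riemannian_measure_exists:
  "\<exists>\<mu>. sets \<mu> = sets (restrict_space borel (points A)) \<and>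
     (\<forall>i\<in>charts A. \<forall>S\<in>sets \<mu>. S \<subseteq> chart_dom A i \<longrightarrow>
        emeasure \<mu> S = (\<integral>\<^sup>+x\<in>chart_map A i ` S. chart_density i x \<partial>lborel))"
proof -
  define f where "f S = (\<Sum>n. emeasure (chart_measure (cover n)) (S \<inter> piece n))" for S
  let ?R = "restrict_space borel (points A)"
  define \<mu> where "\<mu> = measure_of (points A) (sets ?R) f"
  have sp: "space ?R = points A" by (simp add: space_restrict_space)
  have Sn: "S \<inter> piece n \<in> sets (chart_measure (cover n))" if "S \<in> sets ?R" for S n
    using that piece_borel piece_dom dom_borel[OF cover(1)]
    by (auto simp: sets_chart_measure sets_restrict_space_iff sets_points)
  have sets: "sets \<mu> = sets ?R"
    unfolding \<mu>_def using sets.space_closed[of ?R] sets.sigma_sets_eq[of ?R] by (simp add: sp)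
  have em: "emeasure \<mu> S = f S" if "S \<in> sets ?R" for S
  proof (rule emeasure_measure_of[OF \<mu>_def])
    show "sets ?R \<subseteq> Pow (points A)" using sets.space_closed[of ?R] by (simp add: sp)
    show "S \<in> sets \<mu>" using that sets by simp
    show "positive (sets \<mu>) f" by (simp add: positive_def f_def)
    show "countably_additive (sets \<mu>) f"
    proof (rule countably_additiveI)
      fix F :: "nat \<Rightarrow> 'a set"
      assume F: "range F \<subseteq> sets \<mu>" "disjoint_family F"
      have "(\<Sum>k. f (F k)) = (\<Sum>n. \<Sum>k. emeasure (chart_measure (cover n)) (F k \<inter> piece n))"
        unfolding f_def by (rule suminf_ennreal_commute)
      also have "\<dots> = (\<Sum>n. emeasure (chart_measure (cover n)) (\<Union>k. F k \<inter> piece n))"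
      proof (intro suminf_cong suminf_emeasure)
        show "range (\<lambda>k. F k \<inter> piece n) \<subseteq> sets (chart_measure (cover n))" for n
          using F Sn sets by blast
        show "disjoint_family (\<lambda>k. F k \<inter> piece n)" for n
          using F(2) by (auto simp: disjoint_family_on_def)
      qed
      also have "\<dots> = f (\<Union>k. F k)" by (simp add: f_def)
      finally show "(\<Sum>k. f (F k)) = f (\<Union>k. F k)" .
    qed
  qed
  have "emeasure \<mu> S = (\<integral>\<^sup>+x\<in>chart_map A i ` S. chart_density i x \<partial>lborel)"
    if i: "i \<in> charts A" and S: "S \<in> sets \<mu>" "S \<subseteq> chart_dom A i" for i S
  proof -
    have Sb: "S \<in> sets borel" using S sets sets_points by auto
    have "emeasure \<mu> S = (\<Sum>n. emeasure (chart_measure (cover n)) (S \<inter> piece n))"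
      using em S sets by (simp add: f_def)
    also have "\<dots> = (\<Sum>n. emeasure (chart_measure i) (S \<inter> piece n))"
    proof (intro suminf_cong)
      fix n
      have "S \<inter> piece n \<in> sets borel" "S \<inter> piece n \<subseteq> chart_dom A i" "S \<inter> piece n \<subseteq> chart_dom A (cover n)"
        using Sb S piece_borel piece_dom by auto
      then show "emeasure (chart_measure (cover n)) (S \<inter> piece n) = emeasure (chart_measure i) (S \<inter> piece n)"
        using i cover by (simp add: emeasure_chart_measure nn_integral_chart_change[of i "cover n"])
    qed
    also have "\<dots> = emeasure (chart_measure i) (\<Union>n. S \<inter> piece n)"
    proof (rule suminf_emeasure)
      show "range (\<lambda>n. S \<inter> piece n) \<subseteq> sets (chart_measure i)"
        using Sb S piece_borel dom_borel[OF i] by (auto simp: sets_chart_measure sets_restrict_space_iff)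
      show "disjoint_family (\<lambda>n. S \<inter> piece n)"
        using disjoint_piece by (auto simp: disjoint_family_on_def)
    qed
    also have "(\<Union>n. S \<inter> piece n) = S"
      using UN_piece S(2) dom_points[OF i] by blast
    finally show ?thesis using emeasure_chart_measure[OF i Sb S(2)] by simp
  qed
  with sets show ?thesis by blast
qed

text \<open>The chart formula fixes the measure of every intersection with a piece and countable
  additivity does the rest. The solution is therefore unique, and the description in
  \<open>riemannian_measure\<close> denotes it.\<close>

lemma riemannian_measure:
  shows sets_riemannian_measure: "sets (riemannian_measure A g) = sets (restrict_space borel (points A))"
    and emeasure_riemannian_measure: "i \<in> charts A \<Longrightarrow> S \<in> sets borel \<Longrightarrow> S \<subseteq> chart_dom A i \<Longrightarrow>
      emeasure (riemannian_measure A g) S = (\<integral>\<^sup>+x\<in>chart_map A i ` S. chart_density i x \<partial>lborel)"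
proof -
  let ?P = "\<lambda>\<mu>. sets \<mu> = sets (restrict_space borel (points A)) \<and>
     (\<forall>i\<in>charts A. \<forall>S\<in>sets \<mu>. S \<subseteq> chart_dom A i \<longrightarrow>
        emeasure \<mu> S = (\<integral>\<^sup>+x\<in>chart_map A i ` S. chart_density i x \<partial>lborel))"
  have unique: "\<mu> = \<nu>" if \<mu>: "?P \<mu>" and \<nu>: "?P \<nu>" for \<mu> \<nu>
  proof (rule measure_eqI)
    show "sets \<mu> = sets \<nu>" using \<mu> \<nu> by simp
    fix S assume S: "S \<in> sets \<mu>"
    then have Sp: "S \<subseteq> points A" "S \<in> sets borel" using \<mu> sets_points by auto
    have decomp: "emeasure \<rho> S = (\<Sum>n. \<integral>\<^sup>+x\<in>chart_map A (cover n) ` (S \<inter> piece n). chart_density (cover n) x \<partial>lborel)"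
      if \<rho>: "?P \<rho>" for \<rho>
    proof -
      have Sn: "S \<inter> piece n \<in> sets \<rho>" for n
        using Sp piece_borel \<rho> sets_points by auto
      have "emeasure \<rho> S = emeasure \<rho> (\<Union>n. S \<inter> piece n)"
        using UN_piece Sp by (metis Int_UN_distrib Int_absorb2)
      also have "\<dots> = (\<Sum>n. emeasure \<rho> (S \<inter> piece n))"
        using Sn disjoint_piece by (intro suminf_emeasure[symmetric]) (auto simp: disjoint_family_on_def)
      also have "\<dots> = (\<Sum>n. \<integral>\<^sup>+x\<in>chart_map A (cover n) ` (S \<inter> piece n). chart_density (cover n) x \<partial>lborel)"
        using \<rho> Sn cover piece_dom by (intro suminf_cong) (meson inf.coboundedI2)
      finally show ?thesis .
    qed
    show "emeasure \<mu> S = emeasure \<nu> S"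
      using decomp[OF \<mu>] decomp[OF \<nu>] by simp
  qed
  have eq: "riemannian_measure A g = (THE \<mu>. ?P \<mu>)"
    by (simp add: riemannian_measure_def chart_density_def)
  have ex1: "\<exists>!\<mu>. ?P \<mu>"
    by (rule ex_ex1I[OF riemannian_measure_exists unique])
  have P: "?P (riemannian_measure A g)"
    unfolding eq by (rule theI'[of ?P, OF ex1])
  then show "sets (riemannian_measure A g) = sets (restrict_space borel (points A))" by blast
  show "emeasure (riemannian_measure A g) S = (\<integral>\<^sup>+x\<in>chart_map A i ` S. chart_density i x \<partial>lborel)"
    if "i \<in> charts A" "S \<in> sets borel" "S \<subseteq> chart_dom A i"
  proof -
    have "S \<in> sets (riemannian_measure A g)"
      using P that sets_points order_trans[OF that(3) dom_points[OF that(1)]] by simp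
    then show ?thesis using P that by blast
  qed
qed

lemma space_riemannian_measure: "space (riemannian_measure A g) = points A"
  using sets_eq_imp_space_eq[OF sets_riemannian_measure] by (simp add: space_restrict_space)

text \<open>Restricted to a chart domain the Riemannian measure is \<open>chart_measure\<close>,
  which passes the formula from sets to functions.\<close>

lemma nn_integral_riemannian_measure_chart:
  assumes i: "i \<in> charts A" and S: "S \<in> sets borel" "S \<subseteq> chart_dom A i"
    and F: "F \<in> borel_measurable (restrict_space borel (points A))"
  shows "(\<integral>\<^sup>+p\<in>S. F p \<partial>riemannian_measure A g)
    = (\<integral>\<^sup>+x\<in>chart_map A i ` S. chart_density i x * F (chart_inv A i x) \<partial>lborel)"
proof -
  let ?\<mu> = "riemannian_measure A g"
  have dom: "chart_dom A i \<in> sets ?\<mu>"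
    using dom_borel dom_points i by (simp add: sets_riemannian_measure sets_points)
  have restr: "restrict_space ?\<mu> (chart_dom A i) = chart_measure i"
  proof (rule measure_eqI)
    show s: "sets (restrict_space ?\<mu> (chart_dom A i)) = sets (chart_measure i)"
      using dom_borel[OF i] dom_points[OF i] points_borel
      by (auto simp: sets_chart_measure sets_restrict_space_iff dom sets_riemannian_measure
          order_trans[OF _ dom_points[OF i]])
    fix T assume "T \<in> sets (restrict_space ?\<mu> (chart_dom A i))"
    then have T: "T \<in> sets borel" "T \<subseteq> chart_dom A i"
      unfolding s using dom_borel[OF i] by (auto simp: sets_chart_measure sets_restrict_space_iff)
    then show "emeasure (restrict_space ?\<mu> (chart_dom A i)) T = emeasure (chart_measure i) T"
      using dom i by (simp add: emeasure_restrict_space emeasure_riemannian_measure emeasure_chart_measure)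
  qed
  have FS: "(\<lambda>p. F p * indicator S p) \<in> borel_measurable (restrict_space borel (chart_dom A i))"
  proof -
    have "F \<in> borel_measurable (restrict_space borel (chart_dom A i))"
      using F by (rule measurable_restrict_mono) (rule dom_points[OF i])
    moreover have "indicator S \<in> borel_measurable (restrict_space borel (chart_dom A i))"
      using S by (intro measurable_restrict_space1) auto
    ultimately show ?thesis by measurable
  qed
  have "(\<integral>\<^sup>+p\<in>S. F p \<partial>?\<mu>) = (\<integral>\<^sup>+p. F p * indicator S p * indicator (chart_dom A i) p \<partial>?\<mu>)"
    using S by (intro nn_integral_cong) (auto simp: indicator_def)
  also have "\<dots> = (\<integral>\<^sup>+p. F p * indicator S p \<partial>restrict_space ?\<mu> (chart_dom A i))"
    using dom by (intro nn_integral_restrict_space[symmetric]) simp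
  also have "\<dots> = (\<integral>\<^sup>+x. chart_density i x * (F (chart_inv A i x) * indicator S (chart_inv A i x)) *
      indicator (chart_map A i ` chart_dom A i) x \<partial>lborel)"
    unfolding restr using i FS by (rule nn_integral_chart_measure)
  also have "\<dots> = (\<integral>\<^sup>+x\<in>chart_map A i ` S. chart_density i x * F (chart_inv A i x) \<partial>lborel)"
    using map_image_vimage[OF i S(2)]
    by (intro nn_integral_cong) (auto simp: indicator_def split: if_splits)
  finally show ?thesis .
qed

lemma nn_integral_pieces:
  assumes "F \<in> borel_measurable (restrict_space borel (points A))" "S \<in> sets borel" "S \<subseteq> points A"
  shows "(\<integral>\<^sup>+p\<in>S. F p \<partial>riemannian_measure A g) = (\<Sum>n. \<integral>\<^sup>+p\<in>S \<inter> piece n. F p \<partial>riemannian_measure A g)"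
proof -
  let ?\<mu> = "riemannian_measure A g"
  have ms: "measurable ?\<mu> N = measurable (restrict_space borel (points A)) N" for N
    by (rule measurable_cong_sets) (simp_all add: sets_riemannian_measure)
  have S: "(\<Union>n. S \<inter> piece n) = S" using UN_piece assms(3) by blast
  have "(\<integral>\<^sup>+p\<in>(\<Union>n. S \<inter> piece n). F p \<partial>?\<mu>) = (\<Sum>n. \<integral>\<^sup>+p\<in>S \<inter> piece n. F p \<partial>?\<mu>)"
  proof (rule set_nn_integral_disjoint_UN)
    have "indicator S \<in> borel_measurable (restrict_space borel (points A))"
      using assms(2) by (intro measurable_restrict_space1) auto
    with assms(1) show "(\<lambda>p. F p * indicator (\<Union>n. S \<inter> piece n) p) \<in> borel_measurable ?\<mu>"
      unfolding ms S by measurable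
    show "S \<inter> piece n \<in> sets ?\<mu>" for n
      using assms piece_borel by (auto simp: sets_riemannian_measure sets_points)
    show "disjoint_family (\<lambda>n. S \<inter> piece n)"
      using disjoint_piece by (auto simp: disjoint_family_on_def)
  qed
  then show ?thesis by (simp only: S)
qed

end

section \<open>Charts of a manifold with boundary\<close>

text \<open>Uniqueness requires only arbitrarily small nonzero multiples of each basis vector as
  increments, of either sign. Positive ones stay in the half-space, as the first coordinate of a
  basis vector is 0 or 1.\<close>

lemma half_space_derivative_unique:
  fixes x :: "real \<times> 'v::euclidean_space"
  assumes S: "openin (top_of_set half_space) S" "x \<in> S"
    and D: "(f has_derivative D) (at x within S)" "(f has_derivative D') (at x within S)"
  shows "D = D'"
proof (rule frechet_derivative_unique_within[OF D])
  fix i :: "real \<times> 'v" and e :: real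
  assume i: "i \<in> Basis" and e: "e > 0"
  obtain T where T: "open T" "S = half_space \<inter> T" using S by (auto simp: openin_open)
  then obtain \<delta> where \<delta>: "\<delta> > 0" "ball x \<delta> \<subseteq> T" using S by (auto elim!: openE)
  define d where "d = min e \<delta> / 2"
  have d: "0 < d" "d < e" "d < \<delta>" using e \<delta> by (auto simp: d_def)
  have "x + d *\<^sub>R i \<in> T" using \<delta> d i by (intro subsetD[OF \<delta>(2)]) (simp add: dist_norm)
  moreover have "0 \<le> fst i" using i by (auto simp: Basis_prod_def)
  then have "x + d *\<^sub>R i \<in> half_space" using S(2) T d by (auto simp: half_space_def)
  ultimately show "\<exists>d. 0 < \<bar>d\<bar> \<and> \<bar>d\<bar> < e \<and> x + d *\<^sub>R i \<in> S"
    using d T by (intro exI[of _ d]) auto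
qed

lemma closed_half_space: "closed (half_space :: (real \<times> 'v::euclidean_space) set)"
  unfolding half_space_def by (intro closed_Collect_le continuous_intros)

lemma gram_det_continuous_on:
  assumes "\<And>u v. continuous_on S (\<lambda>x. q x u v)"
  shows "continuous_on S (\<lambda>x. gram_det (q x))"
  unfolding gram_det_def by (intro continuous_intros assms)

locale bordered_manifold =
  fixes M :: "('i, 'a::{t2_space,second_countable_topology}, real \<times> 'v::euclidean_space) atlas"
  assumes mwb: "manifold_with_boundary M"
begin

abbreviation "\<phi> \<equiv> chart_map M"
abbreviation "patch \<equiv> chart_dom M"
abbreviation "\<iota> \<equiv> chart_inv M"

lemma open_dom: "i \<in> charts M \<Longrightarrow> openin (top_of_set (points M)) (patch i)"
  and open_image: "i \<in> charts M \<Longrightarrow> openin (top_of_set half_space) (\<phi> i ` patch i)"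
  and homeo: "i \<in> charts M \<Longrightarrow> homeomorphism (patch i) (\<phi> i ` patch i) (\<phi> i) (\<iota> i)"
  and transition_smooth: "i \<in> charts M \<Longrightarrow> j \<in> charts M \<Longrightarrow>
      smooth_on (local_dom M M id i j) (local_rep M M id i j)"
  using mwb by (auto simp: manifold_with_boundary_def)

lemma inv_\<phi> [simp]: "i \<in> charts M \<Longrightarrow> p \<in> patch i \<Longrightarrow> \<iota> i (\<phi> i p) = p"
  using homeo by (auto simp: homeomorphism_def)

lemma dom_points: "i \<in> charts M \<Longrightarrow> patch i \<subseteq> points M"
  by (auto simp: points_def)

lemma continuous_\<phi>: "i \<in> charts M \<Longrightarrow> continuous_on (patch i) (\<phi> i)"
  and continuous_inv: "i \<in> charts M \<Longrightarrow> continuous_on (\<phi> i ` patch i) (\<iota> i)"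
  using homeo by (auto simp: homeomorphism_def)

lemma fst_\<phi>_nonneg: "i \<in> charts M \<Longrightarrow> p \<in> patch i \<Longrightarrow> 0 \<le> fst (\<phi> i p)"
  using openin_subset[OF open_image] by (force simp: half_space_def)

lemma open_image_Int:
  assumes "i \<in> charts M" "openin (top_of_set (points M)) T"
  shows "openin (top_of_set half_space) (\<phi> i ` (patch i \<inter> T))"
proof -
  obtain O' where "open O'" "T = points M \<inter> O'" using assms by (auto simp: openin_open)
  then have "openin (top_of_set (patch i)) (patch i \<inter> T)"
    using dom_points[OF assms(1)] by (auto simp: openin_open)
  then have "openin (top_of_set (\<phi> i ` patch i)) (\<phi> i ` (patch i \<inter> T))"
    using homeomorphism_imp_open_map[OF homeo[OF assms(1)]] by simp
  then show ?thesis using open_image[OF assms(1)] openin_trans by blast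
qed

lemma local_dom_id: "local_dom M M id i j = \<phi> i ` (patch i \<inter> patch j)"
  by (auto simp: local_dom_def)

lemma local_rep_id: "local_rep M M id i j = \<phi> j \<circ> \<iota> i"
  by (auto simp: local_rep_def)

lemma transition_derivative:
  assumes "i \<in> charts M" "j \<in> charts M" "p \<in> patch i" "p \<in> patch j"
  shows "\<exists>D. (\<phi> j \<circ> \<iota> i has_derivative D) (at (\<phi> i p) within \<phi> i ` (patch i \<inter> patch j))"
  using smooth_on_has_derivative[OF transition_smooth[OF assms(1,2)], of "\<phi> i p"] assms(3,4)
  by (simp add: local_dom_id local_rep_id)

text \<open>In a chart in which \<open>p\<close> were an interior point, the first coordinate of the other chart
  would have a local minimum at \<open>p\<close>, so the transition map would have a singular derivative.\<close>

lemma boundary_chart_invariant: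
  assumes ij: "i \<in> charts M" "j \<in> charts M" and p: "p \<in> patch i" "p \<in> patch j" and "fst (\<phi> j p) = 0"
  shows "fst (\<phi> i p) = 0"
proof (rule ccontr)
  assume "fst (\<phi> i p) \<noteq> 0"
  then have pos: "fst (\<phi> i p) > 0" using fst_\<phi>_nonneg[OF ij(1) p(1)] by linarith
  let ?S = "\<phi> i ` (patch i \<inter> patch j)" and ?S' = "\<phi> j ` (patch j \<inter> patch i)" and ?\<psi> = "\<phi> j \<circ> \<iota> i"
  obtain T where T: "open T" "?S = half_space \<inter> T"
    using open_image_Int[OF ij(1) open_dom[OF ij(2)]] by (auto simp: openin_open)
  \<comment> \<open>Restricting to positive first coordinate gives a set open in the whole model
    space, where derivatives are two-sided and the test for extrema applies.\<close>
  define U where "U = T \<inter> {x. fst x > (0::real)}"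
  have "open U" unfolding U_def by (intro open_Int T open_Collect_less continuous_intros)
  have US: "U \<subseteq> ?S" using T by (auto simp: U_def half_space_def)
  have xU: "\<phi> i p \<in> U" using T pos p by (auto simp: U_def)
  obtain D where "(?\<psi> has_derivative D) (at (\<phi> i p) within ?S)"
    using transition_derivative[OF ij p] by blast
  then have DU: "(?\<psi> has_derivative D) (at (\<phi> i p) within U)"
    using US has_derivative_subset by blast
  then have D: "(?\<psi> has_derivative D) (at (\<phi> i p))"
    by (simp only: at_within_open[OF xU \<open>open U\<close>])
  obtain E where "(\<phi> i \<circ> \<iota> j has_derivative E) (at (\<phi> j p) within ?S')"
    using transition_derivative[OF ij(2,1) p(2,1)] by blast
  moreover have "?\<psi> ` U \<subseteq> ?S'"
    using US ij by auto
  ultimately have E: "(\<phi> i \<circ> \<iota> j has_derivative E) (at (?\<psi> (\<phi> i p)) within ?\<psi> ` U)"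
    using has_derivative_subset ij p by fastforce
  have "((\<phi> i \<circ> \<iota> j) \<circ> ?\<psi> has_derivative E \<circ> D) (at (\<phi> i p) within U)"
    by (rule diff_chain_within[OF DU E])
  then have "((\<lambda>x. x) has_derivative E \<circ> D) (at (\<phi> i p) within U)"
    by (rule has_derivative_transform[OF xU, rotated]) (use US ij in auto)
  then have "((\<lambda>x. x) has_derivative E \<circ> D) (at (\<phi> i p))"
    by (simp only: at_within_open[OF xU \<open>open U\<close>])
  then have ED: "E \<circ> D = (\<lambda>x. x)"
    using has_derivative_unique has_derivative_ident by blast
  then have "inj D" by (metis comp_apply injI)
  then have "surj D" using linear_injective_imp_surjective has_derivative_linear[OF D] by blast
  then obtain u where u: "D u = (1, 0)" by (metis surjD)
  have "((\<lambda>x. fst (?\<psi> x)) has_derivative (\<lambda>v. fst (D v))) (at (\<phi> i p))"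
    using D by (rule has_derivative_fst)
  moreover have "\<forall>y\<in>U. fst (?\<psi> (\<phi> i p)) \<le> fst (?\<psi> y)"
    using US ij p assms(5) fst_\<phi>_nonneg by auto
  ultimately have "(\<lambda>v. fst (D v)) = (\<lambda>v. 0)"
    using differential_zero_maxmin[OF xU \<open>open U\<close>] by blast
  then show False using u by (metis fst_conv zero_neq_one)
qed

lemma boundary_iff: "i \<in> charts M \<Longrightarrow> p \<in> patch i \<Longrightarrow> p \<in> boundary M \<longleftrightarrow> fst (\<phi> i p) = 0"
  using boundary_chart_invariant by (auto simp: boundary_def)

lemma boundary_subset: "boundary M \<subseteq> points M"
  by (auto simp: boundary_def points_def)

section \<open>The boundary and its induced atlas\<close>

lemma closedin_boundary: "closedin (top_of_set (points M)) (boundary M)"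
proof -
  have "openin (top_of_set (points M)) {p \<in> patch i. fst (\<phi> i p) > 0}" if i: "i \<in> charts M" for i
  proof -
    have "openin (top_of_set (patch i)) (patch i \<inter> (\<lambda>p. fst (\<phi> i p)) -` {0<..})"
      using continuous_\<phi>[OF i] by (intro continuous_openin_preimage_gen continuous_intros) auto
    then show ?thesis using openin_trans open_dom[OF i] by (simp add: vimage_def Int_def) blast
  qed
  moreover have "points M - boundary M = (\<Union>i\<in>charts M. {p \<in> patch i. fst (\<phi> i p) > 0})"
    using boundary_iff fst_\<phi>_nonneg by (fastforce simp: points_def less_le)
  ultimately have "openin (top_of_set (points M)) (points M - boundary M)"
    by (metis (no_types, lifting) openin_Union imageE)
  then show ?thesis using boundary_subset by (simp add: closedin_def)
qed

lemma points_boundary_atlas: "points (boundary_atlas M) = boundary M"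
  using boundary_subset by (auto simp: points_def boundary_atlas_def)

lemma chart_inv_boundary_atlas:
  assumes "i \<in> charts M" "p \<in> patch i" "p \<in> boundary M"
  shows "chart_inv (boundary_atlas M) i (snd (\<phi> i p)) = p"
proof -
  have "inj_on (\<lambda>p. snd (\<phi> i p)) (patch i \<inter> boundary M)"
    using assms(1) boundary_iff by (intro inj_onI) (metis Int_iff inv_\<phi> prod_eqI)
  from inv_into_f_f[OF this, of p] show ?thesis
    using assms by (simp add: chart_inv_def boundary_atlas_def)
qed

lemma \<phi>_boundary: "i \<in> charts M \<Longrightarrow> p \<in> patch i \<Longrightarrow> p \<in> boundary M \<Longrightarrow> \<phi> i p = (0, snd (\<phi> i p))"
  using boundary_iff by (metis prod.collapse)

lemma boundary_image:
  assumes "i \<in> charts M" "X \<subseteq> patch i"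
  shows "(\<lambda>p. snd (\<phi> i p)) ` (X \<inter> boundary M) = {v. (0, v) \<in> \<phi> i ` X}"
proof
  show "(\<lambda>p. snd (\<phi> i p)) ` (X \<inter> boundary M) \<subseteq> {v. (0, v) \<in> \<phi> i ` X}"
    using \<phi>_boundary assms by (force simp: image_iff)
  show "{v. (0, v) \<in> \<phi> i ` X} \<subseteq> (\<lambda>p. snd (\<phi> i p)) ` (X \<inter> boundary M)"
  proof
    fix v assume "v \<in> {v. (0, v) \<in> \<phi> i ` X}"
    then obtain p where p: "p \<in> X" "\<phi> i p = (0, v)" by auto
    then have "p \<in> boundary M" using boundary_iff assms by auto
    with p show "v \<in> (\<lambda>p. snd (\<phi> i p)) ` (X \<inter> boundary M)" by force
  qed
qed

text \<open>The image is the slice at first coordinate 0 of a relatively open subset of the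
  half-space. Since it is open in \<open>'v\<close>, derivatives along the boundary are ordinary
  ones.\<close>

lemma open_boundary_image:
  assumes "i \<in> charts M" "openin (top_of_set (points M)) T"
  shows "open ((\<lambda>p. snd (\<phi> i p)) ` (patch i \<inter> T \<inter> boundary M))"
proof -
  obtain U where U: "open U" "\<phi> i ` (patch i \<inter> T) = half_space \<inter> U"
    using open_image_Int[OF assms] by (auto simp: openin_open)
  have "(\<lambda>p. snd (\<phi> i p)) ` (patch i \<inter> T \<inter> boundary M) = (\<lambda>v. (0, v)) -` U"
    using U by (simp add: boundary_image[OF assms(1)]) (auto simp: half_space_def)
  moreover have "open ((\<lambda>v::'v. (0::real, v)) -` U)"
    using U by (intro open_vimage continuous_intros)
  ultimately show ?thesis by simp
qed

lemma inv_boundary: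
  assumes "i \<in> charts M" "p \<in> patch i" "p \<in> boundary M"
  shows "\<iota> i (0, snd (\<phi> i p)) = p"
  using \<phi>_boundary[OF assms] inv_\<phi>[OF assms(1,2)] by simp

lemma riemannian_atlas_manifold:
  assumes g: "riemannian_metric M g" and "charts M \<noteq> {}" and closed: "closed (points M)"
  shows "riemannian_atlas M g"
proof
  show "points M \<in> sets borel" using closed by simp
  fix i assume i: "i \<in> charts M"
  show "\<phi> i ` patch i \<in> sets borel"
    using open_image[OF i] by (auto simp: openin_open intro!: sets.Int borel_closed[OF closed_half_space])
  show "openin (top_of_set (points M)) (patch i)"
    "homeomorphism (patch i) (\<phi> i ` patch i) (\<phi> i) (\<iota> i)"
    using open_dom homeo i by blast+
  show "bilinear (g i p)" if "p \<in> patch i" for p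
    using g i that by (auto simp: riemannian_metric_def)
  show "(\<lambda>x. gram_det (g i (\<iota> i x))) \<in> borel_measurable (restrict_space borel (\<phi> i ` patch i))"
    using g i by (intro borel_measurable_continuous_on_restrict gram_det_continuous_on smooth_on_continuous_on)
      (auto simp: riemannian_metric_def)
  show "\<exists>D. (\<phi> j \<circ> \<iota> i has_derivative D) (at (\<phi> i p) within \<phi> i ` (patch i \<inter> patch j)) \<and>
          (\<forall>u v. g i p u v = g j p (D u) (D v))"
    if j: "j \<in> charts M" "p \<in> patch i" "p \<in> patch j" for j p
  proof -
    obtain D where D: "(\<phi> j \<circ> \<iota> i has_derivative D) (at (\<phi> i p) within \<phi> i ` (patch i \<inter> patch j))"
      using transition_derivative[OF i j] by blast
    have "is_pullback M g M g id" using g by (simp add: riemannian_metric_def)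
    then have "\<forall>u v. g i p u v = g j p (D u) (D v)"
      using i j D unfolding is_pullback_def local_dom_id local_rep_id by fastforce
    with D show ?thesis by blast
  qed
qed fact

lemma riemannian_atlas_boundary:
  assumes g: "riemannian_metric M g" and "charts M \<noteq> {}" and closed: "closed (points M)"
  shows "riemannian_atlas (boundary_atlas M) (induced_metric g)"
proof -
  interpret R: riemannian_atlas M g by (rule riemannian_atlas_manifold[OF assms])
  let ?B = "boundary_atlas M"
  have sel [simp]: "charts ?B = charts M" "chart_dom ?B i = patch i \<inter> boundary M"
    "chart_map ?B i = (\<lambda>p. snd (\<phi> i p))" for i
    by (simp_all add: boundary_atlas_def)
  have inv_eq: "chart_inv ?B i v = \<iota> i (0, v)" if "i \<in> charts M" "v \<in> (\<lambda>p. snd (\<phi> i p)) ` (patch i \<inter> boundary M)" for i v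
    using that chart_inv_boundary_atlas inv_boundary by auto
  have im_0: "(0, v) \<in> \<phi> i ` X"
    if "i \<in> charts M" "X \<subseteq> patch i" "v \<in> (\<lambda>p. snd (\<phi> i p)) ` (X \<inter> boundary M)" for i v X
    using that boundary_image by simp
  have dom_Int: "patch i \<inter> points M = patch i" if "i \<in> charts M" for i
    using dom_points[OF that] by blast
  have op: "open ((\<lambda>p. snd (\<phi> i p)) ` (patch i \<inter> boundary M))" if "i \<in> charts M" for i
    using open_boundary_image[OF that, of "points M"] dom_Int[OF that] by simp
  show ?thesis
  proof
    show "charts ?B \<noteq> {}" using assms by simp
    have "closed (boundary M)" using closedin_boundary closed closedin_closed_trans by blast
    then show "points ?B \<in> sets borel" by (simp add: points_boundary_atlas)
    fix i assume "i \<in> charts ?B"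
    then have i: "i \<in> charts M" by simp
    show "openin (top_of_set (points ?B)) (chart_dom ?B i)"
      using open_dom[OF i] boundary_subset unfolding points_boundary_atlas
      by (auto simp: openin_open)
    show "chart_map ?B i ` chart_dom ?B i \<in> sets borel" using op[OF i] by simp
    have cinv: "continuous_on ((\<lambda>p. snd (\<phi> i p)) ` (patch i \<inter> boundary M)) (\<lambda>v. \<iota> i (0, v))"
      by (intro continuous_on_compose2[OF continuous_inv[OF i]] continuous_intros)
        (use im_0[OF i order_refl] in auto)
    show "homeomorphism (chart_dom ?B i) (chart_map ?B i ` chart_dom ?B i) (chart_map ?B i) (chart_inv ?B i)"
    proof (rule homeomorphismI)
      show "continuous_on (chart_dom ?B i) (chart_map ?B i)"
        by simp (intro continuous_intros continuous_on_subset[OF continuous_\<phi>[OF i]], blast)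
      show "continuous_on (chart_map ?B i ` chart_dom ?B i) (chart_inv ?B i)"
        using cinv inv_eq[OF i] by (simp cong: continuous_on_cong)
    qed (use chart_inv_boundary_atlas i in auto)
    show "bilinear (induced_metric g i p)" if "p \<in> chart_dom ?B i" for p
    proof -
      have b: "bilinear (g i p)" using R.bilinear i that by simp
      have lin: "linear (\<lambda>v::'v. (0::real, v))" by (rule linearI) auto
      have "linear (\<lambda>x. g i p (0, x) y)" "linear (\<lambda>x. g i p y (0, x))" for y
      proof -
        have "linear (\<lambda>x. g i p x y)" "linear (g i p y)"
          using b unfolding bilinear_def by blast+
        from this[THEN linear_compose[OF lin]]
        show "linear (\<lambda>x. g i p (0, x) y)" "linear (\<lambda>x. g i p y (0, x))"
          by (simp_all add: o_def)
      qed
      then show ?thesis by (simp add: bilinear_def induced_metric_def)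
    qed
    show "(\<lambda>v. gram_det (induced_metric g i (chart_inv ?B i v)))
        \<in> borel_measurable (restrict_space borel (chart_map ?B i ` chart_dom ?B i))"
    proof (intro borel_measurable_continuous_on_restrict gram_det_continuous_on)
      fix u w
      have "continuous_on (\<phi> i ` patch i) (\<lambda>x. g i (\<iota> i x) (0, u) (0, w))"
        using g i by (intro smooth_on_continuous_on) (auto simp: riemannian_metric_def)
      then have "continuous_on ((\<lambda>p. snd (\<phi> i p)) ` (patch i \<inter> boundary M)) (\<lambda>v. g i (\<iota> i (0, v)) (0, u) (0, w))"
        by (rule continuous_on_compose2) (use im_0[OF i order_refl] in \<open>auto intro!: continuous_intros\<close>)
      then show "continuous_on (chart_map ?B i ` chart_dom ?B i) (\<lambda>v. induced_metric g i (chart_inv ?B i v) u w)"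
        using inv_eq[OF i] by (simp add: induced_metric_def cong: continuous_on_cong)
    qed
    fix j p assume "j \<in> charts ?B" "p \<in> chart_dom ?B i" "p \<in> chart_dom ?B j"
    then have j: "j \<in> charts M" and p: "p \<in> patch i" "p \<in> patch j" "p \<in> boundary M" by auto
    obtain D where D: "(\<phi> j \<circ> \<iota> i has_derivative D) (at (\<phi> i p) within \<phi> i ` (patch i \<inter> patch j))"
      and gD: "\<And>u v. g i p u v = g j p (D u) (D v)"
      using R.transition[OF i j p(1,2)] by blast
    let ?V = "(\<lambda>p. snd (\<phi> i p)) ` (patch i \<inter> patch j \<inter> boundary M)" and ?v = "snd (\<phi> i p)"
    have v: "?v \<in> ?V" using p by blast
    have openV: "open ?V" using open_boundary_image[OF i open_dom[OF j]] .
    have emb: "((\<lambda>v. (0, v)) has_derivative (\<lambda>v. (0, v))) (at ?v within ?V)"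
      by (auto intro!: derivative_eq_intros)
    have sub: "(\<lambda>v. (0, v)) ` ?V \<subseteq> \<phi> i ` (patch i \<inter> patch j)"
      using im_0[OF i, of "patch i \<inter> patch j"] by blast
    have "((\<phi> j \<circ> \<iota> i) has_derivative D) (at (0, ?v) within (\<lambda>v. (0, v)) ` ?V)"
      using has_derivative_subset[OF D sub] \<phi>_boundary[OF i p(1,3)] by simp
    from diff_chain_within[OF emb this]
    have c: "(\<phi> j \<circ> \<iota> i \<circ> (\<lambda>v. (0, v)) has_derivative D \<circ> (\<lambda>v. (0, v))) (at ?v within ?V)" .
    have c1: "((\<lambda>v. fst (\<phi> j (\<iota> i (0, v)))) has_derivative (\<lambda>v. fst (D (0, v)))) (at ?v within ?V)"
      using has_derivative_fst[OF c] by simp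
    \<comment> \<open>Transition maps send boundary points to boundary points, so the first
      coordinate vanishes on the whole slice and so does its derivative. Hence D maps vectors (0, v)
      to vectors (0, w), and the pullback identity of the metric restricts to the boundary.\<close>
    have z: "fst (\<phi> j (\<iota> i (0, w))) = 0" if "w \<in> ?V" for w
      using that inv_boundary[OF i] boundary_iff[OF j] by auto
    have "((\<lambda>v. 0) has_derivative (\<lambda>v. fst (D (0, v)))) (at ?v within ?V)"
      by (rule has_derivative_transform[OF v _ c1]) (simp add: z)
    then have "((\<lambda>v. 0) has_derivative (\<lambda>v. fst (D (0, v)))) (at ?v)"
      by (simp only: at_within_open[OF v openV])
    then have "(\<lambda>v. fst (D (0, v))) = (\<lambda>v. 0)"
      using has_derivative_unique has_derivative_const by blast
    then have f0: "fst (D (0, v)) = 0" for v by metis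
    have c2: "((\<lambda>v. snd (\<phi> j (\<iota> i (0, v)))) has_derivative (\<lambda>v. snd (D (0, v)))) (at ?v within ?V)"
      using has_derivative_snd[OF c] by simp
    have "(chart_map ?B j \<circ> chart_inv ?B i has_derivative (\<lambda>v. snd (D (0, v)))) (at ?v within ?V)"
      by (rule has_derivative_transform[OF v _ c2]) (use inv_eq[OF i] in auto)
    moreover have "chart_dom ?B i \<inter> chart_dom ?B j = patch i \<inter> patch j \<inter> boundary M" by auto
    moreover have "induced_metric g i p u w = induced_metric g j p (snd (D (0, u))) (snd (D (0, w)))" for u w
      using gD[of "(0, u)" "(0, w)"] f0 by (simp add: induced_metric_def) (metis prod.collapse)
    ultimately show "\<exists>D. (chart_map ?B j \<circ> chart_inv ?B i has_derivative D)
        (at (chart_map ?B i p) within chart_map ?B i ` (chart_dom ?B i \<inter> chart_dom ?B j)) \<and>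
        (\<forall>u v. induced_metric g i p u v = induced_metric g j p (D u) (D v))"
      by (intro exI[of _ "\<lambda>v. snd (D (0, v))"]) simp
  qed
qed

end

section \<open>Covectors and differentials\<close>

text \<open>Two dual vectors differ by a vector of norm 0, so positive definiteness makes the
  description in \<open>covector_norm_sq\<close> unique.\<close>

lemma covector_norm_sq_eq:
  assumes q: "bilinear q" "\<And>u. u \<noteq> 0 \<Longrightarrow> 0 < q u u" and u: "\<And>v. q u v = \<alpha> v"
  shows "covector_norm_sq q \<alpha> = q u u"
proof -
  have "u' = u" if "\<forall>v. q u' v = \<alpha> v" for u'
  proof -
    have "q (u' - u) (u' - u) = 0"
      using that u bilinear_lsub[OF q(1)] by simp
    then show ?thesis using q(2)[of "u' - u"] by force
  qed
  then have "(THE u. \<forall>v. q u v = \<alpha> v) = u"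
    using u by (intro the_equality) auto
  then show ?thesis by (simp add: covector_norm_sq_def)
qed

context bordered_manifold
begin

text \<open>\<open>frechet_derivative\<close> is a choice; uniqueness in the half-space identifies
  it with any derivative found by calculation, including one-sided ones.\<close>

lemma differential_eq:
  assumes "i \<in> charts M" "p \<in> patch i"
    and "(f \<circ> \<iota> i has_derivative D) (at (\<phi> i p) within \<phi> i ` patch i)"
  shows "differential M f i p = D"
proof -
  have "(f \<circ> \<iota> i has_derivative differential M f i p) (at (\<phi> i p) within \<phi> i ` patch i)"
    unfolding differential_def
    by (rule frechet_derivative_works[THEN iffD1]) (use assms(3) in \<open>auto simp: differentiable_def\<close>)
  then show ?thesis
    using half_space_derivative_unique[OF open_image[OF assms(1)]] assms by blast
qed

lemma chart_neighbourhood: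
  assumes "i \<in> charts M" "openin (top_of_set (points M)) T"
  obtains V where "open V" "\<phi> i ` patch i \<inter> V = \<phi> i ` (patch i \<inter> T)"
proof -
  obtain V where "open V" "\<phi> i ` (patch i \<inter> T) = half_space \<inter> V"
    using open_image_Int[OF assms] by (auto simp: openin_open)
  moreover have "\<phi> i ` patch i \<subseteq> half_space"
    using openin_subset[OF open_image[OF assms(1)]] by simp
  ultimately show ?thesis using that[of V] by blast
qed

lemma differential_locally_constant:
  assumes i: "i \<in> charts M" "p \<in> patch i"
    and T: "openin (top_of_set (points M)) T" "p \<in> T" "\<forall>q\<in>T. f q = f p"
  shows "differential M f i p = (\<lambda>v. 0)"
proof (rule differential_eq[OF i])
  obtain V where V: "open V" "\<phi> i ` patch i \<inter> V = \<phi> i ` (patch i \<inter> T)"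
    using chart_neighbourhood[OF i(1) T(1)] .
  have x: "\<phi> i p \<in> \<phi> i ` patch i" "\<phi> i p \<in> V"
    using V i T by blast+
  have eq: "(f \<circ> \<iota> i) y = f p" if "y \<in> V" "y \<in> \<phi> i ` patch i" for y
  proof -
    have "y \<in> \<phi> i ` (patch i \<inter> T)" using that V by blast
    then show ?thesis using T(3) i by auto
  qed
  have "((\<lambda>y. f p) has_derivative (\<lambda>v. 0)) (at (\<phi> i p) within \<phi> i ` patch i)" by simp
  then show "(f \<circ> \<iota> i has_derivative (\<lambda>v. 0)) (at (\<phi> i p) within \<phi> i ` patch i)"
  proof (rule has_derivative_transform_eventually)
    show "\<forall>\<^sub>F y in at (\<phi> i p) within \<phi> i ` patch i. f p = (f \<circ> \<iota> i) y"
      unfolding eventually_at_topological using V(1) x(2) eq[symmetric] by blast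
    show "f p = (f \<circ> \<iota> i) (\<phi> i p)" "\<phi> i p \<in> \<phi> i ` patch i"
      using eq[OF x(2,1)] x(1) by simp_all
  qed
qed

text \<open>The chart is selected by \<open>SOME\<close>, so the dual vector is demanded in every
  chart around p, always with the same squared norm a.\<close>

lemma differential_norm_sq_eq:
  assumes "riemannian_metric M g" "p \<in> points M"
    and "\<And>i. i \<in> charts M \<Longrightarrow> p \<in> patch i \<Longrightarrow> \<exists>u. (\<forall>v. g i p u v = differential M f i p v) \<and> g i p u u = a"
  shows "differential_norm_sq M g f p = a"
proof -
  define i where "i = (SOME i. i \<in> charts M \<and> p \<in> patch i)"
  have "\<exists>i. i \<in> charts M \<and> p \<in> patch i" using assms(2) by (auto simp: points_def)
  from someI_ex[OF this] have i: "i \<in> charts M" "p \<in> patch i" by (simp_all add: i_def)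
  obtain u where u: "\<And>v. g i p u v = differential M f i p v" "g i p u u = a"
    using assms(3)[OF i] by blast
  have "differential_norm_sq M g f p = covector_norm_sq (g i p) (differential M f i p)"
    by (simp add: differential_norm_sq_def i_def Let_def)
  also have "\<dots> = g i p u u"
    using assms(1) i by (intro covector_norm_sq_eq u(1)) (auto simp: riemannian_metric_def)
  finally show ?thesis using u by simp
qed

end

section \<open>The product collar and the test functions\<close>

locale product_collar = bordered_manifold M
  for M :: "('i, 'a::{t2_space,second_countable_topology}, real \<times> 'v::euclidean_space) atlas" +
  fixes g g' :: "('i, 'a, real \<times> 'v) tensor2" and W :: "'a set" and L :: real and \<kappa> :: "'a \<times> real \<Rightarrow> 'a"
  assumes compact: "compact (points M)"
    and metric: "riemannian_metric M g"
    and L_pos: "L > 0"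
    and W_open: "openin (top_of_set (points M)) W"
    and iso: "isometry (cylinder_atlas (boundary_atlas M) L) (product_metric (induced_metric g))
           (open_submanifold M W) g \<kappa>"
    and \<kappa>_0: "y \<in> boundary M \<Longrightarrow> \<kappa> (y, 0) = y"
    and metric': "riemannian_metric M g'"
    and agree: "p \<in> boundary M \<union> (points M - \<kappa> ` (boundary M \<times> {0..<L/2})) \<Longrightarrow>
      i \<in> charts M \<Longrightarrow> p \<in> chart_dom M i \<Longrightarrow> g' i p = g i p"
begin

abbreviation "\<Sigma> \<equiv> boundary M"
abbreviation "Cyl \<equiv> cylinder_atlas (boundary_atlas M) L"
abbreviation "Sub \<equiv> open_submanifold M W"
abbreviation "\<kappa>' \<equiv> inv_into (\<Sigma> \<times> {0..<L}) \<kappa>"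

lemma Cyl_simps [simp]:
  "charts Cyl = charts M" "chart_dom Cyl j = (patch j \<inter> \<Sigma>) \<times> {0..<L}"
  "chart_map Cyl j (y, t) = (t, snd (\<phi> j y))"
  by (simp_all add: cylinder_atlas_def boundary_atlas_def)

lemma Sub_simps [simp]:
  "charts Sub = charts M" "chart_dom Sub i = patch i \<inter> W" "chart_map Sub i = \<phi> i"
  by (simp_all add: open_submanifold_def)

lemma points_Cyl: "points Cyl = \<Sigma> \<times> {0..<L}"
  using boundary_subset by (auto simp: points_def)

lemma W_subset: "W \<subseteq> points M"
  using W_open openin_imp_subset by blast

lemma points_Sub: "points Sub = W"
  using W_subset by (auto simp: points_def)

lemma bij_\<kappa>: "bij_betw \<kappa> (\<Sigma> \<times> {0..<L}) W"
  and \<kappa>_smooth: "smooth_map Cyl Sub \<kappa>" and \<kappa>'_smooth: "smooth_map Sub Cyl \<kappa>'"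
  and \<kappa>_pullback: "is_pullback Cyl (product_metric (induced_metric g)) Sub g \<kappa>"
  using iso by (simp_all add: isometry_def diffeomorphism_def points_Cyl points_Sub)

lemma continuous_\<kappa>: "continuous_on (\<Sigma> \<times> {0..<L}) \<kappa>"
  using \<kappa>_smooth by (simp add: smooth_map_def points_Cyl)

lemma continuous_\<kappa>': "continuous_on W \<kappa>'"
  using \<kappa>'_smooth by (simp add: smooth_map_def points_Sub)

lemma \<kappa>'_\<kappa> [simp]: "y \<in> \<Sigma> \<Longrightarrow> 0 \<le> t \<Longrightarrow> t < L \<Longrightarrow> \<kappa>' (\<kappa> (y, t)) = (y, t)"
  using bij_\<kappa> by (simp add: bij_betw_def)

lemma \<kappa>_W [simp]: "y \<in> \<Sigma> \<Longrightarrow> 0 \<le> t \<Longrightarrow> t < L \<Longrightarrow> \<kappa> (y, t) \<in> W"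
  using bij_\<kappa> by (auto simp: bij_betw_def)

lemma collar_cases:
  assumes "p \<in> W"
  obtains y t where "y \<in> \<Sigma>" "0 \<le> t" "t < L" "p = \<kappa> (y, t)" "\<kappa>' p = (y, t)"
proof -
  have "p \<in> \<kappa> ` (\<Sigma> \<times> {0..<L})" using assms bij_\<kappa> by (simp add: bij_betw_def)
  then show ?thesis using that by auto
qed

lemma openin_collar:
  assumes "open T"
  shows "openin (top_of_set (points M)) {q \<in> W. \<kappa>' q \<in> T}"
proof -
  have "openin (top_of_set W) (W \<inter> \<kappa>' -` T)"
    using continuous_openin_preimage_gen[OF continuous_\<kappa>' assms] .
  then show ?thesis
    using openin_trans[OF _ W_open] by (simp add: vimage_def Int_def)
qed

lemma compact_\<Sigma>: "compact \<Sigma>"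
  using closedin_boundary compact closedin_compact by blast

lemma chart_inv_Cyl:
  assumes "j \<in> charts M" "y \<in> patch j" "y \<in> \<Sigma>" "0 \<le> t" "t < L"
  shows "chart_inv Cyl j (t, snd (\<phi> j y)) = (y, t)"
proof -
  have "inj_on (chart_map Cyl j) (chart_dom Cyl j)"
    using assms(1) inv_boundary by (intro inj_onI) (auto, metis)
  from inv_into_f_f[OF this, of "(y, t)"] show ?thesis
    using assms by (simp add: chart_inv_def)
qed

lemma chart_inv_Sub:
  assumes "i \<in> charts M" "p \<in> patch i" "p \<in> W"
  shows "chart_inv Sub i (\<phi> i p) = p"
proof -
  have "inj_on (\<phi> i) (patch i \<inter> W)"
    using assms(1) by (intro inj_onI) (metis IntD1 inv_\<phi>)
  from inv_into_f_f[OF this, of p] show ?thesis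
    using assms by (simp add: chart_inv_def)
qed

lemma patch_neighbourhood:
  assumes "j \<in> charts M"
  obtains T where "open T" "patch j = points M \<inter> T"
  using open_dom[OF assms] by (auto simp: openin_open)

lemma continuous_collar_chart:
  assumes j: "j \<in> charts M"
  shows "continuous_on ({0..<L} \<times> (\<lambda>p. snd (\<phi> j p)) ` (patch j \<inter> \<Sigma>)) (\<lambda>x. \<kappa> (\<iota> j (0, snd x), fst x))"
proof (rule continuous_on_compose2[OF continuous_\<kappa>])
  let ?V = "(\<lambda>p. snd (\<phi> j p)) ` (patch j \<inter> \<Sigma>)"
  have V0: "(0, v) \<in> \<phi> j ` patch j" "\<iota> j (0, v) \<in> \<Sigma>" if "v \<in> ?V" for v
  proof -
    show "(0, v) \<in> \<phi> j ` patch j" using that boundary_image[OF j order_refl] by simp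
    show "\<iota> j (0, v) \<in> \<Sigma>" using that inv_boundary[OF j] by (elim imageE) auto
  qed
  have "continuous_on ({0..<L} \<times> ?V) (\<lambda>x. \<iota> j (0, snd x))"
    by (rule continuous_on_compose2[OF continuous_inv[OF j]]) (use V0(1) in \<open>auto intro!: continuous_intros\<close>)
  then show "continuous_on ({0..<L} \<times> ?V) (\<lambda>x. (\<iota> j (0, snd x), fst x))"
    by (intro continuous_intros)
  show "(\<lambda>x. (\<iota> j (0, snd x), fst x)) ` ({0..<L} \<times> ?V) \<subseteq> \<Sigma> \<times> {0..<L}"
    using V0(2) by auto
qed

text \<open>This is the condition under which \<open>half_space_derivative_unique\<close> can
  compare derivatives taken along \<kappa>. The cylinder chart {0..<L} \<times> V is relatively open
  in the half-space, and membership in the chart \<open>i\<close> is an open condition by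
  continuity.\<close>

lemma local_dom_openin:
  assumes j: "j \<in> charts M" and i: "i \<in> charts M"
  shows "openin (top_of_set half_space) (local_dom Cyl Sub \<kappa> j i)"
proof -
  let ?V = "(\<lambda>p. snd (\<phi> j p)) ` (patch j \<inter> \<Sigma>)"
  let ?k = "\<lambda>(t, v). \<kappa> (\<iota> j (0, v), t)"
  have "patch j \<inter> points M = patch j" using dom_points[OF j] by blast
  then have "open ?V"
    using open_boundary_image[OF j, of "points M"] by simp
  then have op: "openin (top_of_set half_space) ({0..<L} \<times> ?V)"
    unfolding openin_open
    by (intro exI[of _ "{..<L} \<times> ?V"]) (auto simp: half_space_def open_Times)
  have cont: "continuous_on ({0..<L} \<times> ?V) ?k"
    using continuous_collar_chart[OF j] by (simp add: case_prod_unfold)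
  obtain T where T: "open T" "patch i = points M \<inter> T" using patch_neighbourhood[OF i] .
  have "openin (top_of_set ({0..<L} \<times> ?V)) (({0..<L} \<times> ?V) \<inter> ?k -` T)"
    using continuous_openin_preimage_gen[OF cont T(1)] .
  moreover have "({0..<L} \<times> ?V) \<inter> ?k -` T = local_dom Cyl Sub \<kappa> j i"
  proof
    show "({0..<L} \<times> ?V) \<inter> ?k -` T \<subseteq> local_dom Cyl Sub \<kappa> j i"
    proof
      fix x assume "x \<in> ({0..<L} \<times> ?V) \<inter> ?k -` T"
      then obtain t p where x: "x = (t, snd (\<phi> j p))" and t: "t \<in> {0..<L}" and p: "p \<in> patch j" "p \<in> \<Sigma>"
        and "?k x \<in> T" by auto
      then have "\<kappa> (p, t) \<in> T" using inv_boundary[OF j p] by simp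
      then have "\<kappa> (p, t) \<in> patch i \<inter> W" using t p T W_subset by auto
      then show "x \<in> local_dom Cyl Sub \<kappa> j i"
        unfolding local_dom_def x using t p by (intro image_eqI[of _ _ "(p, t)"]) auto
    qed
    show "local_dom Cyl Sub \<kappa> j i \<subseteq> ({0..<L} \<times> ?V) \<inter> ?k -` T"
      using T inv_boundary[OF j] by (auto simp: local_dom_def)
  qed
  ultimately show ?thesis using openin_trans[OF _ op] by simp
qed

text \<open>Injectivity of \<kappa> keeps points of height at least L/2 out of the region where the
  two metrics may differ.\<close>

lemma collar_agree:
  assumes "y \<in> \<Sigma>" "L/2 \<le> t" "t < L" "i \<in> charts M" "\<kappa> (y, t) \<in> patch i"
  shows "g' i (\<kappa> (y, t)) = g i (\<kappa> (y, t))"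
proof -
  have "\<kappa> (y, t) \<notin> \<kappa> ` (\<Sigma> \<times> {0..<L/2})"
  proof
    assume "\<kappa> (y, t) \<in> \<kappa> ` (\<Sigma> \<times> {0..<L/2})"
    then obtain z s where zs: "z \<in> \<Sigma>" "0 \<le> s" "s < L/2" "\<kappa> (y, t) = \<kappa> (z, s)" by auto
    have "\<kappa>' (\<kappa> (y, t)) = (y, t)" using assms L_pos by simp
    moreover have "\<kappa>' (\<kappa> (z, s)) = (z, s)" using zs L_pos by simp
    ultimately show False using zs assms by simp
  qed
  then show ?thesis using agree[of "\<kappa> (y, t)" i] assms dom_points by blast
qed

text \<open>The pullback identity at a point involves the values of the metric there and the
  derivative of \<kappa>, but no derivative of the metric. It therefore passes from \<open>g\<close>
  to \<open>g'\<close> even at height exactly L/2, where the metrics need not agree on a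
  neighbourhood.\<close>

lemma collar_pullback:
  assumes y: "y \<in> \<Sigma>" and t: "L/2 \<le> t" "t < L" and j: "j \<in> charts M" "y \<in> patch j"
    and i: "i \<in> charts M" "\<kappa> (y, t) \<in> patch i"
  shows "\<exists>D. (local_rep Cyl Sub \<kappa> j i has_derivative D) (at (t, snd (\<phi> j y)) within local_dom Cyl Sub \<kappa> j i) \<and>
    (\<forall>u v. product_metric (induced_metric g) j (y, t) u v = g' i (\<kappa> (y, t)) (D u) (D v))"
proof -
  let ?Q = "local_dom Cyl Sub \<kappa> j i" and ?R = "local_rep Cyl Sub \<kappa> j i"
  have t0: "0 \<le> t" using t L_pos by simp
  have mem: "j \<in> charts Cyl" "i \<in> charts Sub" "(y, t) \<in> chart_dom Cyl j" "\<kappa> (y, t) \<in> chart_dom Sub i"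
    using i j y t t0 by simp_all
  have zQ: "(t, snd (\<phi> j y)) \<in> ?Q"
    unfolding local_dom_def using mem by (intro image_eqI[of _ _ "(y, t)"]) auto
  have "smooth_on ?Q ?R" using \<kappa>_smooth i j by (simp add: smooth_map_def)
  then obtain D where D: "(?R has_derivative D) (at (t, snd (\<phi> j y)) within ?Q)"
    using smooth_on_has_derivative zQ by blast
  then have "(?R has_derivative D) (at (chart_map Cyl j (y, t)) within ?Q)" by simp
  then have "\<forall>u v. product_metric (induced_metric g) j (y, t) u v = g i (\<kappa> (y, t)) (D u) (D v)"
    using \<kappa>_pullback mem unfolding is_pullback_def by blast
  then show ?thesis using D collar_agree[OF y t i] by auto
qed

definition locally_constant :: "('a \<Rightarrow> real) \<Rightarrow> bool" where
  "locally_constant c \<longleftrightarrow> (\<forall>y\<in>\<Sigma>. \<exists>T. open T \<and> y \<in> T \<and> (\<forall>z\<in>T \<inter> \<Sigma>. c z = c y))"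

lemma locally_constantD:
  assumes "locally_constant c" "y \<in> \<Sigma>"
  obtains T where "open T" "y \<in> T" "\<forall>z\<in>T \<inter> \<Sigma>. c z = c y"
proof -
  show ?thesis
    using that bspec[OF assms(1)[unfolded locally_constant_def] assms(2)] by blast
qed

lemma locally_constant_continuous: "locally_constant c \<Longrightarrow> continuous_on \<Sigma> c"
  unfolding continuous_on_eq_continuous_within
proof
  fix y assume c: "locally_constant c" and y: "y \<in> \<Sigma>"
  obtain T where T: "open T" "y \<in> T" "\<forall>z\<in>T \<inter> \<Sigma>. c z = c y"
    using locally_constantD[OF c y] .
  have "((\<lambda>z. c y) \<longlongrightarrow> c y) (at y within \<Sigma>)" by simp
  then have "(c \<longlongrightarrow> c y) (at y within \<Sigma>)"
    by (rule Lim_transform_eventually) (use T in \<open>auto simp: eventually_at_topological\<close>)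
  then show "continuous (at y within \<Sigma>) c" by (simp add: continuous_within)
qed

end

section \<open>Extension of locally constant boundary functions into M\<close>

locale collar_cutoff = product_collar M g g' W L \<kappa>
  for M :: "('i, 'a::{t2_space,second_countable_topology}, real \<times> 'v::euclidean_space) atlas"
    and g g' W L \<kappa> +
  fixes \<eta> \<psi> :: "real \<Rightarrow> real" and r :: real
  assumes Ck_\<eta>: "Ck_on k \<eta> UNIV"
    and \<eta>_1: "t \<le> L/2 \<Longrightarrow> \<eta> t = 1"
    and r: "L/2 < r" "r < L"
    and \<eta>_0: "r \<le> t \<Longrightarrow> \<eta> t = 0"
    and \<eta>_der: "(\<eta> has_real_derivative \<psi> t) (at t)"
    and \<psi>_cont: "continuous_on UNIV \<psi>"
begin

definition ext :: "('a \<Rightarrow> real) \<Rightarrow> 'a \<Rightarrow> real" where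
  "ext c p = (if p \<in> W then c (fst (\<kappa>' p)) * \<eta> (snd (\<kappa>' p)) else 0)"

lemma ext_\<kappa>: "y \<in> \<Sigma> \<Longrightarrow> 0 \<le> t \<Longrightarrow> t < L \<Longrightarrow> ext c (\<kappa> (y, t)) = c y * \<eta> t"
  by (simp add: ext_def)

lemma ext_boundary: "y \<in> \<Sigma> \<Longrightarrow> ext c y = c y"
  using ext_\<kappa>[of y 0 c] L_pos \<kappa>_0 by (simp add: \<eta>_1)

text \<open>Since \<eta> vanishes from r < L on, the extension is 0 outside the image of \<Sigma>
  \<times> [0, r]. This image is compact, hence closed in a Hausdorff space, and lies in W; so it
  stays away from every point off W.\<close>

lemma ext_zero_near:
  assumes "p \<in> points M" "p \<notin> W"
  obtains T where "openin (top_of_set (points M)) T" "p \<in> T" "\<forall>q\<in>T. ext c q = 0"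
proof -
  let ?K = "\<kappa> ` (\<Sigma> \<times> {0..r})"
  have "compact ?K"
    using r by (intro compact_continuous_image continuous_on_subset[OF continuous_\<kappa>] compact_Times compact_\<Sigma>) auto
  then have "open (- ?K)" using compact_imp_closed by blast
  moreover have "ext c q = 0" if "q \<in> points M \<inter> - ?K" for q
  proof (cases "q \<in> W")
    case True
    then obtain y t where yt: "y \<in> \<Sigma>" "0 \<le> t" "t < L" "q = \<kappa> (y, t)" by (rule collar_cases)
    then have "t \<notin> {0..r}" using that by auto
    then show ?thesis using yt by (simp add: ext_\<kappa> \<eta>_0)
  qed (simp add: ext_def)
  moreover have "p \<notin> ?K"
  proof
    assume "p \<in> ?K"
    then show False using assms(2) r by auto
  qed
  ultimately show ?thesis using that[of "points M \<inter> - ?K"] assms by auto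
qed

text \<open>Below height L/2 the cutoff is 1 and \<open>c\<close> is constant near the foot point;
  off W the function is 0 nearby. What is excluded is the slab on which all energy sits.\<close>

lemma ext_locally_constant_near:
  assumes c: "locally_constant c" and p: "p \<in> points M" "p \<notin> \<kappa> ` (\<Sigma> \<times> {L/2..<L})"
  obtains T where "openin (top_of_set (points M)) T" "p \<in> T" "\<forall>q\<in>T. ext c q = ext c p"
proof (cases "p \<in> W")
  case False
  obtain T where "openin (top_of_set (points M)) T" "p \<in> T" "\<forall>q\<in>T. ext c q = 0"
    by (rule ext_zero_near[OF p(1) False, of c])
  then show ?thesis using that[of T] by simp
next
  case True
  then obtain y t where yt: "y \<in> \<Sigma>" "0 \<le> t" "t < L" "p = \<kappa> (y, t)" "\<kappa>' p = (y, t)" by (rule collar_cases)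
  then have t: "t < L/2" using p(2) by force
  obtain T where T: "open T" "y \<in> T" "\<forall>z\<in>T \<inter> \<Sigma>. c z = c y"
    using locally_constantD[OF c yt(1)] .
  have op: "open (T \<times> {..<L/2})" using T by (simp add: open_Times)
  have "ext c q = ext c p" if "q \<in> {q \<in> W. \<kappa>' q \<in> T \<times> {..<L/2}}" for q
  proof -
    have "q \<in> W" using that by simp
    then obtain z s where zs: "z \<in> \<Sigma>" "0 \<le> s" "s < L" "q = \<kappa> (z, s)" "\<kappa>' q = (z, s)" by (rule collar_cases)
    then have "z \<in> T" "s < L/2" using that by auto
    then have "c z = c y" "\<eta> s = 1" "\<eta> t = 1"
      using T(3) zs(1) t by (simp_all add: \<eta>_1)
    then show ?thesis
      unfolding zs(4) yt(4) ext_\<kappa>[OF zs(1-3)] ext_\<kappa>[OF yt(1-3)] by simp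
  qed
  moreover have "p \<in> {q \<in> W. \<kappa>' q \<in> T \<times> {..<L/2}}"
    unfolding mem_Collect_eq yt(5) using True t T(2) by simp
  ultimately show ?thesis
    by (intro that[OF openin_collar[OF op]] ballI)
qed

lemma ext_smooth:
  assumes c: "locally_constant c"
  shows "ext c \<in> smooth_functions M"
proof -
  have "smooth_on (\<phi> i ` patch i) (ext c \<circ> \<iota> i)" if i: "i \<in> charts M" for i
    unfolding smooth_on_def
  proof
    fix x assume "x \<in> \<phi> i ` patch i"
    then obtain p where p: "p \<in> patch i" "x = \<phi> i p" by blast
    then have pM: "p \<in> points M" using dom_points i by blast
    show "\<exists>V F. open V \<and> x \<in> V \<and> (\<forall>k. Ck_on k F V) \<and> (\<forall>y\<in>\<phi> i ` patch i \<inter> V. F y = (ext c \<circ> \<iota> i) y)"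
    proof (cases "p \<in> W")
      case False
      obtain T where T: "openin (top_of_set (points M)) T" "p \<in> T" "\<forall>q\<in>T. ext c q = 0"
        using ext_zero_near[OF pM False] .
      obtain V where V: "open V" "\<phi> i ` patch i \<inter> V = \<phi> i ` (patch i \<inter> T)"
        using chart_neighbourhood[OF i T(1)] .
      have "x \<in> V" using V p T by blast
      moreover have "\<forall>y\<in>\<phi> i ` patch i \<inter> V. 0 = (ext c \<circ> \<iota> i) y"
        unfolding V using T(3) i by auto
      ultimately show ?thesis
        using V(1) Ck_on_const by (intro exI[of _ V] exI[of _ "\<lambda>_. 0"]) auto
    next
      case True
      then obtain y t where yt: "y \<in> \<Sigma>" "0 \<le> t" "t < L" "p = \<kappa> (y, t)" "\<kappa>' p = (y, t)" by (rule collar_cases)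
      obtain j where j: "j \<in> charts M" "y \<in> patch j"
        using yt(1) boundary_subset by (auto simp: points_def)
      obtain T where T: "open T" "y \<in> T" "\<forall>z\<in>T \<inter> \<Sigma>. c z = c y"
        using locally_constantD[OF c yt(1)] .
      obtain Tj where Tj: "open Tj" "patch j = points M \<inter> Tj" using patch_neighbourhood[OF j(1)] .
      \<comment> \<open>On this set the foot point stays where \<open>c\<close> is constant and
        inside the chart \<open>j\<close>, so a single coordinate expression of the inverse collar
        map suffices.\<close>
      let ?O = "{q \<in> W. \<kappa>' q \<in> (T \<inter> Tj) \<times> UNIV}"
      have O: "openin (top_of_set (points M)) ?O"
        using T Tj by (intro openin_collar) (simp add: open_Times open_Int)
      obtain V1 where V1: "open V1" "\<phi> i ` patch i \<inter> V1 = \<phi> i ` (patch i \<inter> ?O)"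
        using chart_neighbourhood[OF i O] .
      have "smooth_on (local_dom Sub Cyl \<kappa>' i j) (local_rep Sub Cyl \<kappa>' i j)"
        using \<kappa>'_smooth i j by (simp add: smooth_map_def)
      moreover have "x \<in> local_dom Sub Cyl \<kappa>' i j"
        unfolding local_dom_def using p True yt j by (intro image_eqI[of _ _ p]) auto
      ultimately obtain V0 F0 where V0: "open V0" "x \<in> V0" "\<And>k. Ck_on k F0 V0"
        "\<And>z. z \<in> local_dom Sub Cyl \<kappa>' i j \<Longrightarrow> z \<in> V0 \<Longrightarrow> F0 z = local_rep Sub Cyl \<kappa>' i j z"
        unfolding smooth_on_def by (metis IntI)
      have xV1: "x \<in> V1" using V1(2) p True yt T Tj j by auto
      \<comment> \<open>F0 extends the coordinate expression of \<open>\<kappa>'\<close> to an open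
        set of the model space. Its first component extends the height, and \<eta> is smooth on the
        whole line, so the composite is a smooth local extension of \<open>ext c\<close>.\<close>
      let ?V = "V0 \<inter> V1" and ?F = "\<lambda>z. c y * \<eta> (fst (F0 z))"
      have oV: "open ?V" using V0 V1 by blast
      have Ck: "Ck_on k ?F ?V" for k
        by (rule Ck_on_linear[OF bounded_linear_mult_right oV Ck_on_compose_real[OF oV Ck_\<eta>
              Ck_on_linear[OF bounded_linear_fst oV Ck_on_subset[OF V0(3)]]]]) simp
      have "?F z = (ext c \<circ> \<iota> i) z" if z: "z \<in> \<phi> i ` patch i \<inter> ?V" for z
      proof -
        have "z \<in> \<phi> i ` (patch i \<inter> ?O)" using z V1 by blast
        then obtain q where q: "z = \<phi> i q" "q \<in> patch i \<inter> ?O" by (rule imageE)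
        then have q: "q \<in> patch i" "q \<in> W" "\<kappa>' q \<in> (T \<inter> Tj) \<times> UNIV" "z = \<phi> i q" by simp_all
        from q(2) obtain y' s where ys: "y' \<in> \<Sigma>" "0 \<le> s" "s < L" "q = \<kappa> (y', s)" "\<kappa>' q = (y', s)"
          by (rule collar_cases)
        have y': "y' \<in> T" "y' \<in> patch j" using q ys Tj boundary_subset by auto
        have "z \<in> local_dom Sub Cyl \<kappa>' i j"
          unfolding local_dom_def using q ys y' by (intro image_eqI[of _ _ q]) auto
        then have "F0 z = local_rep Sub Cyl \<kappa>' i j z" using V0(4) z by blast
        also have "\<dots> = (s, snd (\<phi> j y'))"
          using q ys by (simp add: local_rep_def chart_inv_Sub[OF i])
        finally show ?thesis
          using q i bspec[OF T(3), of y'] y'(1) ys by (simp add: ext_\<kappa>)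
      qed
      then show ?thesis
        using oV Ck V0(2) xV1 by (intro exI[of _ ?V] exI[of _ ?F]) auto
    qed
  qed
  moreover have "ext c p = 0" if "p \<notin> points M" for p
    using that W_subset by (auto simp: ext_def)
  ultimately show ?thesis by (simp add: smooth_functions_def)
qed

section \<open>Pointwise norm of the differential\<close>

text \<open>The differential is 0 here, and the vector dual to the zero covector is 0 for every
  inner product. This is how the unknown part of \<open>g'\<close> drops out.\<close>

lemma norm_sq_ext_zero:
  assumes c: "locally_constant c" and p: "p \<in> points M" "p \<notin> \<kappa> ` (\<Sigma> \<times> {L/2..<L})"
  shows "differential_norm_sq M g' (ext c) p = 0"
proof (rule differential_norm_sq_eq[OF metric' p(1)])
  fix i assume i: "i \<in> charts M" "p \<in> patch i"
  obtain T where T: "openin (top_of_set (points M)) T" "p \<in> T" "\<forall>q\<in>T. ext c q = ext c p"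
    using ext_locally_constant_near[OF assms] .
  have "bilinear (g' i p)" using metric' i by (auto simp: riemannian_metric_def)
  then show "\<exists>u. (\<forall>v. g' i p u v = differential M (ext c) i p v) \<and> g' i p u u = 0"
    using differential_locally_constant[OF i T] bilinear_lzero by (intro exI[of _ 0]) auto
qed

text \<open>The gradient of \<open>ext c\<close> at \<open>\<kappa> (y, t)\<close> is the image under the differential of \<open>\<kappa>\<close> of
  \<open>c y * \<psi> t\<close> times the unit vector of the real factor.\<close>

lemma norm_sq_ext_collar:
  assumes c: "locally_constant c" and y: "y \<in> \<Sigma>" and t: "L/2 \<le> t" "t < L"
  shows "differential_norm_sq M g' (ext c) (\<kappa> (y, t)) = (c y * \<psi> t)\<^sup>2"
proof -
  define p where "p = \<kappa> (y, t)"
  have t0: "0 \<le> t" using t L_pos by simp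
  have pW: "p \<in> W" and pk: "\<kappa>' p = (y, t)" using y t t0 by (simp_all add: p_def)
  have pM: "p \<in> points M" using pW W_subset by blast
  obtain j where j: "j \<in> charts M" "y \<in> patch j"
    using y boundary_subset by (auto simp: points_def)
  obtain T where T: "open T" "y \<in> T" "\<forall>z\<in>T \<inter> \<Sigma>. c z = c y"
    using locally_constantD[OF c y] .
  have "differential_norm_sq M g' (ext c) p = (c y * \<psi> t)\<^sup>2"
  proof (rule differential_norm_sq_eq[OF metric' pM])
    fix i assume i: "i \<in> charts M" "p \<in> patch i"
    let ?Q = "local_dom Cyl Sub \<kappa> j i" and ?R = "local_rep Cyl Sub \<kappa> j i"
    define z where "z = (t, snd (\<phi> j y))"
    have zQ: "z \<in> ?Q"
      unfolding local_dom_def z_def using i j y t t0 pW p_def by (intro image_eqI[of _ _ "(y, t)"]) auto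
    have Rz: "?R z = \<phi> i p"
      using chart_inv_Cyl[OF j y t0 t(2)] by (simp add: local_rep_def z_def p_def)
    obtain D where D: "(?R has_derivative D) (at z within ?Q)"
      and pull: "\<And>u v. product_metric (induced_metric g) j (y, t) u v = g' i p (D u) (D v)"
      using collar_pullback[OF y t j, of i] i unfolding p_def z_def by blast
    have bil: "bilinear (g' i p)" using metric' i by (auto simp: riemannian_metric_def)
    have linD: "linear D" using D has_derivative_linear by blast
    \<comment> \<open>D pulls the inner product \<open>g' i p\<close> back to the positive definite
      product metric, so it is injective. The dimensions agree, hence it is onto, and the gradient
      can be tested on vectors of the form D w.\<close>
    have "D u = 0 \<Longrightarrow> u = 0" for u
    proof -
      assume "D u = 0"
      then have 0: "product_metric (induced_metric g) j (y, t) u u = 0"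
        using pull bilinear_lzero[OF bil] by simp
      obtain a v where u: "u = (a, v)" by (cases u)
      have "v \<noteq> 0 \<Longrightarrow> 0 < g j y (0, v) (0, v)"
        using metric j unfolding riemannian_metric_def by (simp add: zero_prod_def)
      moreover have "bilinear (g j y)" using metric j by (auto simp: riemannian_metric_def)
      then have "g j y (0, 0) (0, 0) = 0" using bilinear_lzero by (metis zero_prod_def)
      moreover have "a * a + g j y (0, v) (0, v) = 0"
        using 0 by (simp add: u product_metric_def induced_metric_def)
      ultimately have "v = 0" "a = 0"
        by (smt (verit) mult_eq_0_iff zero_le_square)+
      then show "u = 0" by (simp add: u zero_prod_def)
    qed
    then have "inj D" using linear_injective_0[OF linD] by blast
    then have "surj D" using linear_injective_imp_surjective linD by blast
    have "smooth_on (\<phi> i ` patch i) (ext c \<circ> \<iota> i)"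
      using ext_smooth[OF c] i by (simp add: smooth_functions_def)
    then obtain A where A: "(ext c \<circ> \<iota> i has_derivative A) (at (\<phi> i p) within \<phi> i ` patch i)"
      using smooth_on_has_derivative i by blast
    have dA: "differential M (ext c) i p = A" using differential_eq[OF i A] .
    have R: "?R (s, snd (\<phi> j y')) = \<phi> i (\<kappa> (y', s))" if "y' \<in> patch j" "y' \<in> \<Sigma>" "0 \<le> s" "s < L" for y' s
      using chart_inv_Cyl[OF j(1) that] by (simp add: local_rep_def)
    have RQ: "?R ` ?Q \<subseteq> \<phi> i ` patch i"
      using R by (auto simp: local_dom_def)
    have "(ext c \<circ> \<iota> i \<circ> ?R has_derivative A \<circ> D) (at z within ?Q)"
      using diff_chain_within[OF D] has_derivative_subset[OF A RQ] Rz by simp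
    \<comment> \<open>In cylinder coordinates \<open>ext c\<close> depends near z only on the
      height, because \<open>c\<close> is constant near y. The neighbourhood used restricts the
      boundary coordinates alone.\<close>
    moreover have "(ext c \<circ> \<iota> i \<circ> ?R has_derivative (\<lambda>u. c y * \<psi> t * fst u)) (at z within ?Q)"
    proof -
      have e: "(\<eta> has_derivative (*) (\<psi> t)) (at (fst z) within fst ` ?Q)"
        using \<eta>_der[of t] by (auto simp: has_field_derivative_def z_def intro: has_derivative_at_withinI)
      have "((\<lambda>x. c y * \<eta> (fst x)) has_derivative (\<lambda>u. c y * (\<psi> t * fst u))) (at z within ?Q)"
        using diff_chain_within[OF has_derivative_fst[OF has_derivative_ident] e]
        by (intro has_derivative_mult_right) (simp add: o_def)
      then have "((\<lambda>x. c y * \<eta> (fst x)) has_derivative (\<lambda>u. c y * \<psi> t * fst u)) (at z within ?Q)"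
        by (simp add: mult.assoc)
      then show ?thesis
      proof (rule has_derivative_transform_eventually)
        obtain Tj where Tj: "open Tj" "patch j = points M \<inter> Tj" using patch_neighbourhood[OF j(1)] .
        have "patch j \<inter> (points M \<inter> T) = patch j \<inter> T" using dom_points[OF j(1)] by blast
        then have oV: "open ((\<lambda>p. snd (\<phi> j p)) ` (patch j \<inter> T \<inter> \<Sigma>))"
          using open_boundary_image[OF j(1), of "points M \<inter> T"] T(1) by (simp add: openin_open_Int)
        have "(ext c \<circ> \<iota> i \<circ> ?R) x = c y * \<eta> (fst x)"
          if "x \<in> ?Q" "x \<in> UNIV \<times> (\<lambda>p. snd (\<phi> j p)) ` (patch j \<inter> T \<inter> \<Sigma>)" for x
        proof -
          from that(1) obtain y' s where ys: "y' \<in> patch j" "y' \<in> \<Sigma>" "0 \<le> s" "s < L"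
            "\<kappa> (y', s) \<in> patch i" "x = (s, snd (\<phi> j y'))" by (auto simp: local_dom_def)
          from that(2) obtain y'' where "y'' \<in> patch j" "y'' \<in> T" "y'' \<in> \<Sigma>" "snd (\<phi> j y') = snd (\<phi> j y'')"
            using ys(6) by auto
          then have "y' \<in> T" using ys inv_boundary[OF j(1)] by metis
          then have "c y' = c y" using T ys by blast
          then show ?thesis using ys R i by (simp add: ext_\<kappa>)
        qed
        moreover have "z \<in> UNIV \<times> (\<lambda>p. snd (\<phi> j p)) ` (patch j \<inter> T \<inter> \<Sigma>)"
          using j y T by (auto simp: z_def)
        ultimately show "\<forall>\<^sub>F x in at z within ?Q. c y * \<eta> (fst x) = (ext c \<circ> \<iota> i \<circ> ?R) x"
          "c y * \<eta> (fst z) = (ext c \<circ> \<iota> i \<circ> ?R) z" "z \<in> ?Q"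
          using oV zQ by (auto simp: eventually_at_topological simp del: o_apply
              intro!: exI[of _ "UNIV \<times> (\<lambda>p. snd (\<phi> j p)) ` (patch j \<inter> T \<inter> \<Sigma>)"] open_Times)
      qed
    qed
    \<comment> \<open>The chain rule and the direct computation give two derivatives of the same
      composite within \<open>?Q\<close>; uniqueness there identifies them.\<close>
    ultimately have AD: "A \<circ> D = (\<lambda>u. c y * \<psi> t * fst u)"
      using half_space_derivative_unique[OF local_dom_openin[OF j(1) i(1)] zQ] by blast
    let ?e = "(c y * \<psi> t, 0) :: real \<times> 'v"
    have pe: "product_metric (induced_metric g) j (y, t) ?e w = c y * \<psi> t * fst w" for w
    proof -
      have "bilinear (g j y)" using metric j by (auto simp: riemannian_metric_def)
      then have "g j y (0, 0) v = 0" for v using bilinear_lzero by (metis zero_prod_def)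
      then show ?thesis by (cases w) (simp add: product_metric_def induced_metric_def)
    qed
    have "g' i p (D ?e) v = A v" for v
    proof -
      obtain w where w: "v = D w" using \<open>surj D\<close> by (metis surjD)
      have "A (D w) = c y * \<psi> t * fst w" using AD by (metis comp_apply)
      then show ?thesis using pull[of ?e w] pe[of w] w by simp
    qed
    moreover have "g' i p (D ?e) (D ?e) = (c y * \<psi> t)\<^sup>2"
      using pull[of ?e ?e] pe[of ?e] by (simp add: power2_eq_square)
    ultimately show "\<exists>u. (\<forall>v. g' i p u v = differential M (ext c) i p v) \<and> g' i p u u = (c y * \<psi> t)\<^sup>2"
      unfolding dA by blast
  qed
  then show ?thesis by (simp add: p_def)
qed

end

section \<open>The Dirichlet energy of the test functions\<close>

lemma gram_det_product_metric:
  assumes "bilinear (h j y)"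
  shows "gram_det (product_metric h j (y, t)) = gram_det (h j y)"
proof -
  have "product_metric h j (y, t) = (\<lambda>(r, v) (s, w). r * s + h j y v w)"
    by (simp add: product_metric_def fun_eq_iff)
  then show ?thesis
    using gram_det_product[of "h j y"] bilinear_lzero[OF assms] bilinear_rzero[OF assms] by simp
qed

locale collar_energy = collar_cutoff M g g' W L \<kappa> \<eta> \<psi> r
  for M :: "('i, 'a::{t2_space,second_countable_topology}, real \<times> 'v::euclidean_space) atlas"
    and g g' W L \<kappa> \<eta> \<psi> r +
  fixes c :: "'a \<Rightarrow> real"
  assumes c: "locally_constant c" and boundary_nonempty: "\<Sigma> \<noteq> {}"
begin

lemma charts_nonempty: "charts M \<noteq> {}"
  using boundary_nonempty by (auto simp: boundary_def)

lemma closed_points: "closed (points M)"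
  using compact by (rule compact_imp_closed)

sublocale R: riemannian_atlas M g'
  by (rule riemannian_atlas_manifold[OF metric' charts_nonempty closed_points])

sublocale B: riemannian_atlas "boundary_atlas M" "induced_metric g'"
  by (rule riemannian_atlas_boundary[OF metric' charts_nonempty closed_points])

text \<open>On the slab this is the signed length of the gradient of \<open>ext c\<close>, as
  \<open>norm_sq_ext_collar\<close> shows.\<close>

definition slope :: "'a \<Rightarrow> real" where
  "slope p = c (fst (\<kappa>' p)) * \<psi> (snd (\<kappa>' p))"

text \<open>Height L/2 is included: the metrics agree there, and the part of the collar left below
  is open, which local constancy requires.\<close>

definition slab :: "'a set \<Rightarrow> 'a set" where
  "slab X = \<kappa> ` (X \<times> {L/2..<L})"

text \<open>The indicator makes this Borel on the whole ambient space, although \<open>slope\<close>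
  is controlled only on W.\<close>

definition energy_density :: "'a \<Rightarrow> ennreal" where
  "energy_density p = ennreal ((slope p)\<^sup>2) * indicator (slab \<Sigma>) p"

lemma slab_cases:
  assumes "p \<in> slab X" "X \<subseteq> \<Sigma>"
  obtains y t where "y \<in> X" "y \<in> \<Sigma>" "L/2 \<le> t" "0 \<le> t" "t < L" "p = \<kappa> (y, t)" "\<kappa>' p = (y, t)"
proof -
  from assms(1) obtain x where x: "p = \<kappa> x" "x \<in> X \<times> {L/2..<L}"
    unfolding slab_def by (rule imageE)
  obtain y t where "x = (y, t)" by (cases x)
  with x assms(2) have yt: "y \<in> X" "y \<in> \<Sigma>" "L/2 \<le> t" "t < L" "p = \<kappa> (y, t)" by auto
  moreover from yt L_pos have t0: "0 \<le> t" by simp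
  moreover have "\<kappa>' p = (y, t)" unfolding yt(5) using yt t0 by simp
  ultimately show ?thesis by (intro that)
qed

lemma slab_W: "X \<subseteq> \<Sigma> \<Longrightarrow> slab X \<subseteq> W"
  by (auto elim!: slab_cases)

text \<open>The image under \<kappa> is rewritten as a preimage under \<open>\<kappa>'\<close>,
  continuous on the Borel set W; the upper bound L on the height holds automatically there.\<close>

lemma slab_borel:
  assumes "X \<in> sets borel" "X \<subseteq> \<Sigma>"
  shows "slab X \<in> sets borel"
proof -
  have W: "W \<in> sets borel"
    using W_open closed_points by (auto simp: openin_open)
  have eq: "slab X = \<kappa>' -` (X \<times> {L/2..}) \<inter> W"
  proof
    show "slab X \<subseteq> \<kappa>' -` (X \<times> {L/2..}) \<inter> W"
      using slab_W[OF assms(2)] assms(2) by (auto elim!: slab_cases)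
    show "\<kappa>' -` (X \<times> {L/2..}) \<inter> W \<subseteq> slab X"
    proof
      fix p assume p: "p \<in> \<kappa>' -` (X \<times> {L/2..}) \<inter> W"
      then have "p \<in> W" by simp
      then obtain y t where "y \<in> \<Sigma>" "0 \<le> t" "t < L" "p = \<kappa> (y, t)" "\<kappa>' p = (y, t)" by (rule collar_cases)
      with p show "p \<in> slab X" by (auto simp: slab_def)
    qed
  qed
  have "\<kappa>' \<in> borel_measurable (restrict_space borel W)"
    using continuous_\<kappa>' by (rule borel_measurable_continuous_on_restrict)
  moreover have "X \<times> {L/2..} \<in> sets borel" using assms by (intro borel_Times) auto
  ultimately have "\<kappa>' -` (X \<times> {L/2..}) \<inter> space (restrict_space borel W) \<in> sets (restrict_space borel W)"
    by (rule measurable_sets)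
  then show ?thesis using W by (simp add: eq space_restrict_space sets_restrict_space_iff)
qed

lemma \<Sigma>_borel: "\<Sigma> \<in> sets borel"
  by (intro borel_closed compact_imp_closed compact_\<Sigma>)

lemma continuous_slope: "continuous_on W slope"
proof -
  have "continuous_on W (\<lambda>p. c (fst (\<kappa>' p)))"
  proof (rule continuous_on_compose2[OF locally_constant_continuous[OF c]])
    show "continuous_on W (\<lambda>p. fst (\<kappa>' p))" by (intro continuous_on_fst continuous_\<kappa>')
    show "(\<lambda>p. fst (\<kappa>' p)) ` W \<subseteq> \<Sigma>" by (auto elim!: collar_cases)
  qed
  moreover have "continuous_on W (\<lambda>p. \<psi> (snd (\<kappa>' p)))"
    by (rule continuous_on_compose2[OF \<psi>_cont]) (auto intro: continuous_on_snd continuous_\<kappa>')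
  ultimately show ?thesis unfolding slope_def[abs_def] by (rule continuous_on_mult)
qed

lemma energy_density_measurable: "energy_density \<in> borel_measurable borel"
proof -
  have "slope \<in> borel_measurable (restrict_space borel (slab \<Sigma>))"
    by (intro borel_measurable_continuous_on_restrict continuous_on_subset[OF continuous_slope] slab_W order_refl)
  then have "(\<lambda>p. ennreal ((slope p)\<^sup>2)) \<in> borel_measurable (restrict_space borel (slab \<Sigma>))"
    by measurable
  then show ?thesis
    using slab_borel[OF \<Sigma>_borel order_refl]
    unfolding energy_density_def[abs_def]
    by (subst (asm) borel_measurable_restrict_space_iff_ennreal) simp_all
qed

lemma dirichlet_energy_eq:
  "dirichlet_energy M g' (ext c) = (\<integral>\<^sup>+p\<in>slab \<Sigma>. energy_density p \<partial>riemannian_measure M g')"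
  unfolding dirichlet_energy_def
proof (rule nn_integral_cong)
  fix p assume "p \<in> space (riemannian_measure M g')"
  then have p: "p \<in> points M" by (simp add: R.space_riemannian_measure)
  show "ennreal (differential_norm_sq M g' (ext c) p) = energy_density p * indicator (slab \<Sigma>) p"
  proof (cases "p \<in> slab \<Sigma>")
    case True
    then obtain y t where yt: "y \<in> \<Sigma>" "L/2 \<le> t" "t < L" "p = \<kappa> (y, t)" "\<kappa>' p = (y, t)"
      by (rule slab_cases) auto
    have "differential_norm_sq M g' (ext c) p = (slope p)\<^sup>2"
      unfolding slope_def yt(5) using norm_sq_ext_collar[OF c yt(1-3)] yt(4) by simp
    then show ?thesis using True by (simp add: energy_density_def)
  next
    case False
    then show ?thesis using norm_sq_ext_zero[OF c p] by (simp add: slab_def)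
  qed
qed

text \<open>The energy integrand in cylinder coordinates, height first. By block-diagonality of the
  product metric the volume density is the boundary density alone, so the variables
  separate.\<close>

definition cylinder_density :: "'i \<Rightarrow> real \<times> 'v \<Rightarrow> ennreal" where
  "cylinder_density j z = B.chart_density j (snd z) *
     ennreal ((c (chart_inv (boundary_atlas M) j (snd z)) * \<psi> (fst z))\<^sup>2)"

abbreviation cyl_image :: "'i \<Rightarrow> 'a set \<Rightarrow> (real \<times> 'v) set" where
  "cyl_image j S \<equiv> (\<lambda>p. chart_map Cyl j (\<kappa>' p)) ` S"

abbreviation bmap :: "'i \<Rightarrow> 'a \<Rightarrow> 'v" where
  "bmap j \<equiv> (\<lambda>y. snd (\<phi> j y))"

lemma B_simps [simp]: "charts (boundary_atlas M) = charts M"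
  "chart_dom (boundary_atlas M) j = patch j \<inter> \<Sigma>" "chart_map (boundary_atlas M) j = bmap j"
  by (simp_all add: boundary_atlas_def)

lemma cyl_image_borel:
  assumes j: "j \<in> charts M" and S: "S \<in> sets borel" "S \<subseteq> slab (patch j \<inter> \<Sigma>)"
  shows "cyl_image j S \<in> sets borel"
proof -
  let ?D = "{0..<L} \<times> bmap j ` (patch j \<inter> \<Sigma>)" and ?k = "\<lambda>x. \<kappa> (\<iota> j (0, snd x), fst x)"
  have D: "?D \<in> sets borel" using B.image_borel j by (intro borel_Times) auto
  have eq: "cyl_image j S = ?k -` S \<inter> ?D"
  proof
    show "cyl_image j S \<subseteq> ?k -` S \<inter> ?D"
    proof
      fix z assume "z \<in> cyl_image j S"
      then obtain p where p: "p \<in> S" "z = chart_map Cyl j (\<kappa>' p)" by blast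
      then have "p \<in> slab (patch j \<inter> \<Sigma>)" using S by blast
      then obtain y t where "y \<in> patch j \<inter> \<Sigma>" "y \<in> \<Sigma>" "L/2 \<le> t"
        and t: "0 \<le> t" "t < L" and p': "p = \<kappa> (y, t)" "\<kappa>' p = (y, t)"
        by (rule slab_cases[OF _ Int_lower2])
      then have yt: "y \<in> patch j \<inter> \<Sigma>" "0 \<le> t" "t < L" "p = \<kappa> (y, t)" "\<kappa>' p = (y, t)" by simp_all
      have "z = (t, bmap j y)" by (simp add: p(2) yt(5))
      then show "z \<in> ?k -` S \<inter> ?D"
        using yt(1-3) p(1) yt(4) inv_boundary[OF j, of y] by simp
    qed
    show "?k -` S \<inter> ?D \<subseteq> cyl_image j S"
    proof
      fix z assume z: "z \<in> ?k -` S \<inter> ?D"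
      then obtain y t where yt: "z = (t, bmap j y)" "0 \<le> t" "t < L" "y \<in> patch j" "y \<in> \<Sigma>" by auto
      then have "\<kappa> (y, t) \<in> S" using z inv_boundary[OF j, of y] by simp
      then show "z \<in> cyl_image j S"
        using yt by (intro image_eqI[of _ _ "\<kappa> (y, t)"]) simp_all
    qed
  qed
  have "?k \<in> borel_measurable (restrict_space borel ?D)"
    using continuous_collar_chart[OF j] by (rule borel_measurable_continuous_on_restrict)
  from measurable_sets[OF this S(1)] D show ?thesis
    by (simp only: eq space_restrict_space sets_restrict_space_iff space_borel Int_UNIV_right sets.Int UNIV_I)
qed

section \<open>Transfer to the cylinder and separation of variables\<close>

text \<open>The change of variables is the coordinate expression of \<kappa> between the cylinder
  chart \<open>j\<close> and the chart \<open>i\<close> of M. On the slab it pulls \<open>g'\<close>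
  back to the product metric, so the Gram formula applies with the squared slope as weight.\<close>

lemma chart_integral:
  assumes j: "j \<in> charts M" and i: "i \<in> charts M"
    and S: "S \<in> sets borel" "S \<subseteq> slab (patch j \<inter> \<Sigma>)" "S \<subseteq> patch i"
  shows "(\<integral>\<^sup>+p\<in>S. energy_density p \<partial>riemannian_measure M g')
       = (\<integral>\<^sup>+z\<in>cyl_image j S. cylinder_density j z \<partial>lborel)"
proof -
  let ?Z = "cyl_image j S" and ?R = "local_rep Cyl Sub \<kappa> j i" and ?Q = "local_dom Cyl Sub \<kappa> j i"
  let ?q = "\<lambda>z. product_metric (induced_metric g') j (chart_inv Cyl j z)"
    and ?q' = "\<lambda>x. g' i (\<iota> i x)" and ?H = "\<lambda>x. (slope (\<iota> i x))\<^sup>2"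
  have Sc: "\<exists>y t. y \<in> patch j \<and> y \<in> \<Sigma> \<and> L/2 \<le> t \<and> 0 \<le> t \<and> t < L \<and> p = \<kappa> (y, t) \<and> \<kappa>' p = (y, t)" if "p \<in> S" for p
  proof -
    have "p \<in> slab (patch j \<inter> \<Sigma>)" using S that by blast
    then show ?thesis by (rule slab_cases) auto
  qed
  have RZ1: "?R (chart_map Cyl j (\<kappa>' p)) = \<phi> i p" if p: "p \<in> S" for p
  proof -
    obtain y t where yt: "y \<in> patch j" "y \<in> \<Sigma>" "0 \<le> t" "t < L" "p = \<kappa> (y, t)" "\<kappa>' p = (y, t)"
      using Sc[OF p] by blast
    show ?thesis
      unfolding yt(6) using chart_inv_Cyl[OF j yt(1-4)] yt(5) by (simp add: local_rep_def)
  qed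
  have RZ: "?R ` ?Z = \<phi> i ` S"
    using RZ1 by (simp add: image_image)
  have gram: "gram_det (?q (t, bmap j y)) = gram_det (induced_metric g' j y)"
    if "y \<in> patch j" "y \<in> \<Sigma>" "0 \<le> t" "t < L" for y t
    using chart_inv_Cyl[OF j that] B.bilinear[of j y] j that by (simp add: gram_det_product_metric)
  have "(\<integral>\<^sup>+p\<in>S. energy_density p \<partial>riemannian_measure M g')
      = (\<integral>\<^sup>+x\<in>\<phi> i ` S. R.chart_density i x * energy_density (\<iota> i x) \<partial>lborel)"
    using energy_density_measurable
    by (intro R.nn_integral_riemannian_measure_chart i S) (rule measurable_restrict_space1)
  also have "\<dots> = (\<integral>\<^sup>+x. ennreal (sqrt (gram_det (?q' x))) * ennreal (?H x) * indicator (?R ` ?Z) x \<partial>lborel)"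
    unfolding RZ
  proof (intro nn_integral_cong)
    fix x
    have "energy_density p = ennreal ((slope p)\<^sup>2)" if "p \<in> S" for p
      using S that by (auto simp: energy_density_def slab_def)
    then show "R.chart_density i x * energy_density (\<iota> i x) * indicator (\<phi> i ` S) x =
      ennreal (sqrt (gram_det (?q' x))) * ennreal (?H x) * indicator (\<phi> i ` S) x"
      using S i by (auto simp: R.chart_density_def indicator_def)
  qed
  also have "\<dots> = (\<integral>\<^sup>+z. ennreal (sqrt (gram_det (?q z))) * ennreal (?H (?R z)) * indicator ?Z z \<partial>lborel)"
  proof (rule nn_integral_change_of_variables_gram[symmetric])
    show "?Z \<in> sets borel" using cyl_image_borel[OF j S(1,2)] .
    show "?R ` ?Z \<in> sets borel" unfolding RZ using R.map_image_borel[OF i S(1,3)] .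
    show "inj_on ?R ?Z"
    proof (rule inj_onI)
      fix z z' assume "z \<in> ?Z" "z' \<in> ?Z" and eq: "?R z = ?R z'"
      then obtain p p' where p: "p \<in> S" "z = chart_map Cyl j (\<kappa>' p)" "p' \<in> S" "z' = chart_map Cyl j (\<kappa>' p')"
        by blast
      then have "\<phi> i p = \<phi> i p'" using eq RZ1 by simp
      then have "p = p'" using R.map_inj[OF i] p S(3) by (meson inj_onD subsetD)
      then show "z = z'" using p by simp
    qed
    fix z assume "z \<in> ?Z"
    then obtain p where p: "p \<in> S" "z = chart_map Cyl j (\<kappa>' p)" by blast
    obtain y t where yt: "y \<in> patch j" "y \<in> \<Sigma>" "L/2 \<le> t" "0 \<le> t" "t < L" "p = \<kappa> (y, t)" "\<kappa>' p = (y, t)"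
      using Sc[OF p(1)] by blast
    have z: "z = (t, bmap j y)" by (simp add: p(2) yt(7))
    have pi: "p \<in> patch i" using p S by blast
    have ip: "\<iota> i (?R z) = p" using RZ1[OF p(1)] p(2) pi i by simp
    show "bilinear (?q' (?R z))" unfolding ip using R.bilinear[OF i pi] .
    have sub: "?Z \<subseteq> ?Q"
    proof
      fix z assume "z \<in> ?Z"
      then obtain p where p: "p \<in> S" "z = chart_map Cyl j (\<kappa>' p)" by blast
      obtain y t where yt: "y \<in> patch j" "y \<in> \<Sigma>" "0 \<le> t" "t < L" "p = \<kappa> (y, t)" "\<kappa>' p = (y, t)"
        using Sc[OF p(1)] by blast
      have "\<kappa> (y, t) \<in> patch i" using p S yt(5) by blast
      then show "z \<in> ?Q"
        unfolding local_dom_def p(2) yt(6) using yt(1-4) by (intro image_eqI[of _ _ "(y, t)"]) simp_all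
    qed
    obtain D where D: "(?R has_derivative D) (at z within ?Q)"
      "\<And>u v. product_metric (induced_metric g) j (y, t) u v = g' i p (D u) (D v)"
      using collar_pullback[OF yt(2,3,5) j yt(1) i] pi unfolding yt(6) z by blast
    \<comment> \<open>The isometry concerns the metric induced by \<open>g\<close>, the boundary
      norm that induced by \<open>g'\<close>; agreement on \<Sigma> identifies them.\<close>
    have "induced_metric g' j y = induced_metric g j y"
      using agree[of y j] yt j by (simp add: induced_metric_def)
    then have "?q z = product_metric (induced_metric g) j (y, t)"
      using chart_inv_Cyl[OF j yt(1,2,4,5)] by (simp add: z product_metric_def)
    then show "\<exists>D. (?R has_derivative D) (at z within ?Z) \<and> (\<forall>u v. ?q z u v = ?q' (?R z) (D u) (D v))"
      unfolding ip using D has_derivative_subset[OF D(1) sub] by auto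
  next
    have "(\<lambda>z. gram_det (induced_metric g' j (chart_inv (boundary_atlas M) j (snd z))))
        \<in> borel_measurable (restrict_space borel ?Z)"
    proof (rule measurable_compose[OF _ B.gram_measurable])
      show "snd \<in> restrict_space borel ?Z \<rightarrow>\<^sub>M
        restrict_space borel (chart_map (boundary_atlas M) j ` chart_dom (boundary_atlas M) j)"
      proof (rule measurable_restrict_space2)
        show "snd \<in> borel_measurable (restrict_space borel ?Z)"
          by (intro borel_measurable_continuous_on_restrict continuous_intros)
        show "snd \<in> space (restrict_space borel ?Z) \<rightarrow> chart_map (boundary_atlas M) j ` chart_dom (boundary_atlas M) j"
        proof
          fix z assume "z \<in> space (restrict_space borel ?Z)"
          then obtain p where p: "p \<in> S" "z = chart_map Cyl j (\<kappa>' p)" by (auto simp: space_restrict_space)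
          obtain y t where "y \<in> patch j" "y \<in> \<Sigma>" "\<kappa>' p = (y, t)" using Sc[OF p(1)] by blast
          with p show "snd z \<in> chart_map (boundary_atlas M) j ` chart_dom (boundary_atlas M) j" by auto
        qed
      qed
    qed (use j in simp)
    moreover have "gram_det (?q z) = gram_det (induced_metric g' j (chart_inv (boundary_atlas M) j (snd z)))"
      if "z \<in> space (restrict_space borel ?Z)" for z
    proof -
      from that obtain p where p: "p \<in> S" "z = chart_map Cyl j (\<kappa>' p)" by (auto simp: space_restrict_space)
      obtain y t where yt: "y \<in> patch j" "y \<in> \<Sigma>" "0 \<le> t" "t < L" "\<kappa>' p = (y, t)" using Sc[OF p(1)] by blast
      then show ?thesis
        unfolding p(2) yt(5) using gram[OF yt(1-4)] chart_inv_boundary_atlas[OF j yt(1,2)] by simp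
    qed
    ultimately show "(\<lambda>z. gram_det (?q z)) \<in> borel_measurable (restrict_space borel ?Z)"
      by (simp cong: measurable_cong)
    show "(\<lambda>x. gram_det (?q' x)) \<in> borel_measurable (restrict_space borel (?R ` ?Z))"
      unfolding RZ by (rule measurable_restrict_mono[OF R.gram_measurable[OF i]]) (use S in blast)
    have "continuous_on (\<phi> i ` S) (\<lambda>x. slope (\<iota> i x))"
    proof (rule continuous_on_compose2[OF continuous_slope])
      show "continuous_on (\<phi> i ` S) (\<iota> i)"
        by (rule continuous_on_subset[OF continuous_inv[OF i]]) (use S in blast)
      show "\<iota> i ` (\<phi> i ` S) \<subseteq> W"
        unfolding image_image
      proof (rule image_subsetI)
        fix p assume "p \<in> S"
        then have "p \<in> W" "p \<in> patch i" using S slab_W[OF Int_lower2, of "patch j"] by blast+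
        then show "\<iota> i (\<phi> i p) \<in> W" using i by simp
      qed
    qed
    then have "(\<lambda>x. slope (\<iota> i x)) \<in> borel_measurable (restrict_space borel (\<phi> i ` S))"
      by (rule borel_measurable_continuous_on_restrict)
    then show "?H \<in> borel_measurable (restrict_space borel (?R ` ?Z))"
      unfolding RZ by measurable
  qed simp
  also have "\<dots> = (\<integral>\<^sup>+z\<in>?Z. cylinder_density j z \<partial>lborel)"
  proof (rule nn_integral_cong)
    fix z
    show "ennreal (sqrt (gram_det (?q z))) * ennreal (?H (?R z)) * indicator ?Z z = cylinder_density j z * indicator ?Z z"
    proof (cases "z \<in> ?Z")
      case True
      then obtain p where p: "p \<in> S" "z = chart_map Cyl j (\<kappa>' p)" by blast
      obtain y t where yt: "y \<in> patch j" "y \<in> \<Sigma>" "0 \<le> t" "t < L" "p = \<kappa> (y, t)" "\<kappa>' p = (y, t)"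
        using Sc[OF p(1)] by blast
      have z: "z = (t, bmap j y)" by (simp add: p(2) yt(6))
      have "p \<in> patch i" using p S by blast
      then have "\<iota> i (?R z) = p" using RZ1[OF p(1)] p(2) i by simp
      moreover have "slope p = c y * \<psi> t" by (simp add: slope_def yt(6))
      moreover have "chart_inv (boundary_atlas M) j (bmap j y) = y"
        using chart_inv_boundary_atlas[OF j yt(1,2)] .
      ultimately show ?thesis
        using gram[OF yt(1-4)] by (simp add: cylinder_density_def B.chart_density_def z)
    qed simp
  qed
  finally show ?thesis .
qed

text \<open>The slab over X is a product in the chart \<open>j\<close>, but it need not fit into one
  chart of M. It is cut along the pieces of M, each part is moved to the cylinder, and the parts are
  put together there before Tonelli separates height and boundary.\<close>

lemma slab_integral:
  assumes j: "j \<in> charts M" and X: "X \<in> sets borel" "X \<subseteq> patch j \<inter> \<Sigma>"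
  shows "(\<integral>\<^sup>+p\<in>slab X. energy_density p \<partial>riemannian_measure M g')
    = (\<integral>\<^sup>+t\<in>{L/2..<L}. ennreal ((\<psi> t)\<^sup>2) \<partial>lborel) *
      (\<integral>\<^sup>+y\<in>X. ennreal ((c y)\<^sup>2) \<partial>riemannian_measure (boundary_atlas M) (induced_metric g'))"
proof -
  let ?I = "{L/2..<L}" and ?inv = "chart_inv (boundary_atlas M) j"
  let ?b = "\<lambda>v. B.chart_density j v * ennreal ((c (?inv v))\<^sup>2)"
  have X\<Sigma>: "X \<subseteq> \<Sigma>" using X by blast
  have slabX: "slab X \<in> sets borel" "slab X \<subseteq> points M"
    using slab_borel[OF X(1) X\<Sigma>] slab_W[OF X\<Sigma>] W_subset by auto
  have im: "cyl_image j (slab X) = ?I \<times> bmap j ` X"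
  proof
    show "cyl_image j (slab X) \<subseteq> ?I \<times> bmap j ` X"
      using X\<Sigma> by (auto elim!: slab_cases)
    show "?I \<times> bmap j ` X \<subseteq> cyl_image j (slab X)"
    proof
      fix z assume "z \<in> ?I \<times> bmap j ` X"
      then obtain t y where ty: "z = (t, bmap j y)" "L/2 \<le> t" "t < L" "y \<in> X" by auto
      then have "\<kappa>' (\<kappa> (y, t)) = (y, t)" using X\<Sigma> L_pos by (intro \<kappa>'_\<kappa>) auto
      then show "z \<in> cyl_image j (slab X)"
        using ty by (intro image_eqI[of _ _ "\<kappa> (y, t)"]) (auto simp: slab_def)
    qed
  qed
  have bX: "bmap j ` X \<in> sets borel"
    using B.map_image_borel[of j X] j X by simp
  have c_meas: "(\<lambda>y. ennreal ((c y)\<^sup>2)) \<in> borel_measurable (restrict_space borel \<Sigma>)"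
    using borel_measurable_continuous_on_restrict[OF locally_constant_continuous[OF c]] by measurable
  have b_meas: "(\<lambda>v. ?b v * indicator (bmap j ` X) v) \<in> borel_measurable borel"
  proof -
    let ?V = "chart_map (boundary_atlas M) j ` chart_dom (boundary_atlas M) j"
    have "(\<lambda>y. ennreal ((c y)\<^sup>2)) \<in> borel_measurable (restrict_space borel (chart_dom (boundary_atlas M) j))"
      by (rule measurable_restrict_mono[OF c_meas]) simp
    then have "(\<lambda>v. ennreal ((c (?inv v))\<^sup>2)) \<in> borel_measurable (restrict_space borel ?V)"
      using measurable_compose[OF B.inv_measurable] j by simp
    moreover have "B.chart_density j \<in> borel_measurable (restrict_space borel ?V)"
      using B.chart_density_measurable j by simp
    ultimately have "?b \<in> borel_measurable (restrict_space borel ?V)" by measurable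
    then have "?b \<in> borel_measurable (restrict_space borel (bmap j ` X))"
      by (rule measurable_restrict_mono) (use X in auto)
    then show ?thesis using bX by (simp add: borel_measurable_restrict_space_iff_ennreal)
  qed
  have \<psi>_meas: "(\<lambda>t. ennreal ((\<psi> t)\<^sup>2) * indicator ?I t) \<in> borel_measurable borel"
    using borel_measurable_continuous_onI[OF \<psi>_cont] by measurable
  have split: "cylinder_density j z * indicator (?I \<times> bmap j ` X) z
      = (ennreal ((\<psi> (fst z))\<^sup>2) * indicator ?I (fst z)) * (?b (snd z) * indicator (bmap j ` X) (snd z))" for z
    by (cases z) (simp add: cylinder_density_def power_mult_distrib ennreal_mult mult_ac indicator_times)
  have prod_meas: "(\<lambda>z. cylinder_density j z * indicator (?I \<times> bmap j ` X) z) \<in> borel_measurable (lborel \<Otimes>\<^sub>M lborel)"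
    unfolding split
  proof (rule borel_measurable_times_ennreal)
    show "(\<lambda>z. ennreal ((\<psi> (fst z))\<^sup>2) * indicator ?I (fst z)) \<in> borel_measurable (lborel \<Otimes>\<^sub>M lborel)"
      by (rule measurable_compose[OF measurable_fst]) (use \<psi>_meas in simp)
    show "(\<lambda>z. ?b (snd z) * indicator (bmap j ` X) (snd z)) \<in> borel_measurable (lborel \<Otimes>\<^sub>M lborel)"
      by (rule measurable_compose[OF measurable_snd]) (use b_meas in simp)
  qed
  let ?S = "\<lambda>m. slab X \<inter> R.piece m"
  have "(\<integral>\<^sup>+p\<in>slab X. energy_density p \<partial>riemannian_measure M g')
      = (\<Sum>m. \<integral>\<^sup>+p\<in>?S m. energy_density p \<partial>riemannian_measure M g')"
    using energy_density_measurable slabX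
    by (intro R.nn_integral_pieces) (auto intro: measurable_restrict_space1)
  also have "\<dots> = (\<Sum>m. \<integral>\<^sup>+z\<in>cyl_image j (?S m). cylinder_density j z \<partial>lborel)"
  proof (intro suminf_cong chart_integral[OF j R.cover(1)])
    fix m
    show "?S m \<in> sets borel" using slabX R.piece_borel by blast
    show "?S m \<subseteq> slab (patch j \<inter> \<Sigma>)" using X by (auto simp: slab_def)
    show "?S m \<subseteq> patch (R.cover m)" using R.piece_dom by blast
  qed
  also have "\<dots> = (\<integral>\<^sup>+z\<in>(\<Union>m. cyl_image j (?S m)). cylinder_density j z \<partial>lborel)"
  proof (rule set_nn_integral_disjoint_UN[symmetric])
    have un: "(\<Union>m. cyl_image j (?S m)) = cyl_image j (slab X)"
      using R.UN_piece slabX(2) by blast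
    show "(\<lambda>z. cylinder_density j z * indicator (\<Union>m. cyl_image j (?S m)) z) \<in> borel_measurable lborel"
      unfolding un im using prod_meas by (simp add: lborel_prod)
    show "cyl_image j (?S m) \<in> sets lborel" for m
    proof -
      have "?S m \<in> sets borel" "?S m \<subseteq> slab (patch j \<inter> \<Sigma>)"
        using slabX R.piece_borel X by (auto simp: slab_def)
      then show ?thesis using cyl_image_borel[OF j] by simp
    qed
    show "disjoint_family (\<lambda>m. cyl_image j (?S m))"
    proof -
      have "inj_on (\<lambda>p. chart_map Cyl j (\<kappa>' p)) (slab X)"
      proof (rule inj_onI)
        fix p p' assume "p \<in> slab X" "p' \<in> slab X" and eq: "chart_map Cyl j (\<kappa>' p) = chart_map Cyl j (\<kappa>' p')"
        then obtain y t y' t' where yt: "y \<in> X" "p = \<kappa> (y, t)" "\<kappa>' p = (y, t)"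
          "y' \<in> X" "p' = \<kappa> (y', t')" "\<kappa>' p' = (y', t')"
          using X\<Sigma> by (metis slab_cases)
        then have "t = t'" "bmap j y = bmap j y'" using eq by simp_all
        then have "y = y'" using chart_inv_boundary_atlas[OF j] X yt by (metis IntD1 IntD2 subsetD)
        then show "p = p'" using \<open>t = t'\<close> yt by simp
      qed
      then show ?thesis
        using R.disjoint_piece unfolding disjoint_family_on_def inj_on_def by blast
    qed
  qed
  also have "(\<Union>m. cyl_image j (?S m)) = cyl_image j (slab X)"
    using R.UN_piece slabX(2) by blast
  also have "(\<integral>\<^sup>+z\<in>cyl_image j (slab X). cylinder_density j z \<partial>lborel)
      = (\<integral>\<^sup>+z. cylinder_density j z * indicator (?I \<times> bmap j ` X) z \<partial>(lborel \<Otimes>\<^sub>M lborel))"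
    by (simp only: im lborel_prod)
  also have "\<dots> = (\<integral>\<^sup>+t. \<integral>\<^sup>+v. cylinder_density j (t, v) * indicator (?I \<times> bmap j ` X) (t, v) \<partial>lborel \<partial>lborel)"
    using prod_meas by (rule lborel.nn_integral_fst[symmetric])
  also have "\<dots> = (\<integral>\<^sup>+t. (ennreal ((\<psi> t)\<^sup>2) * indicator ?I t) * (\<integral>\<^sup>+v\<in>bmap j ` X. ?b v \<partial>lborel) \<partial>lborel)"
    unfolding split fst_conv snd_conv using b_meas by (simp add: nn_integral_cmult)
  also have "\<dots> = (\<integral>\<^sup>+t\<in>?I. ennreal ((\<psi> t)\<^sup>2) \<partial>lborel) * (\<integral>\<^sup>+v\<in>bmap j ` X. ?b v \<partial>lborel)"
    using \<psi>_meas by (simp add: nn_integral_multc)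
  also have "(\<integral>\<^sup>+v\<in>bmap j ` X. ?b v \<partial>lborel)
      = (\<integral>\<^sup>+y\<in>X. ennreal ((c y)\<^sup>2) \<partial>riemannian_measure (boundary_atlas M) (induced_metric g'))"
    using B.nn_integral_riemannian_measure_chart[of j X "\<lambda>y. ennreal ((c y)\<^sup>2)"] j X c_meas
    by (simp add: points_boundary_atlas)
  finally show ?thesis .
qed

text \<open>A second decomposition, along pieces of the boundary, reduces the whole slab to sets
  over a single boundary chart. The height integral is the same for every piece and factors out of
  the sum.\<close>

lemma dirichlet_energy_ext:
  "dirichlet_energy M g' (ext c)
    = (\<integral>\<^sup>+t\<in>{L/2..<L}. ennreal ((\<psi> t)\<^sup>2) \<partial>lborel) * boundary_norm_sq M g' (ext c)"
proof -
  let ?J = "\<integral>\<^sup>+t\<in>{L/2..<L}. ennreal ((\<psi> t)\<^sup>2) \<partial>lborel"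
    and ?\<beta> = "riemannian_measure (boundary_atlas M) (induced_metric g')"
  have piece\<Sigma>: "B.piece n \<subseteq> \<Sigma>" for n
    using B.piece_dom[of n] by auto
  have un: "(\<Union>n. slab (B.piece n)) = slab \<Sigma>"
    using B.UN_piece unfolding points_boundary_atlas slab_def by blast
  have "dirichlet_energy M g' (ext c) = (\<integral>\<^sup>+p\<in>(\<Union>n. slab (B.piece n)). energy_density p \<partial>riemannian_measure M g')"
    unfolding un by (rule dirichlet_energy_eq)
  also have "\<dots> = (\<Sum>n. \<integral>\<^sup>+p\<in>slab (B.piece n). energy_density p \<partial>riemannian_measure M g')"
  proof (rule set_nn_integral_disjoint_UN)
    have eq: "energy_density p * indicator (slab \<Sigma>) p = energy_density p" for p
      by (simp add: energy_density_def indicator_def)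
    have "energy_density \<in> borel_measurable (restrict_space borel (points M))"
      using energy_density_measurable by (rule measurable_restrict_space1)
    then show "(\<lambda>p. energy_density p * indicator (\<Union>n. slab (B.piece n)) p) \<in> borel_measurable (riemannian_measure M g')"
      unfolding un eq using measurable_cong_sets[OF R.sets_riemannian_measure refl] by blast
    show "slab (B.piece n) \<in> sets (riemannian_measure M g')" for n
      using slab_borel[OF B.piece_borel piece\<Sigma>] slab_W[OF piece\<Sigma>] W_subset
      by (auto simp: R.sets_riemannian_measure R.sets_points)
    show "disjoint_family (\<lambda>n. slab (B.piece n))"
      unfolding disjoint_family_on_def
    proof (intro ballI impI)
      fix m n :: nat assume "m \<noteq> n"
      then have "B.piece m \<inter> B.piece n = {}"
        using B.disjoint_piece by (auto simp: disjoint_family_on_def)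
      then show "slab (B.piece m) \<inter> slab (B.piece n) = {}"
        using piece\<Sigma> by (metis (no_types, lifting) Int_emptyI disjoint_iff prod.inject slab_cases)
    qed
  qed
  also have "\<dots> = (\<Sum>n. ?J * (\<integral>\<^sup>+y\<in>B.piece n. ennreal ((c y)\<^sup>2) \<partial>?\<beta>))"
    using B.cover(1) B.piece_borel B.piece_dom by (intro suminf_cong slab_integral) auto
  also have "\<dots> = ?J * (\<Sum>n. \<integral>\<^sup>+y\<in>B.piece n. ennreal ((c y)\<^sup>2) \<partial>?\<beta>)"
    by (rule ennreal_suminf_cmult)
  also have "(\<Sum>n. \<integral>\<^sup>+y\<in>B.piece n. ennreal ((c y)\<^sup>2) \<partial>?\<beta>) = (\<integral>\<^sup>+y\<in>\<Sigma>. ennreal ((c y)\<^sup>2) \<partial>?\<beta>)"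
  proof -
    have "(\<lambda>y. ennreal ((c y)\<^sup>2)) \<in> borel_measurable (restrict_space borel \<Sigma>)"
      using borel_measurable_continuous_on_restrict[OF locally_constant_continuous[OF c]] by measurable
    from B.nn_integral_pieces[of _ \<Sigma>, unfolded points_boundary_atlas, OF this \<Sigma>_borel order_refl]
    show ?thesis using piece\<Sigma> by (simp add: Int_absorb1)
  qed
  also have "\<dots> = boundary_norm_sq M g' (ext c)"
    unfolding boundary_norm_sq_def
    by (rule nn_integral_cong) (simp add: B.space_riemannian_measure points_boundary_atlas ext_boundary)
  finally show ?thesis .
qed

lemma steklov_quotient_ext:
  assumes "y \<in> \<Sigma>" "c y \<noteq> 0"
  shows "steklov_quotient M g' (ext c) \<le> (\<integral>\<^sup>+t\<in>{L/2..<L}. ennreal ((\<psi> t)\<^sup>2) \<partial>lborel)"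
proof -
  \<comment> \<open>If b is 0 or infinite the quotient in \<open>ennreal\<close> is 0, so the
    inequality persists where cancellation fails.\<close>
  have "a * b / b \<le> a" for a b :: ennreal
  proof (cases "b = 0 \<or> b = top")
    case True
    then show ?thesis by (auto simp: divide_ennreal_def)
  next
    case False
    then show ?thesis by (simp add: ennreal_mult_divide_eq)
  qed
  moreover have "\<not> (\<forall>p\<in>\<Sigma>. ext c p = 0)" using assms ext_boundary by auto
  ultimately show ?thesis
    unfolding steklov_quotient_def dirichlet_energy_ext by (simp only: if_False)
qed

end

section \<open>The eigenvalue bound\<close>

context product_collar
begin

lemma locally_constant_add:
  assumes "locally_constant c" "locally_constant d"
  shows "locally_constant (\<lambda>y. c y + d y)"
  unfolding locally_constant_def
proof
  fix y assume y: "y \<in> \<Sigma>"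
  obtain S where S: "open S" "y \<in> S" "\<forall>z\<in>S \<inter> \<Sigma>. c z = c y"
    using locally_constantD[OF assms(1) y] .
  obtain T where T: "open T" "y \<in> T" "\<forall>z\<in>T \<inter> \<Sigma>. d z = d y"
    using locally_constantD[OF assms(2) y] .
  show "\<exists>T. open T \<and> y \<in> T \<and> (\<forall>z\<in>T \<inter> \<Sigma>. c z + d z = c y + d y)"
    using S T by (intro exI[of _ "S \<inter> T"]) (simp add: open_Int)
qed

lemma locally_constant_scale: "locally_constant c \<Longrightarrow> locally_constant (\<lambda>y. a * c y)"
  unfolding locally_constant_def by metis

text \<open>Components are closed, so with finitely many of them the union of the others is closed
  and each component is relatively open in \<Sigma>.\<close>

lemma locally_constant_indicator:
  assumes fin: "finite (components \<Sigma>)" and C: "C \<in> components \<Sigma>"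
  shows "locally_constant (indicator C)"
  unfolding locally_constant_def
proof
  have closed: "closed D" if "D \<in> components \<Sigma>" for D
    using closedin_component[OF that] compact_imp_closed[OF compact_\<Sigma>] closedin_closed_trans by blast
  fix y assume y: "y \<in> \<Sigma>"
  show "\<exists>T. open T \<and> y \<in> T \<and> (\<forall>z\<in>T \<inter> \<Sigma>. indicator C z = (indicator C y :: real))"
  proof (cases "y \<in> C")
    case True
    let ?T = "- \<Union>(components \<Sigma> - {C})"
    have "open ?T" using fin closed by (intro open_Compl closed_Union) auto
    moreover have "y \<in> ?T" using True C components_nonoverlap by fastforce
    moreover have "z \<in> C" if "z \<in> ?T \<inter> \<Sigma>" for z
      using that Union_components[of \<Sigma>] by blast
    ultimately show ?thesis using True by (intro exI[of _ ?T]) auto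
  next
    case False
    then show ?thesis using closed[OF C] by (intro exI[of _ "- C"]) auto
  qed
qed

end

context collar_cutoff
begin

section \<open>The test space spanned by the boundary components\<close>

definition test_function :: "'a set \<Rightarrow> 'a \<Rightarrow> real" where
  "test_function C = ext (indicator C)"

text \<open>Allows every element of the span of the test functions to be written as
  \<open>ext c\<close> with a single locally constant \<open>c\<close>, so the energy formula
  applies to it directly.\<close>

lemma subspace_ext: "fun_space.subspace {ext c | c. locally_constant c}"
proof (rule fun_space.subspaceI)
  have "locally_constant (\<lambda>_. 0)" by (auto simp: locally_constant_def)
  moreover have "ext (\<lambda>_. 0) = 0" by (auto simp: ext_def fun_eq_iff)
  ultimately show "0 \<in> {ext c | c. locally_constant c}" by force
  fix f h assume "f \<in> {ext c | c. locally_constant c}" "h \<in> {ext c | c. locally_constant c}"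
  then obtain c d where "f = ext c" "h = ext d" "locally_constant c" "locally_constant d" by blast
  moreover have "ext c + ext d = ext (\<lambda>y. c y + d y)"
    by (auto simp: ext_def fun_eq_iff distrib_right)
  ultimately show "f + h \<in> {ext c | c. locally_constant c}"
    using locally_constant_add by auto
next
  fix a f assume "f \<in> {ext c | c. locally_constant c}"
  then obtain c where "f = ext c" "locally_constant c" by blast
  moreover have "fun_scale a (ext c) = ext (\<lambda>y. a * c y)"
    by (auto simp: ext_def fun_eq_iff fun_scale_def)
  ultimately show "fun_scale a f \<in> {ext c | c. locally_constant c}"
    using locally_constant_scale by auto
qed

lemma test_function_component:
  assumes "C \<in> components \<Sigma>" "D \<in> components \<Sigma>" "y \<in> C"
  shows "test_function D y = (if D = C then 1 else 0)"
proof -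
  have "y \<in> \<Sigma>" using assms in_components_subset by blast
  moreover have "D \<noteq> C \<Longrightarrow> y \<notin> D" using assms components_nonoverlap by fastforce
  ultimately show ?thesis using assms(3) by (auto simp: test_function_def ext_boundary)
qed

lemma component_point:
  assumes "C \<in> components \<Sigma>"
  obtains y where "y \<in> C"
  using in_components_nonempty[OF assms] by blast

lemma inj_on_test_function: "inj_on test_function (components \<Sigma>)"
proof (rule inj_onI)
  fix C D assume C: "C \<in> components \<Sigma>" and D: "D \<in> components \<Sigma>" and eq: "test_function C = test_function D"
  obtain y where "y \<in> C" using component_point[OF C] .
  then show "C = D"
    using test_function_component[OF C C, of y] test_function_component[OF C D, of y] eq
    by (metis zero_neq_one)
qed

text \<open>Evaluation at a point of one component kills all other test functions, hence their span,
  but not the one of that component.\<close>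

lemma independent_test_functions: "fun_space.independent (test_function ` components \<Sigma>)"
  unfolding fun_space.dependent_def
proof
  let ?B = "test_function ` components \<Sigma>"
  assume "\<exists>f\<in>?B. f \<in> fun_space.span (?B - {f})"
  then obtain C where C: "C \<in> components \<Sigma>"
    and sp: "test_function C \<in> fun_space.span (?B - {test_function C})" by blast
  obtain y where y: "y \<in> C" using component_point[OF C] .
  have "fun_space.span (?B - {test_function C}) \<subseteq> {f. f y = 0}"
  proof (rule fun_space.span_minimal)
    show "?B - {test_function C} \<subseteq> {f. f y = 0}"
      using test_function_component[OF C _ y] by auto
    show "fun_space.subspace {f. f y = 0}"
      by (rule fun_space.subspaceI) (auto simp: fun_scale_def)
  qed
  then show False using sp test_function_component[OF C C y] by auto
qed

lemma steklov_eigenvalue_le: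
  assumes fin: "finite (components \<Sigma>)" and ne: "\<Sigma> \<noteq> {}"
  shows "steklov_eigenvalue M g' (card (components \<Sigma>))
    \<le> (\<integral>\<^sup>+t\<in>{L/2..<L}. ennreal ((\<psi> t)\<^sup>2) \<partial>lborel)"
proof -
  let ?B = "test_function ` components \<Sigma>"
  let ?E = "fun_space.span ?B"
  have E: "?E \<subseteq> {ext c | c. locally_constant c}"
  proof (rule fun_space.span_minimal[OF _ subspace_ext])
    show "?B \<subseteq> {ext c | c. locally_constant c}"
      using locally_constant_indicator[OF fin] by (auto simp: test_function_def)
  qed
  then have "?E \<subseteq> smooth_functions M" using ext_smooth by blast
  moreover have "card ?B = card (components \<Sigma>)" using inj_on_test_function by (rule card_image)
  ultimately have "?E \<in> subspaces_of_dim (card (components \<Sigma>)) (smooth_functions M)"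
    unfolding subspaces_of_dim_def using independent_test_functions fin by blast
  moreover have "(SUP f\<in>?E - {0}. steklov_quotient M g' f) \<le> (\<integral>\<^sup>+t\<in>{L/2..<L}. ennreal ((\<psi> t)\<^sup>2) \<partial>lborel)"
  proof (rule SUP_least)
    fix f assume f: "f \<in> ?E - {0}"
    then obtain c where c: "f = ext c" "locally_constant c" using E by blast
    interpret energy: collar_energy M g g' W L \<kappa> \<eta> \<psi> r c
      by unfold_locales (use c ne in auto)
    \<comment> \<open>\<open>ext c\<close> is determined by the values of \<open>c\<close> on
      \<Sigma>, so a nonzero element of the space cannot vanish on the boundary. This excludes the
      value \<infinity> in \<open>steklov_quotient\<close>.\<close>
    have "\<exists>y\<in>\<Sigma>. c y \<noteq> 0"
    proof (rule ccontr)
      assume "\<not> (\<exists>y\<in>\<Sigma>. c y \<noteq> 0)"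
      then have "ext c p = 0" for p
        by (cases "p \<in> W") (auto simp: ext_def elim!: collar_cases)
      then have "f = 0" by (simp add: c(1) fun_eq_iff)
      then show False using f by simp
    qed
    then show "steklov_quotient M g' f \<le> (\<integral>\<^sup>+t\<in>{L/2..<L}. ennreal ((\<psi> t)\<^sup>2) \<partial>lborel)"
      using energy.steklov_quotient_ext c(1) by blast
  qed
  ultimately show ?thesis
    unfolding steklov_eigenvalue_def by (rule INF_lower2)
qed

end

theorem proposition3p2:
  fixes M :: "('i, 'a::{t2_space,second_countable_topology}, real \<times> 'v::euclidean_space) atlas"
    and g g' :: "('i, 'a, real \<times> 'v) tensor2"
    and \<Sigma> W :: "'a set" and b :: nat and L :: real
    and \<kappa> :: "'a \<times> real \<Rightarrow> 'a"
  defines "\<Sigma> \<equiv> boundary M"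
  assumes "manifold_with_boundary M"
    and "compact (points M)" and "connected (points M)"
    and "riemannian_metric M g"
    and "card (components \<Sigma>) = b" and "b \<ge> 1"
    and "L > 0"
    and "openin (top_of_set (points M)) W" and "\<Sigma> \<subseteq> W"
    and "isometry (cylinder_atlas (boundary_atlas M) L) (product_metric (induced_metric g))
           (open_submanifold M W) g \<kappa>"
    and "\<forall>y\<in>\<Sigma>. \<kappa> (y, 0) = y"
    and "riemannian_metric M g'"
    and "\<forall>p\<in>\<Sigma> \<union> (points M - \<kappa> ` (\<Sigma> \<times> {0..<L/2})).
           \<forall>i\<in>charts M. p \<in> chart_dom M i \<longrightarrow> g' i p = g i p"
  shows "steklov_eigenvalue M g' b \<le> ennreal (2 / L)"
proof (rule ennreal_le_epsilon)
  fix \<epsilon> :: real assume "\<epsilon> > 0"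
  interpret bordered_manifold M by unfold_locales fact
  interpret product_collar M g g' W L \<kappa>
    by unfold_locales (use assms in auto)
  show "steklov_eigenvalue M g' b \<le> ennreal (2 / L) + ennreal \<epsilon>"
  proof (rule smooth_cutoff[OF \<open>L > 0\<close> \<open>\<epsilon> > 0\<close>])
    fix \<eta> \<psi> :: "real \<Rightarrow> real" and r
    assume cutoff: "\<And>k. Ck_on k \<eta> UNIV" "\<And>t. t \<le> L/2 \<Longrightarrow> \<eta> t = 1" "L/2 < r" "r < L"
      "\<And>t. r \<le> t \<Longrightarrow> \<eta> t = 0" "\<And>t. (\<eta> has_real_derivative \<psi> t) (at t)" "continuous_on UNIV \<psi>"
      and integral: "(\<integral>\<^sup>+t\<in>{L/2..<L}. ennreal ((\<psi> t)\<^sup>2) \<partial>lborel) \<le> ennreal (2 / L + \<epsilon>)"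
    interpret collar_cutoff M g g' W L \<kappa> \<eta> \<psi> r
      by unfold_locales (use cutoff in auto)
    \<comment> \<open>\<open>card\<close> is 0 on infinite sets, so b \<ge> 1 yields finitely many
      components, and at least one.\<close>
    have "finite (components (boundary M))" "boundary M \<noteq> {}"
      using assms by (auto intro: card_ge_0_finite)
    from steklov_eigenvalue_le[OF this]
    have "steklov_eigenvalue M g' b \<le> (\<integral>\<^sup>+t\<in>{L/2..<L}. ennreal ((\<psi> t)\<^sup>2) \<partial>lborel)"
      using assms by simp
    also note integral
    also have "ennreal (2 / L + \<epsilon>) = ennreal (2 / L) + ennreal \<epsilon>"
      using \<open>L > 0\<close> \<open>\<epsilon> > 0\<close> by (intro ennreal_plus) auto
    finally show ?thesis .
  qed
qed

end
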